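(* Let $\mathbb K$ be a field of characteristic zero and let $A=A(V,L,R,\sigma)$. Consider the degree-lexicographical order on words in the generators $x_1,\dots,x_m,a,b,c$ determined by $x_1>x_2>\dots>x_m>c>b>a$. Then $A$ is automaton with respect to this order, i.e. the set of normal words of $A$ is a regular language.
   Context: Let $m\ge1$, $V$ an $m$-dimensional $\mathbb K$-vector space with basis $X=\{x_1,\dots,x_m\}$, $L,R\subseteq V$ subspaces, and $\sigma$ a linear endomorphism of $V$. The algebra $A(V,L,R,\sigma)$ is the associative $\mathbb K$-algebra generated by $Y=X\cup\{a,b,c\}$ (all of degree $1$; $V$ is identified with the span of $x_1,\dots,x_m$ in degree one of the free algebra) subject to the homogeneous quadratic relations: $x_ix_j$ for all $i,j$; $ya$ and $by$ for all $y\in Y$; $a\ell$ for all $\ell\in L$; $\rho b$ for all $\rho\in R$; and $x_ic-c\,\sigma(x_i)$ for $i=1,\dots,m$. A degree-lexicographical order compares words first by length, then lexicographically. A word is normal if it is not the leading word of any element of the two-sided ideal of relations. *)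

theory Defs
  imports Main
begin

datatype gen = Xg nat | Ag | Bg | Cg

text \<open>Elements of the free algebra on the generators: coefficient functions on words
  (elements of the ideal below are automatically finitely supported).\<close>
type_synonym 'k ncpoly = "gen list \<Rightarrow> 'k"

definition gens :: "nat \<Rightarrow> gen set" where
  "gens m = Xg ` {1..m} \<union> {Ag, Bg, Cg}"

definition mon :: "gen list \<Rightarrow> 'k::field ncpoly" where
  "mon w = (\<lambda>u. if u = w then 1 else 0)"

definition rank :: "nat \<Rightarrow> gen \<Rightarrow> nat" where
  "rank m g = (case g of Ag \<Rightarrow> 0 | Bg \<Rightarrow> 1 | Cg \<Rightarrow> 2 | Xg i \<Rightarrow> 3 + (m - i))"

definition deglex_less :: "nat \<Rightarrow> gen list \<Rightarrow> gen list \<Rightarrow> bool" where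
  "deglex_less m u v \<longleftrightarrow> length u < length v \<or>
     (length u = length v \<and> (u, v) \<in> lexord {(x, y). rank m x < rank m y})"

text \<open>V = span of x_1..x_m, represented by coefficient vectors supported in {1..m}.\<close>
definition vecs :: "nat \<Rightarrow> (nat \<Rightarrow> 'k::field) set" where
  "vecs m = {v. \<forall>i. i \<notin> {1..m} \<longrightarrow> v i = 0}"

definition unitv :: "nat \<Rightarrow> (nat \<Rightarrow> 'k::field)" where
  "unitv i = (\<lambda>j. if j = i then 1 else 0)"

definition is_subspace :: "nat \<Rightarrow> (nat \<Rightarrow> 'k::field) set \<Rightarrow> bool" where
  "is_subspace m S \<longleftrightarrow> S \<subseteq> vecs m \<and> (\<lambda>_. 0) \<in> S \<and>
     (\<forall>u\<in>S. \<forall>v\<in>S. (\<lambda>i. u i + v i) \<in> S) \<and> (\<forall>c. \<forall>u\<in>S. (\<lambda>i. c * u i) \<in> S)"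

definition is_lin_endo :: "nat \<Rightarrow> ((nat \<Rightarrow> 'k::field) \<Rightarrow> (nat \<Rightarrow> 'k)) \<Rightarrow> bool" where
  "is_lin_endo m f \<longleftrightarrow> (\<forall>v\<in>vecs m. f v \<in> vecs m) \<and>
     (\<forall>u\<in>vecs m. \<forall>v\<in>vecs m. f (\<lambda>i. u i + v i) = (\<lambda>i. f u i + f v i)) \<and>
     (\<forall>c. \<forall>u\<in>vecs m. f (\<lambda>i. c * u i) = (\<lambda>i. c * f u i))"

definition relations :: "nat \<Rightarrow> (nat \<Rightarrow> 'k::field) set \<Rightarrow> (nat \<Rightarrow> 'k) set
    \<Rightarrow> ((nat \<Rightarrow> 'k) \<Rightarrow> (nat \<Rightarrow> 'k)) \<Rightarrow> 'k ncpoly set" where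
  "relations m L R \<sigma> =
     {mon [Xg i, Xg j] | i j. i \<in> {1..m} \<and> j \<in> {1..m}}
   \<union> {mon [y, Ag] | y. y \<in> gens m}
   \<union> {mon [Bg, y] | y. y \<in> gens m}
   \<union> {(\<lambda>u. \<Sum>j\<in>{1..m}. l j * mon [Ag, Xg j] u) | l. l \<in> L}
   \<union> {(\<lambda>u. \<Sum>j\<in>{1..m}. \<rho> j * mon [Xg j, Bg] u) | \<rho>. \<rho> \<in> R}
   \<union> {(\<lambda>u. mon [Xg i, Cg] u - (\<Sum>j\<in>{1..m}. \<sigma> (unitv i) j * mon [Cg, Xg j] u)) | i. i \<in> {1..m}}"

text \<open>u r v for words u, v and a polynomial r.\<close>
definition wrap :: "gen list \<Rightarrow> 'k::field ncpoly \<Rightarrow> gen list \<Rightarrow> 'k ncpoly" where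
  "wrap u r v = (\<lambda>w. if \<exists>y. w = u @ y @ v then r (THE y. w = u @ y @ v) else 0)"

inductive_set rel_ideal :: "nat \<Rightarrow> (nat \<Rightarrow> 'k::field) set \<Rightarrow> (nat \<Rightarrow> 'k) set
    \<Rightarrow> ((nat \<Rightarrow> 'k) \<Rightarrow> (nat \<Rightarrow> 'k)) \<Rightarrow> 'k ncpoly set"
  for m L R \<sigma> where
  zero: "(\<lambda>_. 0) \<in> rel_ideal m L R \<sigma>"
| add: "p \<in> rel_ideal m L R \<sigma> \<Longrightarrow> q \<in> rel_ideal m L R \<sigma> \<Longrightarrow> (\<lambda>w. p w + q w) \<in> rel_ideal m L R \<sigma>"
| gen: "r \<in> relations m L R \<sigma> \<Longrightarrow> u \<in> lists (gens m) \<Longrightarrow> v \<in> lists (gens m) \<Longrightarrow>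
        (\<lambda>w. c * wrap u r v w) \<in> rel_ideal m L R \<sigma>"

definition is_leading_word :: "nat \<Rightarrow> 'k::field ncpoly \<Rightarrow> gen list \<Rightarrow> bool" where
  "is_leading_word m f w \<longleftrightarrow> f w \<noteq> 0 \<and> (\<forall>u. f u \<noteq> 0 \<longrightarrow> u = w \<or> deglex_less m u w)"

definition normal_words :: "nat \<Rightarrow> (nat \<Rightarrow> 'k::field) set \<Rightarrow> (nat \<Rightarrow> 'k) set
    \<Rightarrow> ((nat \<Rightarrow> 'k) \<Rightarrow> (nat \<Rightarrow> 'k)) \<Rightarrow> gen list set" where
  "normal_words m L R \<sigma> = {w \<in> lists (gens m). \<not> (\<exists>f \<in> rel_ideal m L R \<sigma>. is_leading_word m f w)}"

definition regular_lang :: "'a set \<Rightarrow> 'a list set \<Rightarrow> bool" where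
  "regular_lang \<Sigma> Lang \<longleftrightarrow> (\<exists>(Q :: nat set) q0 \<delta> F. finite Q \<and> q0 \<in> Q \<and> F \<subseteq> Q \<and>
     (\<forall>q\<in>Q. \<forall>g\<in>\<Sigma>. \<delta> q g \<in> Q) \<and> Lang = {w \<in> lists \<Sigma>. foldl \<delta> q0 w \<in> F})"

end

theory Submission
  imports Defs "HOL-Computational_Algebra.Polynomial" "HOL-Computational_Algebra.Primes"
    "HOL-Library.FuncSet" "HOL-Library.Function_Algebras"
begin

text \<open>The relation \<open>x c = c \<sigma>(x)\<close> moves every \<open>c\<close> to the left, so a nonzero word is equivalent to a
  combination of words \<open>p c^n s\<close> and \<open>p c^n x_i s\<close> with \<open>p\<close> empty or \<open>a\<close> and \<open>s\<close> empty or \<open>b\<close>. The vectors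
  \<open>y\<close> with \<open>a c^n y b = 0\<close> form the space \<open>\<sigma>^n(L) + R\<close>, so \<open>a c^n x_i b\<close> fails to be normal iff \<open>x_i\<close> lies in
  \<open>\<sigma>^n(L) + R + span {x_j | j > i}\<close>, and similarly for the other choices of \<open>p\<close> and \<open>s\<close>. Regularity thus
  amounts to the eventual periodicity of the set of such \<open>n\<close>, which is a Skolem-Mahler-Lech statement.
  The finitely many scalars involved lie in a ring \<open>S\<close> that is separated for the p-adic topology and
  in which they have finitely many residues modulo \<open>p\<close>. Hence, along suitable arithmetic
  progressions, the k-th differences of the entries of \<open>\<sigma>^n\<close> are divisible by \<open>p^k\<close>. Sequences with this
  property form a ring in which a nonzero element has only finitely many zeros, and Gaussian
  elimination over this ring decides membership in the span for all but finitely many \<open>n\<close> at once.\<close>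

section \<open>Subrings and polynomials over them\<close>

text \<open>The ring \<open>S\<close> is built inside the given field, one generator at a time,
  starting from a localisation of the integers; of the p-adic integers it keeps only that an element
  divisible by all powers of \<open>p\<close> is 0. The pigeonhole argument for a period needs
  finitely many residues, and adjoining a transcendental element destroys this for \<open>S\<close>;
  it is kept for a subring \<open>B\<close> holding the scalars of the recurrence. Divisibility of
  differences comes from one observation: if \<open>N\<close> is a period modulo \<open>p\<close> of
  all solutions with values in \<open>S\<close>, then \<open>(w (n + N) - w n) / p\<close> is again
  such a solution, so every further difference with step \<open>N\<close> gains a factor
  \<open>p\<close>. A singular \<sigma> costs only an initial segment, after which the recurrence
  can be run backwards. The prime is odd because k! contains \<open>p\<close> at most k / (p - 1)
  times: for \<open>p > 2\<close> at least half of the factor p^k survives division by k!, and that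
  surplus grows with k. In characteristic p the approach has to fail: (1 + t)^n - t^n - 1 over
  F_p(t) vanishes exactly when n is a power of p.\<close>

definition unital_subring :: "'a::comm_ring_1 set \<Rightarrow> bool" where
  "unital_subring S \<longleftrightarrow> 1 \<in> S \<and> (\<forall>x\<in>S. \<forall>y\<in>S. x - y \<in> S \<and> x * y \<in> S)"

lemma unital_subringI:
  assumes "1 \<in> S" "\<And>x y. x \<in> S \<Longrightarrow> y \<in> S \<Longrightarrow> x - y \<in> S" "\<And>x y. x \<in> S \<Longrightarrow> y \<in> S \<Longrightarrow> x * y \<in> S"
  shows "unital_subring S"
  using assms by (auto simp: unital_subring_def)

lemma
  assumes "unital_subring S"
  shows subring_1: "1 \<in> S"
    and subring_diff: "x \<in> S \<Longrightarrow> y \<in> S \<Longrightarrow> x - y \<in> S"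
    and subring_mult: "x \<in> S \<Longrightarrow> y \<in> S \<Longrightarrow> x * y \<in> S"
    and subring_0: "0 \<in> S"
    and subring_uminus: "x \<in> S \<Longrightarrow> - x \<in> S"
    and subring_add: "x \<in> S \<Longrightarrow> y \<in> S \<Longrightarrow> x + y \<in> S"
proof -
  note * = assms[unfolded unital_subring_def]
  show "1 \<in> S" and d: "\<And>x y. x \<in> S \<Longrightarrow> y \<in> S \<Longrightarrow> x - y \<in> S" and "x \<in> S \<Longrightarrow> y \<in> S \<Longrightarrow> x * y \<in> S"
    using * by auto
  show z: "0 \<in> S" using d[of 1 1] * by auto
  show u: "- x \<in> S" if "x \<in> S" for x using d[OF z that] by simp
  show "x + y \<in> S" if "x \<in> S" "y \<in> S" using d[OF that(1) u[OF that(2)]] by simp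
qed

lemma subring_sum:
  assumes "unital_subring S" "\<And>i. i \<in> A \<Longrightarrow> f i \<in> S" shows "sum f A \<in> S"
  using assms(2) by (induction A rule: infinite_finite_induct)
    (auto intro: subring_0[OF assms(1)] subring_add[OF assms(1)])

lemma subring_power:
  assumes "unital_subring S" "x \<in> S" shows "x ^ n \<in> S"
  by (induction n) (auto intro: subring_1[OF assms(1)] subring_mult[OF assms(1)] assms(2))

lemma subring_of_nat:
  assumes "unital_subring S" shows "of_nat n \<in> S"
  by (induction n) (auto intro: subring_1[OF assms(1)] subring_add[OF assms(1)] subring_0[OF assms(1)])

lemma subring_of_int:
  assumes "unital_subring S" shows "of_int n \<in> S"
  by (cases n) (auto intro!: subring_of_nat[OF assms] subring_diff[OF assms] subring_uminus[OF assms] subring_1[OF assms])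

lemmas subring_closure = subring_0 subring_1 subring_diff subring_mult subring_uminus subring_add
  subring_sum subring_power subring_of_nat subring_of_int

text \<open>Polynomials over a subring are singled out inside the polynomials over the ambient type,
  since the rings that occur depend on the given scalars and cannot be types.\<close>

definition polys :: "'a::zero set \<Rightarrow> 'a poly set" where
  "polys S = {f. \<forall>i. coeff f i \<in> S}"

lemma polys_coeff: "f \<in> polys S \<Longrightarrow> coeff f i \<in> S"
  by (simp add: polys_def)

lemma polys_subring:
  assumes "unital_subring S" shows "unital_subring (polys S)"
proof (rule unital_subringI)
  show "1 \<in> polys S"
    by (simp add: polys_def coeff_1 subring_0[OF assms] subring_1[OF assms])
  show "f - g \<in> polys S" "f * g \<in> polys S" if "f \<in> polys S" "g \<in> polys S" for f g
    using that
    by (simp_all add: polys_def coeff_mult subring_sum[OF assms] subring_mult[OF assms] subring_diff[OF assms])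
qed

lemma polys_const: "unital_subring S \<Longrightarrow> c \<in> S \<Longrightarrow> [:c:] \<in> polys S"
  by (auto simp: polys_def coeff_pCons subring_0 split: nat.split)

lemma polys_pCons: "unital_subring S \<Longrightarrow> c \<in> S \<Longrightarrow> f \<in> polys S \<Longrightarrow> pCons c f \<in> polys S"
  by (auto simp: polys_def coeff_pCons split: nat.split)

lemma polys_pConsD:
  assumes "pCons c f \<in> polys S" shows "c \<in> S \<and> f \<in> polys S"
  using polys_coeff[OF assms, of 0] polys_coeff[OF assms, of "Suc n" for n] by (simp add: polys_def)

lemma polys_smult: "unital_subring S \<Longrightarrow> c \<in> S \<Longrightarrow> f \<in> polys S \<Longrightarrow> smult c f \<in> polys S"
  by (simp add: polys_def subring_mult)

lemma polys_monom: "unital_subring S \<Longrightarrow> c \<in> S \<Longrightarrow> monom c n \<in> polys S"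
  by (simp add: polys_def subring_0)

lemma polys_mono: "S \<subseteq> S' \<Longrightarrow> polys S \<subseteq> polys S'"
  by (auto simp: polys_def)

lemma polys_prod:
  assumes "unital_subring S" "\<And>i. i \<in> A \<Longrightarrow> f i \<in> polys S" shows "prod f A \<in> polys S"
  using assms(2) by (induction A rule: infinite_finite_induct)
    (auto intro: subring_1[OF polys_subring[OF assms(1)]] subring_mult[OF polys_subring[OF assms(1)]])

lemma polys_eval:
  assumes "unital_subring S" "f \<in> polys S" "x \<in> S" shows "poly f x \<in> S"
  unfolding poly_altdef using polys_coeff[OF assms(2)] assms(3)
  by (intro subring_sum[OF assms(1)] subring_mult[OF assms(1)] subring_power[OF assms(1)])

lemma polys_pcompose:
  assumes S: "unital_subring S" and "f \<in> polys S" "g \<in> polys S" shows "pcompose f g \<in> polys S"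
  using assms(2)
proof (induction f)
  case 0
  then show ?case by simp
next
  case (pCons a f)
  then show ?case
    using polys_pConsD[OF pCons.prems] assms(3)
    by (auto simp: pcompose_pCons intro!: subring_add[OF polys_subring[OF S]]
        subring_mult[OF polys_subring[OF S]] polys_const[OF S])
qed

text \<open>Long division divides only by the leading coefficient of \<open>g\<close>. This covers
  monic divisors over a ring as well as arbitrary divisors over a subfield.\<close>

lemma polys_division:
  fixes f g :: "'a::field poly"
  assumes S: "unital_subring S" and f: "f \<in> polys S" and g: "g \<in> polys S" "g \<noteq> 0"
    and inv: "inverse (lead_coeff g) \<in> S"
  obtains q r where "q \<in> polys S" "r \<in> polys S" "f = q * g + r" "r = 0 \<or> degree r < degree g"
proof -
  note PS = polys_subring[OF S]
  have "\<exists>q\<in>polys S. \<exists>r\<in>polys S. f = q * g + r \<and> (r = 0 \<or> degree r < degree g)"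
    using f
  proof (induction "degree f" arbitrary: f rule: less_induct)
    case less
    show ?case
    proof (cases "f = 0 \<or> degree f < degree g")
      case True
      with less.prems show ?thesis
        by (intro bexI[of _ 0] bexI[of _ f]) (auto intro: subring_0[OF PS])
    next
      case False
      define h where "h = monom (lead_coeff f * inverse (lead_coeff g)) (degree f - degree g)"
      have h: "h \<in> polys S"
        unfolding h_def using less.prems inv
        by (intro polys_monom[OF S] subring_mult[OF S] polys_coeff)
      have lf: "lead_coeff f * inverse (lead_coeff g) \<noteq> 0" using False g by simp
      have dh: "degree (h * g) = degree f"
        using False g lf by (simp add: h_def degree_mult_eq degree_monom_eq monom_eq_0_iff)
      have lh: "lead_coeff (h * g) = lead_coeff f"
        using g lf by (simp only: lead_coeff_mult h_def lead_coeff_monom) (simp add: g)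
      have mem: "f - h * g \<in> polys S"
        using less.prems h g by (intro subring_diff[OF PS] subring_mult[OF PS])
      have "f - h * g = 0 \<or> degree (f - h * g) < degree f"
        using dh lh by (metis coeff_diff degree_diff_le diff_self le_refl leading_coeff_0_iff nat_less_le)
      then obtain q r where qr: "q \<in> polys S" "r \<in> polys S" "f - h * g = q * g + r"
          "r = 0 \<or> degree r < degree g"
        using less.hyps[OF _ mem] subring_0[OF PS] by (metis mult_zero_left add_0_left)
      then show ?thesis
        using h by (intro bexI[of _ "h + q"] bexI[of _ r])
          (auto simp: algebra_simps intro: subring_add[OF PS])
    qed
  qed
  then show ?thesis using that by blast
qed

section \<open>Zeros of p-adically analytic sequences\<close>

text \<open>The ideal p^k S. \<open>S\<close> has to be named because divisibility in the ambient
  field says nothing.\<close>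

definition ppow_multiples :: "nat \<Rightarrow> nat \<Rightarrow> 'a::comm_ring_1 set \<Rightarrow> 'a set" where
  "ppow_multiples p k S = (\<lambda>y. of_nat p ^ k * y) ` S"

lemma ppow_multiples_0 [simp]: "ppow_multiples p 0 S = S"
  by (simp add: ppow_multiples_def)

lemma ppow_multiplesI: "y \<in> S \<Longrightarrow> of_nat p ^ k * y \<in> ppow_multiples p k S"
  by (simp add: ppow_multiples_def)

lemma
  assumes S: "unital_subring S"
  shows ppow_multiples_add:
      "x \<in> ppow_multiples p k S \<Longrightarrow> y \<in> ppow_multiples p k S \<Longrightarrow> x + y \<in> ppow_multiples p k S"
    and ppow_multiples_diff:
      "x \<in> ppow_multiples p k S \<Longrightarrow> y \<in> ppow_multiples p k S \<Longrightarrow> x - y \<in> ppow_multiples p k S"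
    and ppow_multiples_zero: "0 \<in> ppow_multiples p k S"
    and ppow_multiples_mult:
      "x \<in> ppow_multiples p k S \<Longrightarrow> z \<in> S \<Longrightarrow> x * z \<in> ppow_multiples p k S"
    and ppow_multiples_mult_left:
      "x \<in> ppow_multiples p k S \<Longrightarrow> z \<in> S \<Longrightarrow> z * x \<in> ppow_multiples p k S"
    and ppow_multiples_prod:
      "x \<in> ppow_multiples p k S \<Longrightarrow> w \<in> ppow_multiples p l S \<Longrightarrow> x * w \<in> ppow_multiples p (k + l) S"
    and ppow_multiples_subset: "ppow_multiples p k S \<subseteq> S"
    and ppow_multiples_antimono: "k \<le> l \<Longrightarrow> ppow_multiples p l S \<subseteq> ppow_multiples p k S"
proof -
  note c = subring_closure[OF S]
  show "x \<in> ppow_multiples p k S \<Longrightarrow> y \<in> ppow_multiples p k S \<Longrightarrow> x + y \<in> ppow_multiples p k S"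
    unfolding ppow_multiples_def by (auto simp: distrib_left[symmetric] intro!: imageI c)
  show "x \<in> ppow_multiples p k S \<Longrightarrow> y \<in> ppow_multiples p k S \<Longrightarrow> x - y \<in> ppow_multiples p k S"
    unfolding ppow_multiples_def by (auto simp: right_diff_distrib[symmetric] intro!: imageI c)
  show "0 \<in> ppow_multiples p k S"
    unfolding ppow_multiples_def by (rule image_eqI[of _ _ 0]) (auto intro: c)
  show "x \<in> ppow_multiples p k S \<Longrightarrow> z \<in> S \<Longrightarrow> x * z \<in> ppow_multiples p k S"
    unfolding ppow_multiples_def by (auto simp: mult.assoc intro!: imageI c)
  then show "x \<in> ppow_multiples p k S \<Longrightarrow> z \<in> S \<Longrightarrow> z * x \<in> ppow_multiples p k S"
    by (simp add: mult.commute)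
  show "x * w \<in> ppow_multiples p (k + l) S"
    if x: "x \<in> ppow_multiples p k S" and w: "w \<in> ppow_multiples p l S"
  proof -
    obtain a b where "a \<in> S" "b \<in> S" "x = of_nat p ^ k * a" "w = of_nat p ^ l * b"
      using x w by (auto simp: ppow_multiples_def)
    then show ?thesis
      unfolding ppow_multiples_def
      by (intro image_eqI[of _ _ "a * b"]) (auto simp: power_add algebra_simps intro: c)
  qed
  show "ppow_multiples p k S \<subseteq> S"
    unfolding ppow_multiples_def by (auto intro!: c)
  show "ppow_multiples p l S \<subseteq> ppow_multiples p k S" if "k \<le> l"
  proof
    fix x assume "x \<in> ppow_multiples p l S"
    then obtain y where "y \<in> S" "x = of_nat p ^ l * y" by (auto simp: ppow_multiples_def)
    then have "x = of_nat p ^ k * (of_nat p ^ (l - k) * y)"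
      using that by (simp add: mult.assoc[symmetric] power_add[symmetric])
    then show "x \<in> ppow_multiples p k S"
      using \<open>y \<in> S\<close> by (auto simp: ppow_multiples_def intro!: imageI c)
  qed
qed

lemma ppow_multiples_sum:
  assumes S: "unital_subring S" and "\<And>i. i \<in> A \<Longrightarrow> f i \<in> ppow_multiples p k S"
  shows "sum f A \<in> ppow_multiples p k S"
  using assms(2) by (induction A rule: infinite_finite_induct)
    (auto intro: ppow_multiples_zero[OF S] ppow_multiples_add[OF S])

text \<open>Legendre's bound for the exponent of \<open>p\<close> in k!. The multiples of
  \<open>p\<close> among 1, ..., p l contribute p^l l!, so with \<open>l = k div p\<close> the
  exponent at k is l plus the exponent at l.\<close>

lemma fact_decomposition:
  assumes p: "prime (p::nat)"
  shows "\<exists>e q. fact k = p ^ e * q \<and> coprime p q \<and> (p - 1) * e \<le> k"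
proof -
  have p2: "p \<ge> 2" using p prime_ge_2_nat by blast
  have mult: "\<exists>q. fact (p * l) = p ^ l * fact l * q \<and> coprime p q" for l
  proof (induction l)
    case 0
    show ?case by (intro exI[of _ 1]) simp
  next
    case (Suc l)
    then obtain q where q: "fact (p * l) = p ^ l * fact l * q" "coprime p q" by auto
    define r where "r = (\<Prod>i\<in>{1..<p}. p * l + i)"
    have r: "coprime p r"
      unfolding r_def
    proof (rule prod_coprime_right)
      fix i assume "i \<in> {1..<p}"
      then have "\<not> p dvd p * l + i"
        using dvd_add_right_iff[of p "p * l" i] by (auto dest: dvd_imp_le)
      with p show "coprime p (p * l + i)" by (rule prime_imp_coprime)
    qed
    have step: "fact (p * l + j) = fact (p * l) * (\<Prod>i\<in>{1..<Suc j}. p * l + i)" for j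
      by (induction j) (simp_all add: algebra_simps)
    have *: "{1..<Suc p} = insert p {1..<p}" using p2 by auto
    have "fact (p * l + p) = fact (p * l) * (p * Suc l * r)"
      unfolding step * r_def by (subst prod.insert) (auto simp: algebra_simps)
    then have "fact (p * Suc l) = p ^ Suc l * fact (Suc l) * (q * r)"
      using q by (simp add: algebra_simps)
    then show ?case using q r by auto
  qed
  show ?thesis
  proof (induction k rule: less_induct)
    case (less k)
    show ?case
    proof (cases "k < p")
      case True
      then have "\<not> p dvd fact k" using p by (simp add: prime_dvd_fact_iff)
      then have "coprime p (fact k)" using p by (simp add: prime_imp_coprime)
      then show ?thesis by (intro exI[of _ 0] exI[of _ "fact k"]) simp
    next
      case False
      define l where "l = k div p"
      have "l < k" using False p2 by (simp add: l_def)
      then obtain e q where e: "fact l = p ^ e * q" "coprime p q" "(p - 1) * e \<le> l"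
        using less.IH by blast
      obtain q' where q': "fact (p * l) = p ^ l * fact l * q'" "coprime p q'" using mult by blast
      have "\<exists>r. fact (p * l + j) = fact (p * l) * r \<and> coprime p r" if "j < p" for j
        using that
      proof (induction j)
        case 0
        show ?case by (intro exI[of _ 1]) simp
      next
        case (Suc j)
        then obtain r where r: "fact (p * l + j) = fact (p * l) * r" "coprime p r" by auto
        have "\<not> p dvd p * l + Suc j"
          using Suc.prems dvd_add_right_iff[of p "p * l" "Suc j"] by (auto dest: dvd_imp_le)
        then have "coprime p (p * l + Suc j)" using p by (simp add: prime_imp_coprime)
        then have "coprime p ((p * l + Suc j) * r)" using r by (metis coprime_mult_right_iff)
        moreover have "fact (p * l + Suc j) = fact (p * l) * ((p * l + Suc j) * r)"
          using r(1) by (simp add: algebra_simps)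
        ultimately show ?case by blast
      qed
      from this[of "k mod p"] obtain r where r: "fact k = fact (p * l) * r" "coprime p r"
        using p2 by (auto simp: l_def)
      have "fact k = p ^ (l + e) * (q * q' * r)"
        using r q' e by (simp add: power_add algebra_simps)
      moreover have "coprime p (q * q' * r)" using r q' e by simp
      moreover have "(p - 1) * (l + e) \<le> k"
      proof -
        have "(p - 1) * (l + e) \<le> (p - 1) * l + l" using e(3) by (simp add: distrib_left)
        also have "\<dots> = p * l" using p2 by (cases p) auto
        also have "\<dots> \<le> k" by (simp add: l_def)
        finally show ?thesis .
      qed
      ultimately show ?thesis by blast
    qed
  qed
qed

text \<open>Dividing by a factor \<open>x - z\<close> lowers by one the index from which on all coefficients lie
  in a given subgroup; after as many zeros as needed, all coefficients do.\<close>

lemma poly_value_in_ideal_of_roots: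
  fixes P :: "'a::field_char_0 poly"
  assumes S: "unital_subring S" and I: "I = ppow_multiples p k S"
    and "finite A" "\<And>z. z \<in> A \<Longrightarrow> poly P (of_nat z) = 0"
    and "\<And>i. i \<ge> card A \<Longrightarrow> coeff P i \<in> I"
  shows "poly P (of_nat t) \<in> I"
  using assms(3-)
proof (induction A arbitrary: P rule: finite_induct)
  case empty
  then show ?case
    unfolding poly_altdef I using S
    by (intro ppow_multiples_sum[OF S] ppow_multiples_mult[OF S] subring_power subring_of_nat) (auto simp: I)
next
  case (insert z A)
  then obtain Q where Q: "P = [:- of_nat z, 1:] * Q"
    by (metis dvdE insertI1 poly_eq_0_iff_dvd)
  have z: "of_nat z \<in> S" using S by (rule subring_of_nat)
  have rec: "coeff Q i = coeff P (Suc i) + coeff Q (Suc i) * of_nat z" for i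
    by (simp add: Q)
  have "coeff Q i \<in> I" if "i \<ge> card A" for i
  proof (cases "i \<le> degree Q")
    case True
    then show ?thesis
      using that
    \<comment> \<open>Downwards from the degree, since \<open>rec\<close> expresses each coefficient
      of \<open>Q\<close> by the next higher one.\<close>
    proof (induction i rule: inc_induct)
      case base
      then show ?case
        using insert.prems(2)[of "Suc (degree Q)"] insert.hyps by (simp add: rec[of "degree Q"] coeff_eq_0)
    next
      case (step i)
      then have "coeff Q (Suc i) * of_nat z \<in> I"
        using ppow_multiples_mult[OF S _ z] by (auto simp: I)
      moreover have "coeff P (Suc i) \<in> I" using step insert by simp
      ultimately show ?case using ppow_multiples_add[OF S] by (simp add: rec[of i] I)
    qed
  next
    case False
    then show ?thesis using ppow_multiples_zero[OF S] by (simp add: coeff_eq_0 I)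
  qed
  moreover have "poly Q (of_nat y) = 0" if "y \<in> A" for y
  proof -
    have "y \<noteq> z" using that insert.hyps by auto
    then show ?thesis using insert.prems(1)[of y] that by (auto simp: Q)
  qed
  ultimately have "poly Q (of_nat t) \<in> I" by (intro insert.IH) auto
  then have "poly Q (of_nat t) * (of_nat t - of_nat z) \<in> I"
    using S I by (auto intro!: ppow_multiples_mult subring_diff subring_of_nat)
  then show ?case by (simp add: Q algebra_simps)
qed

definition fdiff :: "(nat \<Rightarrow> 'a::ab_group_add) \<Rightarrow> nat \<Rightarrow> 'a" where
  "fdiff u n = u (Suc n) - u n"

text \<open>The shift is 1 + \<open>fdiff\<close>, and this is its n-th power. The exponent
  \<open>j\<close> is carried along because the step uses the hypothesis for \<open>j\<close> and
  for \<open>j + 1\<close>.\<close>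

lemma newton_forward:
  fixes u :: "nat \<Rightarrow> 'a::comm_ring_1"
  shows "(fdiff ^^ j) u n = (\<Sum>k\<le>n. of_nat (n choose k) * (fdiff ^^ (k + j)) u 0)"
proof (induction n arbitrary: j)
  case 0
  show ?case by simp
next
  case (Suc n)
  define D where "D k = (fdiff ^^ (k + j)) u 0" for k
  have D: "(fdiff ^^ (k + Suc j)) u 0 = D (Suc k)" for k by (simp add: D_def)
  have "(fdiff ^^ j) u (Suc n) = (fdiff ^^ j) u n + (fdiff ^^ Suc j) u n"
    by (simp add: fdiff_def)
  also have "\<dots> = (\<Sum>k\<le>n. of_nat (n choose k) * D k) + (\<Sum>k\<le>n. of_nat (n choose k) * D (Suc k))"
    unfolding Suc D by (simp add: D_def)
  also have "(\<Sum>k\<le>n. of_nat (n choose k) * D k) = (\<Sum>k\<le>Suc n. of_nat (n choose k) * D k)"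
    by (simp add: binomial_eq_0)
  also have "\<dots> = D 0 + (\<Sum>k\<le>n. of_nat (n choose Suc k) * D (Suc k))"
    by (subst sum.atMost_Suc_shift) simp
  also have "\<dots> + (\<Sum>k\<le>n. of_nat (n choose k) * D (Suc k))
      = D 0 + (\<Sum>k\<le>n. of_nat (Suc n choose Suc k) * D (Suc k))"
    by (simp add: sum.distrib[symmetric] algebra_simps)
  also have "\<dots> = (\<Sum>k\<le>Suc n. of_nat (Suc n choose k) * D k)"
    by (subst sum.atMost_Suc_shift) simp
  finally show ?case by (simp add: D_def)
qed

text \<open>A variant of Strassmann's theorem with a finite Newton sum in place of a power series.
  On 0, ..., n the sequence n! u is a polynomial whose coefficients from index 2 j on are divisible
  by p^(e + j), with p^e the p-part of n!. As many zeros as there are lower coefficients make the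
  value at \<open>t\<close> divisible as well, and cancelling n! leaves p^j.\<close>

theorem padic_infinitely_many_zeros:
  fixes u :: "nat \<Rightarrow> 'a::field_char_0"
  assumes S: "unital_subring S" and p: "prime p" "p > 2"
    and D: "\<And>k. (fdiff ^^ k) u 0 \<in> ppow_multiples p k S"
    and inf: "infinite {n. u n = 0}"
  shows "u t \<in> ppow_multiples p j S"
proof -
  \<comment> \<open>2 j zeros, since k >= 2 j guarantees k - k / 2 >= j.\<close>
  obtain A where A: "finite A" "card A = 2 * j" "A \<subseteq> {n. u n = 0}"
    using infinite_arbitrarily_large[OF inf] by blast
  define n where "n = Max (insert t A)"
  have An: "x \<le> n" if "x \<in> insert t A" for x using that A by (simp add: n_def)
  \<comment> \<open>The factor n! clears the denominators k! of the binomial polynomials, whose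
    inverses need not lie in \<open>S\<close>.\<close>
  define a where "a k = fact n * (fdiff ^^ k) u 0 / fact k" for k
  define ff :: "nat \<Rightarrow> 'a poly" where "ff k = (\<Prod>i<k. [:- of_nat i, 1:])" for k
  have ff: "poly (ff k) (of_nat x) = fact k * of_nat (x choose k)" for k x
    unfolding ff_def poly_prod binomial_gbinomial gbinomial_mult_fact
    by (intro prod.cong) auto
  have ffS: "ff k \<in> polys S" for k
    unfolding ff_def using S
    by (auto intro!: polys_prod polys_pCons polys_const subring_closure)
  have deg: "degree (ff k) \<le> k" for k
  proof -
    have "degree (ff k) \<le> (\<Sum>i<k. degree [:- of_nat i :: 'a, 1:])"
      unfolding ff_def using degree_prod_sum_le[of "{..<k}" "\<lambda>i. [:- of_nat i :: 'a, 1:]"] by (simp add: o_def)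
    then show ?thesis by simp
  qed
  define P where "P = (\<Sum>k\<le>n. smult (a k) (ff k))"
  have P: "poly P (of_nat x) = fact n * u x" if "x \<le> n" for x
  proof -
    have "poly P (of_nat x) = (\<Sum>k\<le>n. fact n * (of_nat (x choose k) * (fdiff ^^ k) u 0))"
      unfolding P_def poly_sum by (intro sum.cong) (auto simp: ff a_def field_simps)
    also have "\<dots> = fact n * (\<Sum>k\<le>n. of_nat (x choose k) * (fdiff ^^ k) u 0)"
      by (rule sum_distrib_left[symmetric])
    also have "(\<Sum>k\<le>n. of_nat (x choose k) * (fdiff ^^ k) u 0)
        = (\<Sum>k\<le>x. of_nat (x choose k) * (fdiff ^^ k) u 0)"
      using that by (intro sum.mono_neutral_right) auto
    also have "\<dots> = u x" using newton_forward[of 0 u x] by simp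
    finally show ?thesis .
  qed
  obtain e q where e: "fact n = p ^ e * q" "coprime p q"
    using fact_decomposition[OF p(1)] by blast
  define I where "I = ppow_multiples p (e + j) S"
  have a: "a k \<in> I" if k: "k \<ge> 2 * j" "k \<le> n" for k
  proof -
    obtain f r where f: "fact k = p ^ f * r" "coprime p r" "(p - 1) * f \<le> k"
      using fact_decomposition[OF p(1)] by blast
    have "2 * f \<le> (p - 1) * f" using p by (intro mult_right_mono) auto
    then have fk: "2 * f \<le> k" using f by linarith
    obtain M :: nat where M: "fact n = fact k * M"
      using fact_dvd[OF k(2), where 'a = nat] by (auto elim: dvdE)
    have eq: "p ^ e * q = p ^ f * (r * M)" using M e f by (simp add: algebra_simps)
    have p0: "p > 0" using p by simp
    have fe: "f \<le> e"
    proof (rule ccontr)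
      assume "\<not> f \<le> e"
      then have "p ^ f = p ^ e * p ^ Suc (f - Suc e)" by (simp only: power_add[symmetric]) simp
      with eq p0 have "q = p * (p ^ (f - Suc e) * (r * M))" by (simp add: mult.assoc)
      then have "p dvd q" by simp
      with e(2) p show False by (metis coprime_absorb_left not_prime_unit)
    qed
    have "p ^ e = p ^ f * p ^ (e - f)" using fe by (simp add: power_add[symmetric])
    with eq p0 have "p ^ (e - f) * q = r * M" by (simp add: mult.assoc)
    then have "p ^ (e - f) dvd r * M" by (metis dvd_triv_left)
    then have "p ^ (e - f) dvd M" using f(2) by (simp add: coprime_dvd_mult_right_iff)
    then obtain M' where M': "M = p ^ (e - f) * M'" by (auto elim: dvdE)
    obtain y where y: "y \<in> S" "(fdiff ^^ k) u 0 = of_nat p ^ k * y"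
      using D[of k] by (auto simp: ppow_multiples_def)
    have "a k = of_nat M * (fdiff ^^ k) u 0"
      unfolding a_def using arg_cong[OF M, of "of_nat :: nat \<Rightarrow> 'a"] by simp
    also have "\<dots> = of_nat p ^ (e - f + k) * (of_nat M' * y)"
      by (simp add: M' y power_add)
    finally have "a k \<in> ppow_multiples p (e - f + k) S"
      using y(1) S by (auto intro!: ppow_multiplesI subring_closure)
    moreover have "e + j \<le> e - f + k" using fk fe k by linarith
    ultimately show ?thesis using ppow_multiples_antimono[OF S] by (auto simp: I_def)
  qed
  have "coeff P i \<in> I" if "i \<ge> card A" for i
    unfolding P_def coeff_sum I_def
  proof (rule ppow_multiples_sum[OF S])
    fix k assume "k \<in> {..n}"
    show "coeff (smult (a k) (ff k)) i \<in> ppow_multiples p (e + j) S"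
    proof (cases "i \<le> k")
      case True
      then have "a k \<in> I" using a[of k] that A \<open>k \<in> {..n}\<close> by simp
      then show ?thesis using ppow_multiples_mult[OF S] polys_coeff[OF ffS] by (simp add: I_def)
    next
      case False
      then have "coeff (ff k) i = 0" using deg[of k] by (intro coeff_eq_0) auto
      then show ?thesis using ppow_multiples_zero[OF S] by simp
    qed
  qed
  moreover have "poly P (of_nat z) = 0" if "z \<in> A" for z
    using P[of z] An[of z] that A by auto
  ultimately have "poly P (of_nat t) \<in> I"
    using A by (intro poly_value_in_ideal_of_roots[OF S I_def]) auto
  then obtain y where y: "y \<in> S" "of_nat (fact n) * u t = of_nat p ^ (e + j) * y"
    using P[of t] An by (auto simp: I_def ppow_multiples_def)
  have "of_nat p ^ e * (of_nat q * u t) = of_nat p ^ e * (of_nat p ^ j * y)"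
    using y(2) unfolding e by (simp add: power_add mult.assoc)
  then have qu: "of_nat q * u t = of_nat p ^ j * y" using p by simp
  \<comment> \<open>\<open>q\<close> need not be invertible in \<open>S\<close>; a Bezout identity
    with p^j replaces its inverse.\<close>
  have "coprime (int q) (int p ^ j)" using e(2) by (simp add: coprime_commute flip: of_nat_power)
  then obtain b c where bc: "b * int q + c * int p ^ j = 1"
    using bezout_int[of "int q" "int p ^ j"] by (auto simp: coprime_iff_gcd_eq_1)
  then have "of_int (b * int q + c * int p ^ j) = (1 :: 'a)" by simp
  then have one: "of_int b * of_nat q + of_int c * of_nat p ^ j = (1 :: 'a)" by simp
  have "u t = (of_int b * of_nat q + of_int c * of_nat p ^ j) * u t" unfolding one by simp
  also have "\<dots> = of_int b * (of_nat q * u t) + of_int c * of_nat p ^ j * u t"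
    by (simp add: algebra_simps)
  also have "\<dots> = of_nat p ^ j * (of_int b * y + of_int c * u t)"
    unfolding qu by (simp add: algebra_simps)
  finally have ut: "u t = of_nat p ^ j * (of_int b * y + of_int c * u t)" .
  have "u t \<in> S"
    using newton_forward[of 0 u t] D ppow_multiples_subset[OF S]
    by (auto intro!: subring_sum[OF S] subring_mult[OF S] subring_of_nat[OF S])
  then show ?thesis
    using ut y(1) S by (metis ppow_multiplesI subring_add subring_mult subring_of_int)
qed

section \<open>p-adic models of finitely generated fields\<close>

definition subfield_set :: "'a::field set \<Rightarrow> bool" where
  "subfield_set F \<longleftrightarrow> unital_subring F \<and> (\<forall>x\<in>F. inverse x \<in> F)"

lemma subfield_setD:
  assumes "subfield_set F"
  shows "unital_subring F" and "x \<in> F \<Longrightarrow> inverse x \<in> F"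
    and "x \<in> F \<Longrightarrow> y \<in> F \<Longrightarrow> x / y \<in> F"
  using assms by (auto simp: subfield_set_def divide_inverse subring_mult)

definition adjoin :: "'a::field set \<Rightarrow> 'a \<Rightarrow> 'a set" where
  "adjoin F s = {poly f s / poly g s | f g. f \<in> polys F \<and> g \<in> polys F \<and> poly g s \<noteq> 0}"

lemma adjoinI:
  "f \<in> polys F \<Longrightarrow> g \<in> polys F \<Longrightarrow> poly g s \<noteq> 0 \<Longrightarrow> x = poly f s / poly g s \<Longrightarrow> x \<in> adjoin F s"
  by (auto simp: adjoin_def)

lemma adjoin_subfield:
  assumes "subfield_set F" shows "subfield_set (adjoin F s)"
proof -
  note P = polys_subring[OF subfield_setD(1)[OF assms]]
  have "unital_subring (adjoin F s)"
  proof (rule unital_subringI)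
    show "1 \<in> adjoin F s" using subring_1[OF P] by (intro adjoinI[of 1 _ 1]) auto
    fix x y assume "x \<in> adjoin F s" "y \<in> adjoin F s"
    then obtain f g f' g' where *: "f \<in> polys F" "g \<in> polys F" "poly g s \<noteq> 0" "x = poly f s / poly g s"
      "f' \<in> polys F" "g' \<in> polys F" "poly g' s \<noteq> 0" "y = poly f' s / poly g' s"
      unfolding adjoin_def by blast
    show "x - y \<in> adjoin F s"
      using * by (intro adjoinI[of "f * g' - f' * g" _ "g * g'"])
        (auto simp: diff_frac_eq intro!: subring_diff[OF P] subring_mult[OF P])
    show "x * y \<in> adjoin F s"
      using * by (intro adjoinI[of "f * f'" _ "g * g'"]) (auto intro!: subring_mult[OF P])
  qed
  moreover have "inverse x \<in> adjoin F s" if x: "x \<in> adjoin F s" for x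
  proof -
    obtain f g where *: "f \<in> polys F" "g \<in> polys F" "poly g s \<noteq> 0" "x = poly f s / poly g s"
      using x unfolding adjoin_def by blast
    show ?thesis
    proof (cases "poly f s = 0")
      case True
      then show ?thesis
        using * subring_0[OF P] subring_1[OF P] by (intro adjoinI[of 0 _ 1]) auto
    next
      case False
      then show ?thesis using * by (intro adjoinI[of g _ f]) auto
    qed
  qed
  ultimately show ?thesis by (simp add: subfield_set_def)
qed

lemma adjoin_superset:
  assumes "unital_subring F" shows "F \<subseteq> adjoin F s"
proof
  fix x assume "x \<in> F"
  then show "x \<in> adjoin F s"
    using subring_1[OF polys_subring[OF assms]] polys_const[OF assms]
    by (intro adjoinI[of "[:x:]" _ 1]) auto
qed

lemma adjoin_generator:
  assumes "unital_subring F" shows "s \<in> adjoin F s"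
  using subring_1[OF polys_subring[OF assms]] polys_pCons[OF assms, of 0 "[:1:]"]
    polys_const[OF assms, of 1] subring_0[OF assms] subring_1[OF assms]
  by (intro adjoinI[of "[:0, 1:]" _ 1]) auto

text \<open>\<open>S\<close> plays the role of a ring of p-adic integers; \<open>B\<close> is a subring with finite image
  in \<open>S/pS\<close>, although \<open>S/pS\<close> itself may be infinite.\<close>

definition padic_model :: "nat \<Rightarrow> 'a::comm_ring_1 set \<Rightarrow> 'a set \<Rightarrow> bool" where
  "padic_model p S B \<longleftrightarrow> prime p \<and> p > 2 \<and> unital_subring S \<and> unital_subring B \<and> B \<subseteq> S
     \<and> ppow_multiples p 1 S \<subseteq> B
     \<and> (\<exists>\<Gamma>. finite \<Gamma> \<and> (\<forall>y\<in>B. \<exists>g\<in>\<Gamma>. y - g \<in> ppow_multiples p 1 S))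
     \<and> (\<forall>x. (\<forall>j. x \<in> ppow_multiples p j S) \<longrightarrow> x = 0)"

text \<open>The property carried through the induction on generators. The prime depends on
  \<open>T\<close>, whose denominators it must avoid; \<open>S \<subseteq> F\<close> lets
  transcendence or minimality over \<open>F\<close> be applied to polynomials over
  \<open>S\<close>.\<close>

definition padically_coverable :: "'a::comm_ring_1 set \<Rightarrow> bool" where
  "padically_coverable F \<longleftrightarrow>
     (\<forall>T. finite T \<longrightarrow> T \<subseteq> F \<longrightarrow> (\<exists>p S B. padic_model p S B \<and> S \<subseteq> F \<and> T \<subseteq> B))"

lemma padically_coverableE:
  assumes "padically_coverable F" "finite T" "T \<subseteq> F"
  obtains p S B where "padic_model p S B" "S \<subseteq> F" "T \<subseteq> B"
proof -
  from assms have "\<exists>p S B. padic_model p S B \<and> S \<subseteq> F \<and> T \<subseteq> B"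
    by (simp add: padically_coverable_def)
  then show ?thesis using that by blast
qed

lemma padic_modelD:
  assumes "padic_model p S B"
  shows "prime p" "p > 2" "unital_subring S" "unital_subring B" "B \<subseteq> S" "ppow_multiples p 1 S \<subseteq> B"
    and "(\<And>j. x \<in> ppow_multiples p j S) \<Longrightarrow> x = 0"
  using assms by (simp_all only: padic_model_def) blast

lemma padic_model_residuesE:
  assumes "padic_model p S B"
  obtains \<Gamma> where "finite \<Gamma>" "\<And>y. y \<in> B \<Longrightarrow> \<exists>g\<in>\<Gamma>. y - g \<in> ppow_multiples p 1 S"
proof -
  from assms have "\<exists>\<Gamma>. finite \<Gamma> \<and> (\<forall>y\<in>B. \<exists>g\<in>\<Gamma>. y - g \<in> ppow_multiples p 1 S)"
    by (simp only: padic_model_def)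
  then show ?thesis using that by blast
qed

section \<open>The rational numbers\<close>

lemma rats_subfield: "subfield_set (\<rat> :: 'a::field_char_0 set)"
  unfolding subfield_set_def unital_subring_def by auto

text \<open>\<open>S\<close> is the ring of integers localised at \<open>p\<close>. Its residue
  field is finite, so \<open>B\<close> can be \<open>S\<close> itself.\<close>

lemma rats_coverable: "padically_coverable (\<rat> :: 'a::field_char_0 set)"
  unfolding padically_coverable_def
proof (intro allI impI)
  fix T :: "'a set" assume T: "finite T" "T \<subseteq> \<rat>"
  have "\<forall>x\<in>T. \<exists>a b::int. b > 0 \<and> x = of_int a / of_int b"
  proof
    fix x assume "x \<in> T"
    then obtain q where "x = of_rat q" using T by (auto elim: Rats_cases)
    moreover obtain a b where "quotient_of q = (a, b)" by force
    ultimately show "\<exists>a b::int. b > 0 \<and> x = of_int a / of_int b"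
      using quotient_of_div[of q a b] quotient_of_denom_pos[of q a b]
      by (intro exI[of _ a] exI[of _ b]) (auto simp: of_rat_divide)
  qed
  then obtain num den :: "'a \<Rightarrow> int"
    where den: "\<And>x. x \<in> T \<Longrightarrow> den x > 0" "\<And>x. x \<in> T \<Longrightarrow> x = of_int (num x) / of_int (den x)"
    by metis
  \<comment> \<open>The sum bounds every denominator, so \<open>p\<close> divides none of
    them.\<close>
  obtain p :: nat where p: "prime p" "p > 2 + nat (\<Sum>x\<in>T. den x)"
    using bigger_prime by blast
  have pi: "prime (int p)" using p by simp
  define S :: "'a set" where "S = {of_int a / of_int b | a b. \<not> int p dvd b}"
  have nz: "of_int b \<noteq> (0 :: 'a)" if "\<not> int p dvd b" for b using that by auto
  have ring: "unital_subring S"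
  proof (rule unital_subringI)
    show "1 \<in> S" unfolding S_def using p by (intro CollectI exI[of _ 1]) auto
    fix x y assume "x \<in> S" "y \<in> S"
    then obtain a b a' b' where *: "x = of_int a / of_int b" "y = of_int a' / of_int b'"
      "\<not> int p dvd b" "\<not> int p dvd b'" unfolding S_def by blast
    have bb: "\<not> int p dvd b * b'" using * pi by (simp add: prime_dvd_mult_iff)
    have "x - y = of_int (a * b' - a' * b) / of_int (b * b')"
      using * nz[OF *(3)] nz[OF *(4)] by (simp add: diff_frac_eq)
    then show "x - y \<in> S" using bb unfolding S_def by blast
    have "x * y = of_int (a * a') / of_int (b * b')" using * by simp
    then show "x * y \<in> S" using bb unfolding S_def by blast
  qed
  have fin: "\<exists>g\<in>of_int ` {0..<int p}. y - g \<in> ppow_multiples p 1 S" if y: "y \<in> S" for y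
  proof -
    obtain a b where ab: "y = of_int a / of_int b" "\<not> int p dvd b" using y unfolding S_def by blast
    have "coprime b (int p)" using prime_imp_coprime[OF pi ab(2)] by (simp add: coprime_commute)
    then obtain c k where ck: "c * b + k * int p = 1"
      using bezout_int[of b "int p"] by (auto simp: coprime_iff_gcd_eq_1)
    \<comment> \<open>\<open>c\<close> inverts \<open>b\<close> modulo \<open>p\<close>, so
      \<open>g\<close> is the residue of a / b.\<close>
    define g where "g = (a * c) mod int p"
    have "int p dvd a - b * g"
    proof -
      have "a - b * g = a * (1 - c * b) + b * (a * c - g)" by (simp add: algebra_simps)
      moreover have "1 - c * b = int p * k" using ck by (simp add: algebra_simps)
      moreover have "int p dvd a * c - g" unfolding g_def by (rule dvd_minus_mod)
      ultimately show ?thesis by simp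
    qed
    then obtain l where l: "a - b * g = int p * l" by (auto elim: dvdE)
    have "y - of_int g = of_int (a - b * g) / of_int b"
      using nz[OF ab(2)] by (simp add: ab field_simps)
    also have "\<dots> = of_nat p ^ 1 * (of_int l / of_int b)" unfolding l by simp
    finally have "y - of_int g \<in> ppow_multiples p 1 S"
      using ppow_multiplesI[of "of_int l / of_int b" S p 1] ab(2) unfolding S_def by auto
    moreover have "g \<in> {0..<int p}" using p by (simp add: g_def)
    ultimately show ?thesis by blast
  qed
  have sep: "x = 0" if x: "\<And>j. x \<in> ppow_multiples p j S" for x
  proof (rule ccontr)
    assume "x \<noteq> 0"
    have "x \<in> S" using x[of 0] by simp
    then obtain a b where ab: "x = of_int a / of_int b" "\<not> int p dvd b" unfolding S_def by blast
    have a0: "a \<noteq> 0" using ab \<open>x \<noteq> 0\<close> by auto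
    have "int p ^ j dvd a" for j
    proof -
      obtain a' b' where *: "x = of_nat p ^ j * (of_int a' / of_int b')" "\<not> int p dvd b'"
        using x[of j] unfolding S_def ppow_multiples_def by blast
      have "of_int (a * b') = (of_int (int p ^ j * a' * b) :: 'a)"
        using *(1) nz[OF ab(2)] nz[OF *(2)] unfolding ab(1) by (simp add: field_simps)
      then have "a * b' = int p ^ j * a' * b" by (simp only: of_int_eq_iff)
      then have "int p ^ j dvd a * b'" by (simp add: mult.assoc)
      moreover have "coprime (int p ^ j) b'" using *(2) pi by (simp add: prime_imp_coprime)
      ultimately show ?thesis by (simp add: coprime_dvd_mult_left_iff)
    qed
    \<comment> \<open>The exponent |a| suffices, since p^|a| exceeds |a|.\<close>
    from this[of "nat \<bar>a\<bar>"] have "\<bar>int p ^ nat \<bar>a\<bar>\<bar> \<le> \<bar>a\<bar>" by (rule dvd_imp_le_int[OF a0])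
    moreover have "nat \<bar>a\<bar> < p ^ nat \<bar>a\<bar>" using p by (intro power_gt_expt) auto
    then have "int (nat \<bar>a\<bar>) < int (p ^ nat \<bar>a\<bar>)" by (simp only: of_nat_less_iff)
    ultimately show False by simp
  qed
  have "T \<subseteq> S"
  proof
    fix x assume x: "x \<in> T"
    have "den x \<le> (\<Sum>x\<in>T. den x)" using x T den(1) by (intro member_le_sum) (auto intro: less_imp_le)
    then have "\<not> int p dvd den x" using p den(1)[OF x] zdvd_imp_le[of "int p" "den x"] by auto
    then show "x \<in> S" using den(2)[OF x] unfolding S_def by blast
  qed
  moreover have "padic_model p S S"
    unfolding padic_model_def using p ring fin sep ppow_multiples_subset[OF ring] by (auto intro!: exI[of _ "of_int ` {0..<int p}"])
  moreover have "S \<subseteq> \<rat>" by (auto simp: S_def)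
  ultimately show "\<exists>p S B. padic_model p S B \<and> S \<subseteq> \<rat> \<and> T \<subseteq> B" by blast
qed

section \<open>Transcendental extensions\<close>

lemma poly_diff_ppow_multiples:
  assumes S: "unital_subring S" and "g \<in> polys S" "x \<in> S" "y \<in> S" "x - y \<in> ppow_multiples p k S"
  shows "poly g x - poly g y \<in> ppow_multiples p k S"
  using assms(2)
proof (induction g)
  case 0
  show ?case using ppow_multiples_zero[OF S] by simp
next
  case (pCons a g)
  have g: "g \<in> polys S" using polys_pConsD[OF pCons.prems] by simp
  have "poly (pCons a g) x - poly (pCons a g) y = x * (poly g x - poly g y) + (x - y) * poly g y"
    by (simp add: algebra_simps)
  then show ?case
    using ppow_multiples_add[OF S ppow_multiples_mult_left[OF S pCons.IH[OF g] assms(3)]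
        ppow_multiples_mult[OF S assms(5) polys_eval[OF S g assms(4)]]] by simp
qed

text \<open>A divisor with unit constant term is invertible as a power series over \<open>S\<close>,
  and the recursion for the coefficients of \<open>h\<close> divides by that unit only. It serves to
  cancel the denominators of a localisation.\<close>

lemma coeffs_ppow_multiples_cancel:
  fixes h d :: "'a::field poly"
  assumes S: "unital_subring S" and d: "d \<in> polys S" "coeff d 0 \<noteq> 0" "inverse (coeff d 0) \<in> S"
    and hd: "\<And>i. coeff (h * d) i \<in> ppow_multiples p k S"
  shows "coeff h i \<in> ppow_multiples p k S"
proof (induction i rule: less_induct)
  case (less i)
  have "coeff (h * d) i = (\<Sum>l<i. coeff h l * coeff d (i - l)) + coeff h i * coeff d 0"
    by (simp add: coeff_mult lessThan_Suc_atMost[symmetric])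
  then have "coeff h i = (coeff (h * d) i - (\<Sum>l<i. coeff h l * coeff d (i - l))) * inverse (coeff d 0)"
    using d(2) by (simp add: field_simps)
  moreover have "(\<Sum>l<i. coeff h l * coeff d (i - l)) \<in> ppow_multiples p k S"
    using less polys_coeff[OF d(1)] by (intro ppow_multiples_sum[OF S] ppow_multiples_mult[OF S]) auto
  ultimately show ?case
    using ppow_multiples_mult[OF S ppow_multiples_diff[OF S hd] d(3)] by auto
qed

lemma coeff_in_subringI:
  assumes "unital_subring S" "coeff f ` {..degree f} \<subseteq> S" shows "f \<in> polys S"
proof -
  have "coeff f i \<in> S" for i
    using assms subring_0[OF assms(1)] by (cases "i \<le> degree f") (auto simp: coeff_eq_0)
  then show ?thesis by (simp add: polys_def)
qed

text \<open>Choose an integer \<open>a\<close> at which no denominator of the given elements vanishes, write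
  \<open>s = a + p y\<close>, and localise the polynomials in \<open>y\<close> at those with invertible constant term.\<close>

lemma adjoin_transcendental_coverable:
  fixes F :: "'a::field_char_0 set"
  assumes F: "subfield_set F" "padically_coverable F"
    and trans: "\<And>f. f \<in> polys F \<Longrightarrow> poly f s = 0 \<Longrightarrow> f = 0"
  shows "padically_coverable (adjoin F s)"
  unfolding padically_coverable_def
proof (intro allI impI)
  note FR = subfield_setD(1)[OF F(1)]
  fix T assume T: "finite T" "T \<subseteq> adjoin F s"
  have "\<forall>x\<in>T. \<exists>f g. f \<in> polys F \<and> g \<in> polys F \<and> poly g s \<noteq> 0 \<and> x = poly f s / poly g s"
    using T unfolding adjoin_def by blast
  then obtain f g where fg: "\<And>x. x \<in> T \<Longrightarrow> f x \<in> polys F" "\<And>x. x \<in> T \<Longrightarrow> g x \<in> polys F"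
    "\<And>x. x \<in> T \<Longrightarrow> poly (g x) s \<noteq> 0" "\<And>x. x \<in> T \<Longrightarrow> x = poly (f x) s / poly (g x) s"
    by metis
  have "g x \<noteq> 0" if "x \<in> T" for x using fg(3)[OF that] by auto
  then have "(\<Prod>x\<in>T. g x) \<noteq> 0" using T by simp
  then have "finite {x. poly (\<Prod>x\<in>T. g x) x = 0}" by (rule poly_roots_finite)
  moreover have "infinite (range (of_nat :: nat \<Rightarrow> 'a))" by (simp add: range_inj_infinite inj_of_nat)
  ultimately obtain a :: nat where a: "poly (\<Prod>x\<in>T. g x) (of_nat a) \<noteq> 0"
    by (metis (mono_tags, lifting) finite_subset image_subset_iff mem_Collect_eq)
  have ga: "poly (g x) (of_nat a) \<noteq> 0" if "x \<in> T" for x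
    using a that T by (auto simp: poly_prod)
  \<comment> \<open>The inverses make the denominators, rewritten as polynomials in
    \<open>y\<close>, units of the localisation: their constant terms are the values at
    \<open>a\<close>.\<close>
  define T0 where "T0 = (\<Union>x\<in>T. coeff (f x) ` {..degree (f x)} \<union> coeff (g x) ` {..degree (g x)}
      \<union> {inverse (poly (g x) (of_nat a))})"
  have "finite T0" using T by (simp add: T0_def)
  moreover have "T0 \<subseteq> F"
    using fg(1,2) polys_eval[OF FR fg(2) subring_of_nat[OF FR]] subfield_setD(2)[OF F(1)]
    by (auto simp: T0_def polys_coeff)
  ultimately obtain p S0 B0 where m: "padic_model p S0 B0" and S0F: "S0 \<subseteq> F" and T0: "T0 \<subseteq> B0"
    by (rule padically_coverableE[OF F(2)])
  obtain \<Gamma> where \<Gamma>: "finite \<Gamma>" "\<And>y. y \<in> B0 \<Longrightarrow> \<exists>g\<in>\<Gamma>. y - g \<in> ppow_multiples p 1 S0"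
    using padic_model_residuesE[OF m] by blast
  have p: "prime p" "p > 2" and S0: "unital_subring S0" and B0: "unital_subring B0" "B0 \<subseteq> S0"
    and sep: "\<And>x. (\<And>j. x \<in> ppow_multiples p j S0) \<Longrightarrow> x = 0"
    using padic_modelD[OF m] by simp_all
  note P0 = polys_subring[OF S0]
  have p0: "of_nat p \<noteq> (0 :: 'a)" using p by simp
  define y where "y = (s - of_nat a) / of_nat p"
  have s: "s = of_nat a + of_nat p * y" using p0 by (simp add: y_def)
  \<comment> \<open>\<open>y\<close> arises from \<open>s\<close> by an affine substitution over
    \<open>F\<close>, so it is transcendental too.\<close>
  have transy: "h = 0" if "h \<in> polys F" "poly h y = 0" for h
  proof -
    define l where "l = [:- of_nat a / of_nat p, 1 / of_nat p :: 'a:]"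
    have "l \<in> polys F"
      unfolding l_def using FR
      by (intro polys_pCons polys_const subfield_setD(3)[OF F(1)] subring_uminus subring_of_nat subring_1) auto
    then have "pcompose h l \<in> polys F" using that FR by (simp add: polys_pcompose)
    moreover have "poly (pcompose h l) s = 0"
      using that by (simp add: poly_pcompose l_def y_def diff_divide_distrib)
    ultimately have "pcompose h l = 0" by (rule trans)
    then show ?thesis using p0 by (subst (asm) pcompose_eq_0_iff) (auto simp: l_def)
  qed
  \<comment> \<open>\<open>inverse 0 = 0\<close> lies in \<open>S0\<close>, hence the separate
    condition that the constant term is nonzero.\<close>
  define D where "D = {d \<in> polys S0. coeff d 0 \<noteq> 0 \<and> inverse (coeff d 0) \<in> S0}"
  have Dy: "poly d y \<noteq> 0" if "d \<in> D" for d
    using that transy[of d] polys_mono[OF S0F] by (auto simp: D_def)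
  have D1: "1 \<in> D" using subring_1[OF P0] subring_1[OF S0] by (simp add: D_def)
  have Dmult: "d * e \<in> D" if "d \<in> D" "e \<in> D" for d e
    using that subring_mult[OF P0] subring_mult[OF S0] by (auto simp: D_def coeff_mult)
  define S where "S = {poly h y / poly d y | h d. h \<in> polys S0 \<and> d \<in> D}"
  have SI: "x \<in> S" if "h \<in> polys S0" "d \<in> D" "x = poly h y / poly d y" for x h d
    using that by (auto simp: S_def)
  have S: "unital_subring S"
  proof (rule unital_subringI)
    show "1 \<in> S" using subring_1[OF P0] D1 by (intro SI[of 1 1]) auto
    fix x x' assume "x \<in> S" "x' \<in> S"
    then obtain h d h' d' where *: "h \<in> polys S0" "h' \<in> polys S0" "d \<in> D" "d' \<in> D"
      "x = poly h y / poly d y" "x' = poly h' y / poly d' y" unfolding S_def by blast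
    have dS: "d \<in> polys S0" "d' \<in> polys S0" using * by (auto simp: D_def)
    show "x - x' \<in> S"
      using * dS Dy[OF *(3)] Dy[OF *(4)] Dmult
      by (intro SI[of "h * d' - h' * d" "d * d'"])
        (auto simp: diff_frac_eq intro!: subring_diff[OF P0] subring_mult[OF P0])
    show "x * x' \<in> S"
      using * Dmult by (intro SI[of "h * h'" "d * d'"]) (auto intro!: subring_mult[OF P0])
  qed
  have polyS: "poly h y \<in> S" if "h \<in> polys S0" for h
    using that D1 by (intro SI[of h 1]) auto
  have S0S: "S0 \<subseteq> S" using polyS polys_const[OF S0] by force
  then have ppS: "ppow_multiples p k S0 \<subseteq> ppow_multiples p k S" for k
    by (auto simp: ppow_multiples_def)
  \<comment> \<open>\<open>s\<close> is congruent to the integer \<open>a\<close> modulo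
    \<open>p\<close>, so the residues of \<open>B0\<close> serve for \<open>T\<close> as
    well.\<close>
  define B where "B = {x \<in> S. \<exists>\<beta>\<in>B0. x - \<beta> \<in> ppow_multiples p 1 S}"
  have B0B: "B0 \<subseteq> B"
  proof
    fix \<beta> assume "\<beta> \<in> B0"
    moreover have "\<beta> - \<beta> \<in> ppow_multiples p 1 S" using ppow_multiples_zero[OF S] by simp
    ultimately show "\<beta> \<in> B" using B0 S0S unfolding B_def by blast
  qed
  have B: "unital_subring B"
  proof (rule unital_subringI)
    show "1 \<in> B" using B0B subring_1[OF B0(1)] by auto
    fix x x' assume "x \<in> B" "x' \<in> B"
    then obtain \<beta> \<beta>' where *: "x \<in> S" "x' \<in> S" "\<beta> \<in> B0" "\<beta>' \<in> B0"
        "x - \<beta> \<in> ppow_multiples p 1 S" "x' - \<beta>' \<in> ppow_multiples p 1 S" unfolding B_def by blast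
    have "(x - \<beta>) - (x' - \<beta>') \<in> ppow_multiples p 1 S" by (intro ppow_multiples_diff[OF S] *)
    then have "(x - x') - (\<beta> - \<beta>') \<in> ppow_multiples p 1 S" by (simp add: algebra_simps)
    then show "x - x' \<in> B"
      using * subring_diff[OF B0(1)] subring_diff[OF S] unfolding B_def by blast
    have "x * (x' - \<beta>') + \<beta>' * (x - \<beta>) \<in> ppow_multiples p 1 S"
      using * B0(2) S0S by (intro ppow_multiples_add[OF S] ppow_multiples_mult_left[OF S]) auto
    then have "x * x' - \<beta> * \<beta>' \<in> ppow_multiples p 1 S" by (simp add: algebra_simps)
    then show "x * x' \<in> B"
      using * subring_mult[OF B0(1)] subring_mult[OF S] unfolding B_def by blast
  qed
  have sepS: "x = 0" if x: "\<And>j. x \<in> ppow_multiples p j S" for x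
  proof -
    have "x \<in> S" using x[of 0] by simp
    then obtain h d where hd: "h \<in> polys S0" "d \<in> D" "x = poly h y / poly d y"
      unfolding S_def by blast
    \<comment> \<open>Transcendence turns the equation between values at \<open>y\<close> into one
      between polynomials, where divisibility is read off coefficientwise.\<close>
    have "coeff h i \<in> ppow_multiples p j S0" for i j
    proof -
      obtain h' d' where *: "h' \<in> polys S0" "d' \<in> D" "x = of_nat p ^ j * (poly h' y / poly d' y)"
        using x[of j] unfolding S_def ppow_multiples_def by blast
      have d: "d \<in> polys S0" "d' \<in> polys S0" using hd * by (auto simp: D_def)
      have "poly (h * d' - smult (of_nat p ^ j) (h' * d)) y = 0"
      proof -
        have "poly h y / poly d y = of_nat p ^ j * poly h' y / poly d' y" using *(3) hd(3) by simp
        then show ?thesis using Dy[OF hd(2)] Dy[OF *(2)] by (simp add: frac_eq_eq mult.assoc)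
      qed
      moreover have "h * d' - smult (of_nat p ^ j) (h' * d) \<in> polys S0"
        by (intro subring_diff[OF P0] polys_smult[OF S0] subring_mult[OF P0] subring_power[OF S0]
            subring_of_nat[OF S0] hd * d)
      then have "h * d' - smult (of_nat p ^ j) (h' * d) \<in> polys F" using polys_mono[OF S0F] by blast
      ultimately have "h * d' - smult (of_nat p ^ j) (h' * d) = 0" using transy by blast
      then have eq: "h * d' = smult (of_nat p ^ j) (h' * d)" by simp
      have "coeff (h * d') l = of_nat p ^ j * coeff (h' * d) l" for l
        by (simp only: eq coeff_smult)
      then have mem: "coeff (h * d') l \<in> ppow_multiples p j S0" for l
        by (simp only: ppow_multiplesI[OF polys_coeff[OF subring_mult[OF P0 *(1) d(1)]]])
      have "coeff d' 0 \<noteq> 0" "inverse (coeff d' 0) \<in> S0" using *(2) unfolding D_def by blast+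
      then show ?thesis by (rule coeffs_ppow_multiples_cancel[OF S0 d(2) _ _ mem])
    qed
    then have "h = 0" using sep by (simp add: poly_eq_iff)
    then show ?thesis using hd by simp
  qed
  have "\<exists>g\<in>\<Gamma>. x - g \<in> ppow_multiples p 1 S" if x: "x \<in> B" for x
  proof -
    obtain \<beta> where \<beta>: "\<beta> \<in> B0" "x - \<beta> \<in> ppow_multiples p 1 S" using x unfolding B_def by blast
    then obtain g where g: "g \<in> \<Gamma>" "\<beta> - g \<in> ppow_multiples p 1 S" using \<Gamma>(2) ppS by blast
    have "(x - \<beta>) + (\<beta> - g) \<in> ppow_multiples p 1 S" by (intro ppow_multiples_add[OF S] \<beta> g)
    then show ?thesis using g(1) by auto
  qed
  moreover have "ppow_multiples p 1 S \<subseteq> B"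
    using ppow_multiples_subset[OF S] subring_0[OF B0(1)] by (force simp: B_def)
  ultimately have "padic_model p S B"
    unfolding padic_model_def using p S B sepS \<Gamma>(1) by (auto simp: B_def)
  moreover have "S \<subseteq> adjoin F s"
  proof -
    note A = adjoin_subfield[OF F(1), of s] and AR = subfield_setD(1)[OF adjoin_subfield[OF F(1), of s]]
    have y: "y \<in> adjoin F s"
      unfolding y_def using AR adjoin_generator[OF FR]
      by (intro subfield_setD(3)[OF A] subring_diff subring_of_nat)
    have "polys S0 \<subseteq> polys (adjoin F s)" using S0F adjoin_superset[OF FR] by (intro polys_mono) auto
    then show ?thesis
      using polys_eval[OF AR _ y] by (auto simp: S_def D_def intro!: subfield_setD(3)[OF A])
  qed
  moreover have "T \<subseteq> B"
  proof
    fix x assume x: "x \<in> T"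
    have f: "f x \<in> polys B0" and g: "g x \<in> polys B0" and gi: "inverse (poly (g x) (of_nat a)) \<in> B0"
      using x T0 by (auto simp: T0_def intro!: coeff_in_subringI[OF B0(1)])
    have ys: "y \<in> S" using polyS[of "[:0, 1:]"] subring_0[OF S0] subring_1[OF S0]
      by (simp add: polys_pCons[OF S0] polys_const[OF S0])
    have aS: "of_nat a \<in> S" "of_nat p \<in> S" using S by (auto intro: subring_of_nat)
    have sS: "s \<in> S" unfolding s using ys aS by (intro subring_add[OF S] subring_mult[OF S])
    have sa: "s - of_nat a \<in> ppow_multiples p 1 S"
      using ys ppow_multiplesI[of y S p 1] by (simp add: s)
    have sB: "s \<in> B" using sS sa subring_of_nat[OF B0(1)] unfolding B_def by blast
    have gS: "g x \<in> polys S" using g polys_mono[of B0 S] B0 S0S by blast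
    define d where "d = pcompose (g x) [:of_nat a, of_nat p:]"
    have d0: "coeff d 0 = poly (g x) (of_nat a)"
      by (simp add: d_def poly_0_coeff_0[symmetric] poly_pcompose)
    have "d \<in> polys S0"
      unfolding d_def using g polys_mono[OF B0(2)] S0
      by (intro polys_pcompose polys_pCons polys_const subring_of_nat) auto
    then have "d \<in> D" using d0 gi ga[OF x] B0(2) by (auto simp: D_def)
    moreover have dy: "poly d y = poly (g x) s" by (simp add: d_def poly_pcompose s mult.commute)
    ultimately have igS: "inverse (poly (g x) s) \<in> S"
      using subring_1[OF P0] by (intro SI[of 1 d]) (auto simp: field_simps)
    \<comment> \<open>The difference of the inverses is the difference of the values times elements
      of \<open>S\<close>, so congruent denominators have congruent inverses.\<close>
    have "(poly (g x) s - poly (g x) (of_nat a)) * (- inverse (poly (g x) s) * inverse (poly (g x) (of_nat a)))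
        \<in> ppow_multiples p 1 S"
      using gi B0(2) S0S
      by (intro ppow_multiples_mult[OF S] poly_diff_ppow_multiples[OF S gS sS aS(1) sa]
          subring_mult[OF S] subring_uminus[OF S] igS) auto
    also have "(poly (g x) s - poly (g x) (of_nat a)) * (- inverse (poly (g x) s) * inverse (poly (g x) (of_nat a)))
       = inverse (poly (g x) s) - inverse (poly (g x) (of_nat a))"
      using ga[OF x] fg(3)[OF x] by (simp add: field_simps)
    finally have "inverse (poly (g x) s) \<in> B" using igS gi unfolding B_def by blast
    moreover have "poly (f x) s \<in> B" using f polys_mono[OF B0B] by (intro polys_eval[OF B _ sB]) auto
    ultimately have "poly (f x) s * inverse (poly (g x) s) \<in> B" by (intro subring_mult[OF B])
    then show "x \<in> B" by (subst fg(4)[OF x]) (simp add: divide_inverse)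
  qed
  ultimately show "\<exists>p S B. padic_model p S B \<and> S \<subseteq> adjoin F s \<and> T \<subseteq> B" by blast
qed

section \<open>Algebraic extensions\<close>

lemma adjoin_algebraic_polynomial:
  assumes F: "subfield_set F"
    and f: "f \<in> polys F" "poly f s = 0"
    and min: "\<And>h. h \<in> polys F \<Longrightarrow> poly h s = 0 \<Longrightarrow> degree h < degree f \<Longrightarrow> h = 0"
    and g: "g \<in> polys F" "g \<noteq> 0" "degree g < degree f"
  shows "\<exists>h\<in>polys F. poly h s * poly g s = 1"
  using g
proof (induction "degree g" arbitrary: g rule: less_induct)
  case less
  note FR = subfield_setD(1)[OF F] and P = polys_subring[OF subfield_setD(1)[OF F]]
  show ?case
  proof (cases "degree g = 0")
    case True
    then obtain c where c: "g = [:c:]" by (rule degree_eq_zeroE)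
    then have "c \<in> F" "c \<noteq> 0" using less.prems polys_pConsD[of c 0 F] by auto
    then show ?thesis
      using c polys_const[OF FR] subfield_setD(2)[OF F] by (intro bexI[of _ "[:inverse c:]"]) auto
  next
    case False
    obtain q r where qr: "q \<in> polys F" "r \<in> polys F" "f = q * g + r" "r = 0 \<or> degree r < degree g"
      using polys_division[OF FR f(1) less.prems(1,2)] subfield_setD(2)[OF F polys_coeff[OF less.prems(1)]]
      by blast
    have "r \<noteq> 0"
    proof
      assume r: "r = 0"
      then have fqg: "f = q * g" using qr by simp
      have "q \<noteq> 0" using fqg less.prems by auto
      then have "degree q < degree f" using fqg less.prems False by (simp add: degree_mult_eq)
      moreover have "poly q s = 0 \<or> poly g s = 0" using f fqg by auto
      ultimately show False using min[OF qr(1)] min[OF less.prems(1)] less.prems \<open>q \<noteq> 0\<close> by auto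
    qed
    then obtain h where h: "h \<in> polys F" "poly h s * poly r s = 1"
      using less.hyps[of r] qr less.prems by auto
    \<comment> \<open>Because f(s) = 0. An inverse of r(s), available by induction on the degree,
      therefore yields one of g(s).\<close>
    have "poly r s = - poly q s * poly g s" using f qr(3) by (simp add: eq_neg_iff_add_eq_0 add.commute)
    then show ?thesis
      using h qr by (intro bexI[of _ "h * (- q)"]) (auto simp: mult.assoc intro!: subring_mult[OF P] subring_uminus[OF P])
  qed
qed

text \<open>With \<open>f\<close> the monic minimal polynomial of \<open>s\<close>, the model
  consists of S0[s] and B0[s]. Modulo \<open>f\<close> each element is a combination of 1, ..., s^(d
  - 1), uniquely by minimality, so residues and separatedness are inherited coordinate by
  coordinate.\<close>

lemma adjoin_algebraic_coverable:
  fixes F :: "'a::field_char_0 set"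
  assumes F: "subfield_set F" "padically_coverable F"
    and alg: "f0 \<in> polys F" "f0 \<noteq> 0" "poly f0 s = 0"
  shows "padically_coverable (adjoin F s)"
  unfolding padically_coverable_def
proof (intro allI impI)
  note FR = subfield_setD(1)[OF F(1)] and PF = polys_subring[OF subfield_setD(1)[OF F(1)]]
  fix T assume T: "finite T" "T \<subseteq> adjoin F s"
  obtain f1 where f1: "f1 \<in> polys F \<and> f1 \<noteq> 0 \<and> poly f1 s = 0"
    and min1: "\<And>h. h \<in> polys F \<and> h \<noteq> 0 \<and> poly h s = 0 \<Longrightarrow> degree f1 \<le> degree h"
    using ex_has_least_nat[of "\<lambda>h. h \<in> polys F \<and> h \<noteq> 0 \<and> poly h s = 0" f0 degree] alg by metis
  define f where "f = smult (inverse (lead_coeff f1)) f1"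
  have f: "f \<in> polys F" "poly f s = 0" and df: "degree f = degree f1" and lf: "lead_coeff f = 1"
    using f1 subfield_setD(2)[OF F(1)] by (auto simp: f_def intro!: polys_smult[OF FR] polys_coeff)
  have min: "h = 0" if "h \<in> polys F" "poly h s = 0" "degree h < degree f" for h
    using min1[of h] that df by force
  define d where "d = degree f"
  have d: "d > 0"
  proof (rule ccontr)
    assume "\<not> d > 0"
    then obtain c where "f = [:c:]" using degree_eq_zeroE[of f] by (auto simp: d_def)
    then show False using f lf by auto
  qed
  have f0: "f \<noteq> 0" using lf by auto
  have reduce: "\<exists>h'\<in>polys R. poly h' s = poly h s \<and> degree h' < d"
    if R: "unital_subring R" "f \<in> polys R" "h \<in> polys R" for R h
  proof -
    have "inverse (lead_coeff f) \<in> R" using R lf by (simp add: subring_1)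
    then obtain q r where "r \<in> polys R" "h = q * f + r" "r = 0 \<or> degree r < degree f"
      using polys_division[OF R(1,3,2) f0] by blast
    then show ?thesis using f d by (intro bexI[of _ r]) (auto simp: d_def)
  qed
  have "\<exists>h\<in>polys F. x = poly h s" if x: "x \<in> adjoin F s" for x
  proof -
    obtain u v where uv: "u \<in> polys F" "v \<in> polys F" "poly v s \<noteq> 0" "x = poly u s / poly v s"
      using x unfolding adjoin_def by blast
    obtain v' where v': "v' \<in> polys F" "poly v' s = poly v s" "degree v' < d"
      using reduce[OF FR f(1) uv(2)] by blast
    obtain w where w: "w \<in> polys F" "poly w s * poly v' s = 1"
      using adjoin_algebraic_polynomial[OF F(1) f min v'(1)] uv(3) v' unfolding d_def by fastforce
    then show ?thesis
      using uv v' w inverse_unique[of "poly v s" "poly w s"] by (intro bexI[of _ "u * w"])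
        (auto simp: divide_inverse mult.commute intro!: subring_mult[OF PF])
  qed
  then have "\<forall>x\<in>T. \<exists>h. h \<in> polys F \<and> x = poly h s" using T by blast
  then obtain h where h: "\<And>x. x \<in> T \<Longrightarrow> h x \<in> polys F" "\<And>x. x \<in> T \<Longrightarrow> x = poly (h x) s" by metis
  \<comment> \<open>The coefficients of \<open>f\<close> are included so that reduction modulo
    \<open>f\<close> stays over \<open>B0\<close>, not only over \<open>S0\<close>.\<close>
  define T0 where "T0 = (\<Union>x\<in>T. coeff (h x) ` {..degree (h x)}) \<union> coeff f ` {..degree f}"
  have "finite T0" using T by (simp add: T0_def)
  moreover have "T0 \<subseteq> F" using h(1) f(1) by (auto simp: T0_def polys_coeff)
  ultimately obtain p S0 B0 where m: "padic_model p S0 B0" and S0F: "S0 \<subseteq> F" and T0: "T0 \<subseteq> B0"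
    by (rule padically_coverableE[OF F(2)])
  obtain \<Gamma> where \<Gamma>: "finite \<Gamma>" "\<And>y. y \<in> B0 \<Longrightarrow> \<exists>g\<in>\<Gamma>. y - g \<in> ppow_multiples p 1 S0"
    using padic_model_residuesE[OF m] by blast
  have p: "prime p" "p > 2" and S0: "unital_subring S0" and B0: "unital_subring B0" "B0 \<subseteq> S0"
    and pB0: "ppow_multiples p 1 S0 \<subseteq> B0"
    and sep: "\<And>x. (\<And>j. x \<in> ppow_multiples p j S0) \<Longrightarrow> x = 0"
    using padic_modelD[OF m] by simp_all
  have fB0: "f \<in> polys B0" using T0 by (intro coeff_in_subringI[OF B0(1)]) (auto simp: T0_def)
  then have fS0: "f \<in> polys S0" using polys_mono[OF B0(2)] by blast
  define ev where "ev R = (\<lambda>h. poly h s) ` polys R" for R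
  have ev: "unital_subring (ev R)" if "unital_subring R" for R
  proof (rule unital_subringI)
    note P = polys_subring[OF that]
    show "1 \<in> ev R" using subring_1[OF P] by (force simp: ev_def)
    fix x y assume "x \<in> ev R" "y \<in> ev R"
    then obtain a b where *: "x = poly a s" "y = poly b s" "a \<in> polys R" "b \<in> polys R"
      by (auto simp: ev_def)
    show "x - y \<in> ev R" unfolding ev_def
      by (rule image_eqI[of _ _ "a - b"]) (use * in \<open>auto intro: subring_diff[OF P]\<close>)
    show "x * y \<in> ev R" unfolding ev_def
      by (rule image_eqI[of _ _ "a * b"]) (use * in \<open>auto intro: subring_mult[OF P]\<close>)
  qed
  have ev_super: "R \<subseteq> ev R" if "unital_subring R" for R
    using polys_const[OF that] by (force simp: ev_def)
  have sS: "s \<in> ev S0"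
    unfolding ev_def using subring_0[OF S0] subring_1[OF S0]
    by (intro image_eqI[of _ _ "[:0, 1:]"]) (auto intro!: polys_pCons[OF S0] polys_const[OF S0])
  note S = ev[OF S0] and B = ev[OF B0(1)]
  have expand: "poly r s = (\<Sum>i<d. coeff r i * s ^ i)" if "degree r < d" for r
    unfolding poly_altdef using that by (intro sum.mono_neutral_left) (auto simp: coeff_eq_0)
  define \<Gamma>' where "\<Gamma>' = (\<lambda>g. \<Sum>i<d. g i * s ^ i) ` (PiE {..<d} (\<lambda>_. \<Gamma>))"
  have fin: "finite \<Gamma>'" unfolding \<Gamma>'_def using \<Gamma>(1) by (intro finite_imageI finite_PiE) auto
  have cov: "\<exists>g\<in>\<Gamma>'. y - g \<in> ppow_multiples p 1 (ev S0)" if y: "y \<in> ev B0" for y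
  proof -
    obtain r where r: "r \<in> polys B0" "y = poly r s" "degree r < d"
      using y reduce[OF B0(1) fB0] unfolding ev_def by force
    have "\<forall>i. \<exists>g. g \<in> \<Gamma> \<and> coeff r i - g \<in> ppow_multiples p 1 S0" using \<Gamma>(2) polys_coeff[OF r(1)] by blast
    then obtain g where g: "\<And>i. g i \<in> \<Gamma>" "\<And>i. coeff r i - g i \<in> ppow_multiples p 1 S0" by metis
    have g': "coeff r i - g i \<in> ppow_multiples p 1 (ev S0)" for i
      using g(2)[of i] ev_super[OF S0] by (auto simp: ppow_multiples_def)
    have "y - (\<Sum>i<d. g i * s ^ i) = (\<Sum>i<d. (coeff r i - g i) * s ^ i)"
      by (simp add: r expand sum_subtractf algebra_simps)
    also have "\<dots> \<in> ppow_multiples p 1 (ev S0)"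
      using g' sS by (intro ppow_multiples_sum[OF S] ppow_multiples_mult[OF S] subring_power[OF S])
    also have "(\<Sum>i<d. g i * s ^ i) = (\<Sum>i<d. (restrict g {..<d}) i * s ^ i)" by simp
    finally show ?thesis
      unfolding \<Gamma>'_def using g(1)
      by (intro bexI[OF _ imageI[of "restrict g {..<d}"]]) (auto simp: PiE_iff)
  qed
  have sepS: "x = 0" if x: "\<And>j. x \<in> ppow_multiples p j (ev S0)" for x
  proof -
    have "x \<in> ev S0" using x[of 0] by simp
    then obtain r where r: "r \<in> polys S0" "x = poly r s" "degree r < d"
      using reduce[OF S0 fS0] unfolding ev_def by force
    have "coeff r i \<in> ppow_multiples p j S0" for i j
    proof -
      obtain z where z: "z \<in> ev S0" "x = of_nat p ^ j * z" using x[of j] by (auto simp: ppow_multiples_def)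
      obtain r' where r': "r' \<in> polys S0" "z = poly r' s" "degree r' < d"
        using z(1) reduce[OF S0 fS0] unfolding ev_def by force
      have "poly (r - smult (of_nat p ^ j) r') s = 0" using r r' z by simp
      moreover have "r - smult (of_nat p ^ j) r' \<in> polys F"
        using r r' S0 by (intro subsetD[OF polys_mono[OF S0F]] subring_diff[OF polys_subring[OF S0]] polys_smult
            subring_power subring_of_nat)
      moreover have "degree (r - smult (of_nat p ^ j) r') < degree f"
        using r r' degree_smult_le[of "of_nat p ^ j" r'] by (intro degree_diff_less) (auto simp: d_def)
      ultimately have "r - smult (of_nat p ^ j) r' = 0" by (intro min)
      then have "coeff r i = of_nat p ^ j * coeff r' i" by simp
      then show ?thesis using polys_coeff[OF r'(1)] by (simp add: ppow_multiplesI)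
    qed
    then have "r = 0" using sep by (simp add: poly_eq_iff)
    then show ?thesis using r by simp
  qed
  have "ppow_multiples p 1 (ev S0) \<subseteq> ev B0"
  proof
    fix x assume "x \<in> ppow_multiples p 1 (ev S0)"
    then obtain r where r: "r \<in> polys S0" "x = of_nat p * poly r s" by (auto simp: ppow_multiples_def ev_def)
    \<comment> \<open>Multiplication by \<open>p\<close> moves the coefficients from
      \<open>S0\<close> into \<open>B0\<close>.\<close>
    have "smult (of_nat p) r \<in> polys B0"
      using r(1) pB0 by (auto simp: polys_def ppow_multiples_def)
    then show "x \<in> ev B0" unfolding ev_def using r(2) by (intro image_eqI[of _ _ "smult (of_nat p) r"]) auto
  qed
  moreover have "ev B0 \<subseteq> ev S0" unfolding ev_def using polys_mono[OF B0(2)] by (rule image_mono)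
  ultimately have "padic_model p (ev S0) (ev B0)"
    unfolding padic_model_def using p S B fin cov sepS by blast
  moreover have "ev S0 \<subseteq> adjoin F s"
  proof -
    have "polys S0 \<subseteq> polys F" by (rule polys_mono[OF S0F])
    then have "poly h s \<in> adjoin F s" if "h \<in> polys S0" for h
      using that subring_1[OF PF] by (intro adjoinI[of h F 1]) auto
    then show ?thesis by (auto simp: ev_def)
  qed
  moreover have "T \<subseteq> ev B0"
  proof
    fix x assume x: "x \<in> T"
    have "h x \<in> polys B0" using x T0 by (intro coeff_in_subringI[OF B0(1)]) (auto simp: T0_def)
    then show "x \<in> ev B0" using h(2)[OF x] by (auto simp: ev_def)
  qed
  ultimately show "\<exists>p S B. padic_model p S B \<and> S \<subseteq> adjoin F s \<and> T \<subseteq> B" by blast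
qed

text \<open>The counterpart of Cassels' embedding of finitely generated fields of characteristic
  zero into p-adic fields.\<close>

theorem finite_set_padic_model:
  fixes T :: "'a::field_char_0 set"
  assumes "finite T"
  obtains p S B where "padic_model p S B" "T \<subseteq> B"
proof -
  have "\<exists>F. subfield_set F \<and> padically_coverable F \<and> T \<subseteq> F"
    using assms
  proof (induction T rule: finite_induct)
    case empty
    show ?case using rats_subfield rats_coverable by blast
  next
    case (insert s T)
    then obtain F where F: "subfield_set F" "padically_coverable F" "T \<subseteq> F" by blast
    have "padically_coverable (adjoin F s)"
      using adjoin_transcendental_coverable[OF F(1,2)] adjoin_algebraic_coverable[OF F(1,2)] by blast
    then show ?case
      using F adjoin_subfield[OF F(1), of s] adjoin_superset[OF subfield_setD(1)[OF F(1)], of s]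
        adjoin_generator[OF subfield_setD(1)[OF F(1)], of s]
      by (intro exI[of _ "adjoin F s"]) auto
  qed
  then obtain F where "padically_coverable F" "T \<subseteq> F" by blast
  then show ?thesis using padically_coverableE[OF _ assms] that by metis
qed

section \<open>Linear recurrences\<close>

lemma funpow_fdiff_add:
  "(fdiff ^^ k) (\<lambda>n. u n + v n) n = (fdiff ^^ k) u n + (fdiff ^^ k) v n"
  by (induction k arbitrary: n) (simp_all add: fdiff_def)

lemma funpow_fdiff_diff:
  "(fdiff ^^ k) (\<lambda>n. u n - v n) n = (fdiff ^^ k) u n - (fdiff ^^ k) v n"
  by (induction k arbitrary: n) (simp_all add: fdiff_def)

lemma funpow_fdiff_cmult:
  "(fdiff ^^ k) (\<lambda>n. c * u n) n = (c :: 'a::comm_ring_1) * (fdiff ^^ k) u n"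
  by (induction k arbitrary: n) (simp_all add: fdiff_def right_diff_distrib)

lemma funpow_fdiff_shift: "(fdiff ^^ k) (\<lambda>n. u (Suc n)) n = (fdiff ^^ k) u (Suc n)"
  by (induction k arbitrary: n) (simp_all add: fdiff_def)

lemma funpow_fdiff_const: "(fdiff ^^ k) (\<lambda>_. c) n = (if k = 0 then c else 0)"
  by (induction k arbitrary: n) (auto simp: fdiff_def)

text \<open>By \<open>newton_forward\<close> it would suffice that the k-th differences at 0 lie in
  p^k S; demanding it at all \<open>n\<close> builds in invariance under shifts.\<close>

definition padic_analytic :: "nat \<Rightarrow> 'a::comm_ring_1 set \<Rightarrow> (nat \<Rightarrow> 'a) set" where
  "padic_analytic p S = {v. \<forall>k n. (fdiff ^^ k) v n \<in> ppow_multiples p k S}"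

lemma padic_analytic_diff:
  assumes "unital_subring S" "u \<in> padic_analytic p S" "v \<in> padic_analytic p S"
  shows "(\<lambda>n. u n - v n) \<in> padic_analytic p S"
  using assms by (simp add: padic_analytic_def funpow_fdiff_diff ppow_multiples_diff)

lemma padic_analytic_const:
  assumes "unital_subring S" "c \<in> S" shows "(\<lambda>_. c) \<in> padic_analytic p S"
  using assms by (auto simp: padic_analytic_def funpow_fdiff_const ppow_multiples_zero)

text \<open>The Leibniz rule for differences splits off a factor \<open>fdiff u\<close> or
  \<open>fdiff v\<close>. The offsets \<open>e\<close> and \<open>f\<close> count powers of
  \<open>p\<close> already gained, so the hypothesis applies to these differences with an offset
  raised by one.\<close>

lemma funpow_fdiff_mult:
  assumes S: "unital_subring S"
    and "\<And>k n. (fdiff ^^ k) u n \<in> ppow_multiples p (k + e) S"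
    and "\<And>k n. (fdiff ^^ k) v n \<in> ppow_multiples p (k + f) S"
  shows "(fdiff ^^ k) (\<lambda>n. u n * v n) n \<in> ppow_multiples p (k + (e + f)) S"
  using assms(2,3)
proof (induction k arbitrary: u v e f n)
  case 0
  show ?case using ppow_multiples_prod[OF S 0(1)[of 0 n] 0(2)[of 0 n]] by simp
next
  case (Suc k)
  have u: "(fdiff ^^ k) (fdiff u) n \<in> ppow_multiples p (k + Suc e) S" for k n
    using Suc.prems(1)[of "Suc k" n] by (simp add: funpow_swap1)
  have v: "(fdiff ^^ k) (fdiff v) n \<in> ppow_multiples p (k + Suc f) S" for k n
    using Suc.prems(2)[of "Suc k" n] by (simp add: funpow_swap1)
  have v': "(fdiff ^^ k) (\<lambda>n. v (Suc n)) n \<in> ppow_multiples p (k + f) S" for k n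
    using Suc.prems(2)[of k "Suc n"] by (simp only: funpow_fdiff_shift)
  have leibniz: "fdiff (\<lambda>n. u n * v n) = (\<lambda>n. fdiff u n * v (Suc n) + u n * fdiff v n)"
    by (simp add: fdiff_def fun_eq_iff algebra_simps)
  have "(fdiff ^^ Suc k) (\<lambda>n. u n * v n) n
      = (fdiff ^^ k) (\<lambda>n. fdiff u n * v (Suc n)) n + (fdiff ^^ k) (\<lambda>n. u n * fdiff v n) n"
    by (simp only: funpow_Suc_right o_apply leibniz funpow_fdiff_add)
  then show ?case
    using ppow_multiples_add[OF S, of _ p "k + Suc (e + f)"] Suc.IH[OF u v', of n]
      Suc.IH[OF Suc.prems(1) v, of n] by simp
qed

lemma padic_analytic_mult:
  assumes "unital_subring S" "u \<in> padic_analytic p S" "v \<in> padic_analytic p S"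
  shows "(\<lambda>n. u n * v n) \<in> padic_analytic p S"
  using funpow_fdiff_mult[OF assms(1), of u p 0 v 0] assms(2,3) by (simp add: padic_analytic_def)

lemma padic_analytic_infinitely_many_zeros:
  fixes v :: "nat \<Rightarrow> 'a::field_char_0"
  assumes m: "padic_model p S B" and v: "v \<in> padic_analytic p S" and inf: "infinite {n. v n = 0}"
  shows "v n = 0"
proof (rule padic_modelD(7)[OF m])
  fix j
  show "v n \<in> ppow_multiples p j S"
    using v by (intro padic_infinitely_many_zeros[OF padic_modelD(3,1,2)[OF m] _ inf])
      (simp add: padic_analytic_def)
qed

section \<open>Recurrences that can be solved for either end term\<close>

definition lin_rec :: "(nat \<Rightarrow> 'a::comm_ring_1) \<Rightarrow> nat \<Rightarrow> (nat \<Rightarrow> 'a) \<Rightarrow> bool" where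
  "lin_rec c d w \<longleftrightarrow> (\<forall>n. (\<Sum>i\<le>d. c i * w (n + i)) = 0)"

lemma lin_rec_forward:
  fixes w :: "nat \<Rightarrow> 'a::field"
  assumes "lin_rec c d w" "c d \<noteq> 0"
  shows "w (n + d) = (\<Sum>i<d. - (c i / c d) * w (n + i))"
proof -
  have "(\<Sum>i<d. c i * w (n + i)) + c d * w (n + d) = 0"
    using assms(1) by (simp add: lin_rec_def lessThan_Suc_atMost[symmetric])
  then have "w (n + d) = - (\<Sum>i<d. c i * w (n + i)) / c d"
    using assms(2) by (simp add: field_simps eq_neg_iff_add_eq_0)
  then show ?thesis by (simp add: sum_negf sum_divide_distrib)
qed

lemma lin_rec_backward:
  fixes w :: "nat \<Rightarrow> 'a::field"
  assumes "lin_rec c d w" "c 0 \<noteq> 0"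
  shows "w n = (\<Sum>i\<in>{1..d}. - (c i / c 0) * w (n + i))"
proof -
  have "c 0 * w n + (\<Sum>i\<in>{1..d}. c i * w (n + i)) = 0"
    using assms(1) by (simp add: lin_rec_def sum.atMost_shift[symmetric] atMost_atLeast0 sum.atLeast_Suc_atMost)
  then have "w n = - (\<Sum>i\<in>{1..d}. c i * w (n + i)) / c 0"
    using assms(2) by (simp add: field_simps eq_neg_iff_add_eq_0)
  then show ?thesis by (simp add: sum_negf sum_divide_distrib)
qed

text \<open>Modulo \<open>p\<close> the coordinates of \<open>w (n + l)\<close> in terms of \<open>w l, \<dots>, w (l + d - 1)\<close> take only
  finitely many values, and the recurrence can be run backwards.\<close>

lemma lin_rec_period:
  fixes c :: "nat \<Rightarrow> 'a::field"
  assumes m: "padic_model p S B" and c: "c 0 \<noteq> 0" "c d \<noteq> 0"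
    and c0: "\<And>i. i \<le> d \<Longrightarrow> c i / c 0 \<in> B" and cd: "\<And>i. i \<le> d \<Longrightarrow> c i / c d \<in> B"
  obtains N where "N > 0"
    "\<And>w n. lin_rec c d w \<Longrightarrow> (\<And>n. w n \<in> S) \<Longrightarrow> w (n + N) - w n \<in> ppow_multiples p 1 S"
proof -
  note S = padic_modelD(3)[OF m] and B = padic_modelD(4)[OF m] and BS = padic_modelD(5)[OF m]
  have "\<exists>\<beta>. (\<forall>k. \<beta> k \<in> B) \<and> (\<forall>w l. lin_rec c d w \<longrightarrow> w (n + l) = (\<Sum>k<d. \<beta> k * w (k + l)))" for n
  proof (induction n)
    case 0
    show ?case
    proof (cases "d = 0")
      case True
      \<comment> \<open>A recurrence of order 0 has only the zero solution, matching the empty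
        sum.\<close>
      then have "lin_rec c d w \<longrightarrow> w l = 0" for w l using c by (auto simp: lin_rec_def)
      then show ?thesis using True subring_0[OF B] by auto
    next
      case False
      have "(\<Sum>k<d. (if k = 0 then 1 else 0) * w (k + l)) = (w l :: 'a)" for w l
        using False by (subst sum.mono_neutral_right[where S = "{0}"]) auto
      then show ?thesis
        using subring_0[OF B] subring_1[OF B]
        by (intro exI[of _ "\<lambda>k. if k = 0 then 1 else 0"]) auto
    qed
  next
    case (Suc n)
    then obtain \<beta> where \<beta>: "\<And>k. \<beta> k \<in> B"
      "\<And>w l. lin_rec c d w \<Longrightarrow> w (n + l) = (\<Sum>k<d. \<beta> k * w (k + l))" by blast
    show ?case
    proof (cases d)
      case 0
      then show ?thesis using \<beta> by (intro exI[of _ \<beta>]) (simp add: add_Suc_right[symmetric] del: add_Suc_right)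
    next
      case (Suc d')
      \<comment> \<open>One step of the companion matrix: shift the coordinates, then eliminate the
        term \<open>w (l + d)\<close> by the recurrence.\<close>
      define \<beta>' where "\<beta>' k = (if k = 0 then 0 else \<beta> (k - 1)) - \<beta> d' * (c k / c d)" for k
      \<comment> \<open>Cut off from d on: the claim asks for all \<open>k\<close>, but only for
        \<open>k < d\<close> are the new coordinates known to lie in \<open>B\<close>.\<close>
      define \<beta>'' where "\<beta>'' k = (if k < d then \<beta>' k else 0)" for k
      have "\<beta>' k \<in> B" if "k < d" for k
        unfolding \<beta>'_def using \<beta>(1) subring_0[OF B] cd[of k] that
        by (intro subring_diff[OF B] subring_mult[OF B]) auto
      then have "\<beta>'' k \<in> B" for k using subring_0[OF B] by (simp add: \<beta>''_def)
      moreover have "w (Suc n + l) = (\<Sum>k<d. \<beta>'' k * w (k + l))" if w: "lin_rec c d w" for w l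
      proof -
        have "w (Suc n + l) = (\<Sum>k<d'. \<beta> k * w (k + Suc l)) + \<beta> d' * w (l + d)"
          using \<beta>(2)[OF w, of "Suc l"] Suc by (simp add: add.commute)
        also have "(\<Sum>k<d'. \<beta> k * w (k + Suc l)) = (\<Sum>k<d. (if k = 0 then 0 else \<beta> (k - 1)) * w (k + l))"
          unfolding Suc by (subst sum.lessThan_Suc_shift) simp
        also have "w (l + d) = (\<Sum>i<d. - (c i / c d) * w (l + i))" by (rule lin_rec_forward[OF w c(2)])
        also have "\<beta> d' * \<dots> = (\<Sum>k<d. - (\<beta> d' * (c k / c d)) * w (k + l))"
          by (simp add: sum_distrib_left algebra_simps)
        also have "(\<Sum>k<d. (if k = 0 then 0 else \<beta> (k - 1)) * w (k + l)) + \<dots> = (\<Sum>k<d. \<beta>' k * w (k + l))"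
          unfolding sum.distrib[symmetric] \<beta>'_def by (intro sum.cong) (simp_all add: algebra_simps)
        also have "\<dots> = (\<Sum>k<d. \<beta>'' k * w (k + l))" by (simp add: \<beta>''_def)
        finally show ?thesis .
      qed
      ultimately show ?thesis by blast
    qed
  qed
  then obtain \<beta> where \<beta>: "\<And>n k. \<beta> n k \<in> B"
    "\<And>n w l. lin_rec c d w \<Longrightarrow> w (n + l) = (\<Sum>k<d. \<beta> n k * w (k + l))" by metis
  obtain \<Gamma> where \<Gamma>: "finite \<Gamma>" "\<And>y. y \<in> B \<Longrightarrow> \<exists>g\<in>\<Gamma>. y - g \<in> ppow_multiples p 1 S"
    using padic_model_residuesE[OF m] by blast
  have "\<exists>g. \<forall>n k. g n k \<in> \<Gamma> \<and> \<beta> n k - g n k \<in> ppow_multiples p 1 S"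
    using \<Gamma>(2)[OF \<beta>(1)] by metis
  then obtain g where g: "\<And>n k. g n k \<in> \<Gamma>" "\<And>n k. \<beta> n k - g n k \<in> ppow_multiples p 1 S" by blast
  have "finite (PiE {..<d} (\<lambda>_. \<Gamma>))" using \<Gamma>(1) by (intro finite_PiE) auto
  moreover have "range (\<lambda>n. restrict (g n) {..<d}) \<subseteq> PiE {..<d} (\<lambda>_. \<Gamma>)"
    using g(1) by (intro image_subsetI) (simp add: restrict_PiE_iff)
  ultimately have "finite (range (\<lambda>n. restrict (g n) {..<d}))" by (rule finite_subset[rotated])
  then have "\<not> inj (\<lambda>n. restrict (g n) {..<d})" using range_inj_infinite by blast
  \<comment> \<open>The coordinates do not involve \<open>w\<close>, so the repetition gives a
    period common to all solutions.\<close>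
  then obtain i j where ij: "i < j" "restrict (g i) {..<d} = restrict (g j) {..<d}"
  proof -
    obtain i j where "i \<noteq> j" "restrict (g i) {..<d} = restrict (g j) {..<d}"
      using \<open>\<not> inj _\<close> unfolding inj_def by blast
    then show ?thesis using that[of i j] that[of j i] by (cases "i < j") auto
  qed
  have gij: "g i k = g j k" if "k < d" for k
    using fun_cong[OF ij(2), of k] that by simp
  show ?thesis
  proof (rule that[of "j - i"])
    show "j - i > 0" using ij by simp
    fix w n assume w: "lin_rec c d w" and wS: "\<And>n. w n \<in> S"
    define e where "e n = w (n + (j - i)) - w n" for n
    have "(\<Sum>k\<le>d. c k * e (n + k)) = (\<Sum>k\<le>d. c k * w (n + (j - i) + k)) - (\<Sum>k\<le>d. c k * w (n + k))" for n
      unfolding e_def right_diff_distrib sum_subtractf by (simp add: ac_simps)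
    then have e: "lin_rec c d e" using w by (simp add: lin_rec_def)
    have far: "e n \<in> ppow_multiples p 1 S" if "n \<ge> i" for n
    proof -
      define l where "l = n - i"
      have n: "n = i + l" "n + (j - i) = j + l" using that ij by (auto simp: l_def)
      have "e n = (\<Sum>k<d. ((\<beta> j k - g j k) - (\<beta> i k - g i k)) * w (k + l))"
      proof -
        have "e n = (\<Sum>k<d. \<beta> j k * w (k + l)) - (\<Sum>k<d. \<beta> i k * w (k + l))"
          using \<beta>(2)[OF w, of j l] \<beta>(2)[OF w, of i l] n by (simp only: e_def)
        then show ?thesis
          by (simp only: sum_subtractf[symmetric]) (intro sum.cong, auto simp: gij algebra_simps)
      qed
      also have "\<dots> \<in> ppow_multiples p 1 S"
        by (intro ppow_multiples_sum[OF S] ppow_multiples_mult[OF S _ wS] ppow_multiples_diff[OF S g(2) g(2)])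
      finally show ?thesis .
    qed
    \<comment> \<open>From \<open>i\<close> on the congruence holds; the recurrence, solved for its
      lowest term, carries it back to 0.\<close>
    have "e n \<in> ppow_multiples p 1 S" for n
    proof (induction "i - n" arbitrary: n rule: less_induct)
      case less
      show ?case
      proof (cases "n \<ge> i")
        case True
        then show ?thesis by (rule far)
      next
        case False
        have "(\<Sum>k\<in>{1..d}. - (c k / c 0) * e (n + k)) \<in> ppow_multiples p 1 S"
        proof (rule ppow_multiples_sum[OF S])
          fix k assume k: "k \<in> {1..d}"
          have "i - (n + k) < i - n" using k False by auto
          then have "e (n + k) \<in> ppow_multiples p 1 S" by (rule less)
          moreover have "- (c k / c 0) \<in> S" using c0[of k] k BS subring_uminus[OF S] by auto
          ultimately show "- (c k / c 0) * e (n + k) \<in> ppow_multiples p 1 S"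
            by (rule ppow_multiples_mult_left[OF S])
        qed
        then show ?thesis using lin_rec_backward[OF e c(1), of n] by simp
      qed
    qed
    then show "w (n + (j - i)) - w n \<in> ppow_multiples p 1 S" by (simp add: e_def)
  qed
qed

text \<open>All of \<open>W\<close> and the extra scalars \<open>T\<close> share one model and one
  step \<open>N\<close>, because elimination will multiply their sequences with each other. The
  quotients by both end coefficients go into \<open>B\<close> so that the recurrence runs in either
  direction.\<close>

theorem lin_rec_padic_analytic:
  fixes c :: "nat \<Rightarrow> 'a::field_char_0"
  assumes c: "c 0 \<noteq> 0" "c d \<noteq> 0" and W: "finite W" "\<And>w. w \<in> W \<Longrightarrow> lin_rec c d w" and "finite T"
  obtains p S B N where "padic_model p S B" "N > 0" "T \<subseteq> S"
    "\<And>w r. w \<in> W \<Longrightarrow> (\<lambda>n. w (r + N * n)) \<in> padic_analytic p S"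
proof -
  define T' where "T' = T \<union> (\<lambda>i. c i / c 0) ` {..d} \<union> (\<lambda>i. c i / c d) ` {..d} \<union> (\<Union>w\<in>W. w ` {..<d})"
  have "finite T'" using assms by (simp add: T'_def)
  then obtain p S B where m: "padic_model p S B" and T': "T' \<subseteq> B" by (rule finite_set_padic_model)
  note S = padic_modelD(3)[OF m] and B = padic_modelD(4)[OF m] and BS = padic_modelD(5)[OF m]
  have p0: "of_nat p \<noteq> (0 :: 'a)" using padic_modelD(2)[OF m] by simp
  have cB: "c i / c 0 \<in> B" "c i / c d \<in> B" if "i \<le> d" for i using T' that by (auto simp: T'_def)
  obtain N where N: "N > 0"
    "\<And>w n. lin_rec c d w \<Longrightarrow> (\<And>n. w n \<in> S) \<Longrightarrow> w (n + N) - w n \<in> ppow_multiples p 1 S"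
    using lin_rec_period[OF m c cB] by metis
  have WS: "w n \<in> S" if "w \<in> W" for w n
  proof -
    have "w n \<in> B"
    proof (induction n rule: less_induct)
      case (less n)
      show ?case
      proof (cases "n < d")
        case True
        then show ?thesis using T' that unfolding T'_def by blast
      next
        case False
        have "(\<Sum>i<d. - (c i / c d) * w (n - d + i)) \<in> B"
        proof (rule subring_sum[OF B])
          fix i assume i: "i \<in> {..<d}"
          have "c i / c d \<in> B" using cB(2)[of i] i by simp
          then show "- (c i / c d) * w (n - d + i) \<in> B"
            using less[of "n - d + i"] i False by (intro subring_mult[OF B] subring_uminus[OF B]) auto
        qed
        then show ?thesis using lin_rec_forward[OF W(2)[OF that] c(2), of "n - d"] False by simp
      qed
    qed
    then show ?thesis using BS by blast
  qed
  have "(fdiff ^^ k) (\<lambda>n. w (r + N * n)) n \<in> ppow_multiples p k S"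
    if "lin_rec c d w" "\<And>n. w n \<in> S" for w r k n
    using that
  proof (induction k arbitrary: w n)
    case 0
    then show ?case by simp
  next
    case (Suc k)
    \<comment> \<open>Again a solution with values in \<open>S\<close>, so the induction hypothesis
      applies to \<open>e\<close> in place of \<open>w\<close>.\<close>
    define e where "e n = (w (n + N) - w n) / of_nat p" for n
    have eS: "e n \<in> S" for n
      using N(2)[OF Suc.prems, of n] p0 by (auto simp: e_def ppow_multiples_def)
    have "(\<Sum>i\<le>d. c i * e (n + i)) = ((\<Sum>i\<le>d. c i * w (n + N + i)) - (\<Sum>i\<le>d. c i * w (n + i))) / of_nat p" for n
      unfolding e_def by (simp add: right_diff_distrib diff_divide_distrib sum_subtractf sum_divide_distrib ac_simps)
    then have e: "lin_rec c d e" using Suc.prems(1) by (simp add: lin_rec_def)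
    have "fdiff (\<lambda>n. w (r + N * n)) = (\<lambda>n. of_nat p * e (r + N * n))"
      using p0 by (simp add: fdiff_def e_def fun_eq_iff ac_simps)
    then have "(fdiff ^^ Suc k) (\<lambda>n. w (r + N * n)) n = of_nat p * (fdiff ^^ k) (\<lambda>n. e (r + N * n)) n"
      by (simp only: funpow_Suc_right o_apply funpow_fdiff_cmult)
    also have "\<dots> \<in> ppow_multiples p (1 + k) S"
      using ppow_multiplesI[of 1 S p 1] subring_1[OF S]
      by (intro ppow_multiples_prod[OF S] Suc.IH[OF e eS]) simp
    finally show ?case by simp
  qed
  then have "(\<lambda>n. w (r + N * n)) \<in> padic_analytic p S" if "w \<in> W" for w r
    using W(2)[OF that] WS[OF that] by (simp add: padic_analytic_def)
  moreover have "T \<subseteq> S" using T' BS by (auto simp: T'_def)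
  ultimately show ?thesis using that m N(1) by blast
qed

section \<open>Membership in a varying span\<close>

text \<open>One scaling for coefficient vectors and for polynomials in words alike.\<close>

definition fscale :: "'a::field \<Rightarrow> ('b \<Rightarrow> 'a) \<Rightarrow> 'b \<Rightarrow> 'a" where
  "fscale c f = (\<lambda>i. c * f i)"

lemma fscale_apply: "fscale c f i = c * f i"
  by (simp add: fscale_def)

interpretation fv: vector_space "fscale :: 'a::field \<Rightarrow> ('b \<Rightarrow> 'a) \<Rightarrow> 'b \<Rightarrow> 'a"
  by unfold_locales (auto simp: fun_eq_iff fscale_apply algebra_simps)

lemma fscale_module_homI:
  assumes "\<And>x y. f (x + y) = f x + f y" "\<And>c x. f (fscale c x) = fscale c (f x)"
  shows "module_hom fscale fscale f"
  using assms by unfold_locales auto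

text \<open>\<open>\<pi>\<close> is linear with kernel spanned by \<open>a\<close>, so it realises
  the quotient by \<open>a\<close>. It multiplies by the pivot instead of dividing, because inverses
  of analytic sequences need not be analytic.\<close>

lemma span_insert_pivot:
  fixes a :: "'b \<Rightarrow> 'a::field"
  assumes "a j \<noteq> 0"
  defines "\<pi> \<equiv> \<lambda>x i. a j * x i - x j * a i"
  shows "v \<in> fv.span (insert a A) \<longleftrightarrow> \<pi> v \<in> fv.span (\<pi> ` A)"
proof -
  have lin: "module_hom fscale fscale \<pi>"
    by (rule fscale_module_homI) (auto simp: \<pi>_def fun_eq_iff fscale_apply algebra_simps)
  have img: "fv.span (\<pi> ` A) = \<pi> ` fv.span A" by (rule module_hom.span_image[OF lin])
  show ?thesis
  proof
    assume "v \<in> fv.span (insert a A)"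
    then obtain k where k: "v - fscale k a \<in> fv.span A" by (auto simp: fv.span_breakdown_eq)
    have "\<pi> v = \<pi> (v - fscale k a)" by (simp add: \<pi>_def fun_eq_iff fscale_apply algebra_simps)
    then show "\<pi> v \<in> fv.span (\<pi> ` A)" using k img by blast
  next
    assume "\<pi> v \<in> fv.span (\<pi> ` A)"
    then obtain x where x: "x \<in> fv.span A" "\<pi> v = \<pi> x" using img by blast
    have "a j * (v i - x i) = (v j - x j) * a i" for i
      using fun_cong[OF x(2), of i] by (simp add: \<pi>_def algebra_simps)
    then have "v - fscale ((v j - x j) / a j) a = x"
      using assms(1) by (auto simp: fun_eq_iff fscale_apply field_simps)
    then show "v \<in> fv.span (insert a A)" using x(1) unfolding fv.span_breakdown_eq by (metis (no_types))
  qed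
qed

text \<open>Fraction-free Gaussian elimination over \<open>\<C>\<close>, which behaves like an integral domain:
  a pivot that is not identically zero vanishes only finitely often.\<close>

lemma span_membership_finite_or_cofinite:
  fixes gs :: "(nat \<Rightarrow> 'b \<Rightarrow> 'a::field) list"
  assumes diff: "\<And>f g. f \<in> \<C> \<Longrightarrow> g \<in> \<C> \<Longrightarrow> (\<lambda>n. f n - g n) \<in> \<C>"
    and mult: "\<And>f g. f \<in> \<C> \<Longrightarrow> g \<in> \<C> \<Longrightarrow> (\<lambda>n. f n * g n) \<in> \<C>"
    and zero: "\<And>f n. f \<in> \<C> \<Longrightarrow> infinite {n. f n = 0} \<Longrightarrow> f n = 0"
    and "\<And>g i. g \<in> set gs \<Longrightarrow> (\<lambda>n. g n i) \<in> \<C>" "\<And>i. (\<lambda>n. v n i) \<in> \<C>"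
  shows "finite {n. v n \<in> fv.span ((\<lambda>g. g n) ` set gs)} \<or> finite {n. v n \<notin> fv.span ((\<lambda>g. g n) ` set gs)}"
  using assms(4,5)
proof (induction "length gs" arbitrary: gs v)
  case 0
  show ?case
  proof (cases "\<exists>n. v n \<noteq> 0")
    case True
    then obtain n i where "v n i \<noteq> 0" by (auto simp: fun_eq_iff)
    then have "finite {n. v n i = 0}" using zero[OF 0(3)] by blast
    then have "finite {n. v n = 0}" by (rule finite_subset[rotated]) auto
    then show ?thesis using 0 by simp
  next
    case False
    then show ?thesis using 0 by simp
  qed
next
  case (Suc k)
  then obtain g hs where gs: "gs = g # hs" "k = length hs" by (cases gs) auto
  show ?case
  proof (cases "\<exists>n. g n \<noteq> 0")
    case False
    then have "fv.span ((\<lambda>g. g n) ` set gs) = fv.span ((\<lambda>g. g n) ` set hs)" for n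
      using False by (simp add: gs)
    then show ?thesis using Suc.hyps(1)[OF gs(2), of v] Suc.prems gs by simp
  next
    case True
    then obtain n j where "g n j \<noteq> 0" by (auto simp: fun_eq_iff)
    then have fin: "finite {n. g n j = 0}" using zero[OF Suc.prems(1)[of g j]] gs by auto
    define \<pi> where "\<pi> h n i = g n j * h n i - h n j * g n i" for h :: "nat \<Rightarrow> 'b \<Rightarrow> 'a" and n i
    have \<pi>: "(\<lambda>n. \<pi> h n i) \<in> \<C>" if "\<And>i. (\<lambda>n. h n i) \<in> \<C>" for h i
      unfolding \<pi>_def using that Suc.prems(1)[of g] gs by (intro diff mult) auto
    define A where "A = {n. v n \<in> fv.span ((\<lambda>g. g n) ` set gs)}"
    define A' where "A' = {n. \<pi> v n \<in> fv.span ((\<lambda>g. g n) ` set (map \<pi> hs))}"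
    have "finite A' \<or> finite (- A')"
      using Suc.hyps(1)[of "map \<pi> hs" "\<pi> v"] gs Suc.prems \<pi>
      by (fastforce simp: A'_def Collect_neg_eq)
    moreover have "n \<in> A \<longleftrightarrow> n \<in> A'" if "g n j \<noteq> 0" for n
      using span_insert_pivot[of "g n" j "v n" "(\<lambda>g. g n) ` set hs", OF that]
      by (simp add: A_def A'_def gs \<pi>_def[abs_def] image_image)
    then have "A \<subseteq> A' \<union> {n. g n j = 0}" "- A \<subseteq> - A' \<union> {n. g n j = 0}" by auto
    ultimately have "finite A \<or> finite (- A)"
      using fin by (meson finite_UnI finite_subset)
    then show ?thesis by (simp add: A_def Collect_neg_eq)
  qed
qed

section \<open>Eventually periodic sets\<close>

definition eventually_periodic :: "nat set \<Rightarrow> bool" where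
  "eventually_periodic A \<longleftrightarrow> (\<exists>a N. N > 0 \<and> (\<forall>n\<ge>a. n \<in> A \<longleftrightarrow> n + N \<in> A))"

lemma eventually_periodicI:
  assumes N: "N > 0"
    and "\<And>r. finite {n. a + (r + N * n) \<in> A} \<or> finite {n. a + (r + N * n) \<notin> A}"
  shows "eventually_periodic A"
proof -
  have "\<exists>b. \<forall>n\<ge>b. (a + (r + N * n) \<in> A) = (a + (r + N * Suc n) \<in> A)" for r
    using assms(2)[of r]
  proof (elim disjE)
    assume "finite {n. a + (r + N * n) \<in> A}"
    then obtain b where "\<forall>n\<in>{n. a + (r + N * n) \<in> A}. n < b" by (auto simp: finite_nat_set_iff_bounded)
    then show ?thesis by (intro exI[of _ b]) (metis le_SucI mem_Collect_eq not_le)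
  next
    assume "finite {n. a + (r + N * n) \<notin> A}"
    then obtain b where "\<forall>n\<in>{n. a + (r + N * n) \<notin> A}. n < b" by (auto simp: finite_nat_set_iff_bounded)
    then show ?thesis by (intro exI[of _ b]) (metis le_SucI mem_Collect_eq not_le)
  qed
  then obtain b where b: "\<And>r n. n \<ge> b r \<Longrightarrow> a + (r + N * n) \<in> A \<longleftrightarrow> a + (r + N * Suc n) \<in> A" by metis
  define M where "M = Max (b ` {..<N})"
  have M: "b r \<le> M" if "r < N" for r unfolding M_def using that by (intro Max_ge) auto
  show ?thesis
    unfolding eventually_periodic_def
  proof (rule exI[of _ "a + N * M"], rule exI[of _ N], intro conjI allI impI)
    show "N > 0" by (rule N)
    fix n assume n: "n \<ge> a + N * M"
    define r q where "r = (n - a) mod N" and "q = (n - a) div N"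
    have "n = a + (r + N * q)" using n by (simp add: r_def q_def)
    moreover have "q \<ge> M" using n N by (simp add: q_def less_eq_div_iff_mult_less_eq mult.commute)
    ultimately show "n \<in> A \<longleftrightarrow> n + N \<in> A"
      using b[of r q] M[of r] N by (simp add: r_def algebra_simps)
  qed
qed

lemma eventually_periodic_Not:
  "eventually_periodic {n. P n} \<Longrightarrow> eventually_periodic {n. \<not> P n}"
  unfolding eventually_periodic_def by auto

text \<open>Dependence of a family, not of a set: powers of a matrix may coincide, and then the set
  of them would be too small. The induction clears one coordinate with the vector
  \<open>y k0\<close>.\<close>

lemma nontrivial_relation:
  fixes y :: "'c \<Rightarrow> 'b \<Rightarrow> 'a::field"
  assumes "finite I" "finite K" "card I < card K"
  shows "\<exists>e. (\<exists>k\<in>K. e k \<noteq> 0) \<and> (\<forall>i\<in>I. (\<Sum>k\<in>K. e k * y k i) = 0)"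
  using assms
proof (induction I arbitrary: K y rule: finite_induct)
  case empty
  then have "K \<noteq> {}" by auto
  then show ?case by (intro exI[of _ "\<lambda>_. 1"]) auto
next
  case (insert x I)
  show ?case
  proof (cases "\<forall>k\<in>K. y k x = 0")
    case True
    have "card I < card K" using insert by simp
    then show ?thesis using insert.IH[OF insert.prems(1), of y] True by auto
  next
    case False
    then obtain k0 where k0: "k0 \<in> K" "y k0 x \<noteq> 0" by auto
    define K' where "K' = K - {k0}"
    have K: "K = insert k0 K'" "k0 \<notin> K'" "finite K'" using k0 insert.prems by (auto simp: K'_def)
    have "card I < card K'" using insert.prems insert.hyps K by simp
    then obtain e where e: "\<exists>k\<in>K'. e k \<noteq> 0"
      "\<And>i. i \<in> I \<Longrightarrow> (\<Sum>k\<in>K'. e k * (y k i - y k x / y k0 x * y k0 i)) = 0"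
      using insert.IH[OF K(3), of "\<lambda>k i. y k i - y k x / y k0 x * y k0 i"] by auto
    define e' where "e' = e(k0 := - (\<Sum>k\<in>K'. e k * (y k x / y k0 x)))"
    have rel: "(\<Sum>k\<in>K. e' k * y k i) = (\<Sum>k\<in>K'. e k * (y k i - y k x / y k0 x * y k0 i))" for i
    proof -
      have "(\<Sum>k\<in>K'. e' k * y k i) = (\<Sum>k\<in>K'. e k * y k i)"
        using K(2) by (intro sum.cong) (auto simp: e'_def)
      then have "(\<Sum>k\<in>K. e' k * y k i)
          = - (\<Sum>k\<in>K'. e k * (y k x / y k0 x)) * y k0 i + (\<Sum>k\<in>K'. e k * y k i)"
        using K by (simp add: e'_def)
      then show ?thesis
        by (simp add: right_diff_distrib sum_subtractf sum_distrib_right mult.assoc)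
    qed
    have "(\<Sum>k\<in>K. e' k * y k i) = 0" if "i \<in> insert x I" for i
      using that e(2)[of i] k0(2) by (auto simp: rel)
    moreover have "\<exists>k\<in>K. e' k \<noteq> 0" using e(1) K by (auto simp: e'_def)
    ultimately show ?thesis by blast
  qed
qed

section \<open>Orbits of subspaces under an endomorphism\<close>

lemma sum_fun_apply: "(\<Sum>j\<in>A. f j) i = (\<Sum>j\<in>A. f j i)"
  by (induction A rule: infinite_finite_induct) auto

lemma unitv_in_vecs: "j \<in> {1..m} \<Longrightarrow> unitv j \<in> vecs m"
  by (auto simp: vecs_def unitv_def)

lemma vecs_expansion:
  assumes "v \<in> vecs m" shows "v = (\<Sum>j\<in>{1..m}. fscale (v j) (unitv j))"
proof
  fix i
  have "(\<Sum>j\<in>{1..m}. fscale (v j) (unitv j)) i = (\<Sum>j\<in>{1..m}. if j = i then v j else 0)"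
    unfolding sum_fun_apply by (intro sum.cong) (auto simp: fscale_apply unitv_def)
  then show "v i = (\<Sum>j\<in>{1..m}. fscale (v j) (unitv j)) i"
    using assms by (auto simp: vecs_def)
qed

lemma subspace_finite_basis:
  fixes L :: "(nat \<Rightarrow> 'k::field) set"
  assumes "is_subspace m L"
  obtains Ls where "set Ls \<subseteq> L" "L \<subseteq> fv.span (set Ls)"
proof -
  obtain B where B: "B \<subseteq> L" "fv.independent B" "L \<subseteq> fv.span B"
    by (rule fv.maximal_independent_subset)
  have "vecs m \<subseteq> fv.span (unitv ` {1..m} :: (nat \<Rightarrow> 'k) set)"
  proof
    fix v :: "nat \<Rightarrow> 'k" assume "v \<in> vecs m"
    then have "v = (\<Sum>j\<in>{1..m}. fscale (v j) (unitv j))" by (rule vecs_expansion)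
    also have "\<dots> \<in> fv.span (unitv ` {1..m})"
      by (intro fv.span_sum fv.span_scale fv.span_base) auto
    finally show "v \<in> fv.span (unitv ` {1..m})" .
  qed
  moreover have "B \<subseteq> vecs m" using B(1) assms by (auto simp: is_subspace_def)
  ultimately have "finite B" using fv.independent_span_bound[OF _ B(2), of "unitv ` {1..m}"] by blast
  then obtain Ls where "set Ls = B" using finite_list by blast
  then show ?thesis using that B by blast
qed

text \<open>Replaces \<open>\<sigma>\<close> by a map that is linear on all of \<open>nat \<Rightarrow> 'k\<close>; the relations of the algebra
  only involve the images of the basis vectors.\<close>

definition matrix_map :: "nat \<Rightarrow> ((nat \<Rightarrow> 'k::field) \<Rightarrow> nat \<Rightarrow> 'k) \<Rightarrow> (nat \<Rightarrow> 'k) \<Rightarrow> nat \<Rightarrow> 'k" where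
  "matrix_map m \<sigma> v = (\<lambda>i. if i \<in> {1..m} then \<Sum>j\<in>{1..m}. v j * \<sigma> (unitv j) i else 0)"

lemma matrix_map_add: "matrix_map m \<sigma> (u + v) = matrix_map m \<sigma> u + matrix_map m \<sigma> v"
  by (auto simp: matrix_map_def fun_eq_iff distrib_right sum.distrib)

lemma matrix_map_scale: "matrix_map m \<sigma> (fscale c v) = fscale c (matrix_map m \<sigma> v)"
  by (auto simp: matrix_map_def fun_eq_iff fscale_apply sum_distrib_left mult.assoc)

lemma matrix_map_in_vecs: "matrix_map m \<sigma> v \<in> vecs m"
  by (auto simp: matrix_map_def vecs_def)

lemma matrix_map_unitv:
  assumes "i \<in> {1..m}"
  shows "matrix_map m \<sigma> (unitv i) = (\<Sum>j\<in>{1..m}. fscale (\<sigma> (unitv i) j) (unitv j))"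
proof -
  have "(\<Sum>l\<in>{1..m}. unitv i l * \<sigma> (unitv l) j) = (\<Sum>l\<in>{1..m}. if l = i then \<sigma> (unitv l) j else 0)" for j
    by (intro sum.cong) (auto simp: unitv_def)
  then have "matrix_map m \<sigma> (unitv i) j = \<sigma> (unitv i) j" if "j \<in> {1..m}" for j
    using assms that by (simp add: matrix_map_def)
  then show ?thesis
    by (subst vecs_expansion[OF matrix_map_in_vecs]) (intro sum.cong, auto)
qed

lemma funpow_matrix_map_hom: "module_hom fscale fscale (matrix_map m \<sigma> ^^ n)"
proof (rule fscale_module_homI)
  show "(matrix_map m \<sigma> ^^ n) (x + y) = (matrix_map m \<sigma> ^^ n) x + (matrix_map m \<sigma> ^^ n) y" for x y
    by (induction n) (simp_all only: funpow.simps o_apply id_apply matrix_map_add)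
  show "(matrix_map m \<sigma> ^^ n) (fscale c x) = fscale c ((matrix_map m \<sigma> ^^ n) x)" for c x
    by (induction n) (simp_all only: funpow.simps o_apply id_apply matrix_map_scale)
qed

lemma funpow_matrix_map_in_vecs: "v \<in> vecs m \<Longrightarrow> (matrix_map m \<sigma> ^^ n) v \<in> vecs m"
  by (induction n) (auto simp: matrix_map_in_vecs)

text \<open>m^2 + 1 powers of a matrix with m^2 entries are dependent; any annihilating polynomial
  serves in place of the characteristic one.\<close>

lemma matrix_map_powers_dependent:
  obtains e :: "nat \<Rightarrow> 'k::field" and k0 d where "k0 \<le> d" "e k0 \<noteq> 0"
    "\<And>v i. v \<in> vecs m \<Longrightarrow> (\<Sum>k\<le>d. e k * (matrix_map m \<sigma> ^^ k) v i) = 0"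
proof -
  define T where "T = matrix_map m \<sigma>"
  define d where "d = m * m"
  have "card ({1..m} \<times> {1..m}) < card {..d}" by (simp add: d_def)
  then obtain e where e: "\<exists>k\<in>{..d}. e k \<noteq> 0"
    "\<forall>ji\<in>{1..m} \<times> {1..m}. (\<Sum>k\<le>d. e k * (case ji of (j, i) \<Rightarrow> (T ^^ k) (unitv j) i)) = 0"
    using nontrivial_relation[of "{1..m} \<times> {1..m}" "{..d}" "\<lambda>k (j, i). (T ^^ k) (unitv j) i"]
    by blast
  have "(\<Sum>k\<le>d. e k * (T ^^ k) v i) = 0" if v: "v \<in> vecs m" for v i
  proof (cases "i \<in> {1..m}")
    case False
    then have "(T ^^ k) v i = 0" for k
      using funpow_matrix_map_in_vecs[OF v, where \<sigma> = \<sigma> and n = k] by (simp add: vecs_def T_def)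
    then show ?thesis by simp
  next
    case True
    have "(T ^^ k) v i = (\<Sum>j\<in>{1..m}. v j * (T ^^ k) (unitv j) i)" for k
    proof -
      interpret h: module_hom fscale fscale "T ^^ k"
        unfolding T_def by (rule funpow_matrix_map_hom)
      have "(T ^^ k) v = (\<Sum>j\<in>{1..m}. fscale (v j) ((T ^^ k) (unitv j)))"
        by (subst vecs_expansion[OF v]) (simp only: h.sum h.scale)
      then show ?thesis by (simp add: sum_fun_apply fscale_apply)
    qed
    then have "(\<Sum>k\<le>d. e k * (T ^^ k) v i) = (\<Sum>k\<le>d. \<Sum>j\<in>{1..m}. v j * (e k * (T ^^ k) (unitv j) i))"
      by (simp add: sum_distrib_left mult.left_commute)
    also have "\<dots> = (\<Sum>j\<in>{1..m}. v j * (\<Sum>k\<le>d. e k * (T ^^ k) (unitv j) i))"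
      by (subst sum.swap) (simp add: sum_distrib_left)
    also have "\<dots> = 0"
      using e(2) True by (intro sum.neutral ballI) force
    finally show ?thesis .
  qed
  then show ?thesis using that e(1) unfolding T_def by blast
qed

text \<open>An annihilating polynomial of the map gives one recurrence for the entries of all
  orbits, so along each residue class modulo a common \<open>N\<close> every vector in the span
  problem has analytic entries.\<close>

theorem span_orbit_eventually_periodic:
  fixes v :: "nat \<Rightarrow> 'k::field_char_0"
  assumes Ls: "set Ls \<subseteq> vecs m" and Xs: "set Xs \<subseteq> vecs m" and v: "v \<in> vecs m"
  shows "eventually_periodic {n. v \<in> fv.span ((matrix_map m \<sigma> ^^ n) ` set Ls \<union> set Xs)}"
proof -
  define T where "T = matrix_map m \<sigma>"
  obtain e k0 d0 where e: "k0 \<le> d0" "e k0 \<noteq> 0"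
    "\<And>v i. v \<in> vecs m \<Longrightarrow> (\<Sum>k\<le>d0. e k * (T ^^ k) v i) = 0"
    unfolding T_def by (rule matrix_map_powers_dependent) blast
  define K where "K = {k. k \<le> d0 \<and> e k \<noteq> 0}"
  have K: "finite K" "k0 \<in> K" using e by (auto simp: K_def)
  \<comment> \<open>The orbits are started at the lowest exponent \<open>a\<close> of the
    polynomial. This makes \<open>c 0\<close> nonzero; in other words, \<open>a\<close> steps kill
    the nilpotent part of \<open>T\<close>.\<close>
  define a b where "a = Min K" and "b = Max K"
  have ab: "a \<in> K" "b \<in> K" "\<And>k. k \<in> K \<Longrightarrow> a \<le> k \<and> k \<le> b"
    unfolding a_def b_def using K Min_in[OF K(1)] Max_in[OF K(1)] Min_le[OF K(1)] Max_ge[OF K(1)] by blast+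
  define c where "c i = e (a + i)" for i
  define d where "d = b - a"
  have ab': "a \<le> b" "b \<le> d0" using ab by (auto simp: K_def)
  have c: "c 0 \<noteq> 0" "c d \<noteq> 0" using ab ab' by (auto simp: c_def d_def K_def)
  have rel: "(\<Sum>i\<le>d. c i * (T ^^ (a + i)) u j) = 0" if u: "u \<in> vecs m" for u j
  proof -
    have "(\<Sum>k\<in>{a..b}. e k * (T ^^ k) u j) = (\<Sum>k\<le>d0. e k * (T ^^ k) u j)"
    proof (rule sum.mono_neutral_left)
      have "e k = 0" if "k \<in> {..d0} - {a..b}" for k
        using ab(3)[of k] that by (cases "e k = 0") (auto simp: K_def)
      then show "\<forall>k\<in>{..d0} - {a..b}. e k * (T ^^ k) u j = 0" by simp
    qed (use ab' in auto)
    also have "\<dots> = 0" by (rule e(3)[OF u])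
    also have "(\<Sum>k\<in>{a..b}. e k * (T ^^ k) u j) = (\<Sum>i\<le>d. c i * (T ^^ (a + i)) u j)"
      unfolding c_def d_def using ab'
      by (intro sum.reindex_bij_witness[of _ "\<lambda>i. a + i" "\<lambda>k. k - a"]) auto
    finally show ?thesis .
  qed
  define W where "W = (\<lambda>(l, i) n. (T ^^ (a + n)) l i) ` (set Ls \<times> {1..m})"
  have W: "lin_rec c d w" if w: "w \<in> W" for w
  proof -
    obtain l i where l: "l \<in> set Ls" "w = (\<lambda>n. (T ^^ (a + n)) l i)" using w by (auto simp: W_def)
    have "(T ^^ (a + (n + k))) l = (T ^^ (a + k)) ((T ^^ n) l)" for n k
    proof -
      have eq: "a + (n + k) = (a + k) + n" by simp
      show ?thesis by (simp only: eq funpow_add o_apply)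
    qed
    then show ?thesis
      using rel[OF funpow_matrix_map_in_vecs] l Ls by (auto simp: lin_rec_def T_def)
  qed
  \<comment> \<open>The constant vectors enter the elimination too, so their coordinates must lie in
    \<open>S\<close>.\<close>
  define C where "C = (\<Union>x\<in>insert v (set Xs). x ` {1..m})"
  have fin: "finite W" "finite C" by (auto simp: W_def C_def)
  obtain p S B N where m: "padic_model p S B" and N: "N > 0" and C: "C \<subseteq> S"
    and an: "\<And>w r. w \<in> W \<Longrightarrow> (\<lambda>n. w (r + N * n)) \<in> padic_analytic p S"
    using lin_rec_padic_analytic[OF c fin(1) W fin(2)] by metis
  note S = padic_modelD(3)[OF m]
  have const: "(\<lambda>n. x i) \<in> padic_analytic p S" if "x \<in> insert v (set Xs)" for x i
  proof (rule padic_analytic_const[OF S])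
    show "x i \<in> S"
    proof (cases "i \<in> {1..m}")
      case True
      then show ?thesis using that C unfolding C_def by blast
    next
      case False
      then show ?thesis using that v Xs subring_0[OF S] by (auto simp: vecs_def)
    qed
  qed
  have orbit: "(\<lambda>n. (T ^^ (a + (r + N * n))) l i) \<in> padic_analytic p S" if "l \<in> set Ls" for l i r
  proof (cases "i \<in> {1..m}")
    case True
    then have "(\<lambda>n. (T ^^ (a + n)) l i) \<in> W" using that by (auto simp: W_def)
    then show ?thesis by (rule an)
  next
    case False
    then have "(T ^^ k) l i = 0" for k
      using funpow_matrix_map_in_vecs[where v = l and m = m and \<sigma> = \<sigma> and n = k] that Ls by (auto simp: vecs_def T_def)
    then show ?thesis using padic_analytic_const[OF S subring_0[OF S]] by simp
  qed
  define A where "A = {n. v \<in> fv.span ((T ^^ n) ` set Ls \<union> set Xs)}"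
  have "eventually_periodic A"
  proof (rule eventually_periodicI[OF N])
    fix r
    define gs where "gs = map (\<lambda>l n. (T ^^ (a + (r + N * n))) l) Ls @ map (\<lambda>x n. x) Xs"
    have gs: "(\<lambda>g. g n) ` set gs = (T ^^ (a + (r + N * n))) ` set Ls \<union> set Xs" for n
      by (auto simp: gs_def)
    have "finite {n. v \<in> fv.span ((\<lambda>g. g n) ` set gs)} \<or> finite {n. v \<notin> fv.span ((\<lambda>g. g n) ` set gs)}"
    proof (rule span_membership_finite_or_cofinite[where \<C> = "padic_analytic p S"])
      show "(\<lambda>n. g n i) \<in> padic_analytic p S" if "g \<in> set gs" for g i
        using that orbit const by (auto simp: gs_def)
    qed (use padic_analytic_diff[OF S] padic_analytic_mult[OF S] padic_analytic_infinitely_many_zeros[OF m]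
          const[of v] in auto)
    then show "finite {n. a + (r + N * n) \<in> A} \<or> finite {n. a + (r + N * n) \<notin> A}"
      by (simp add: gs A_def)
  qed
  then show ?thesis by (simp add: A_def T_def)
qed

section \<open>Languages with finitely many left quotients\<close>

definition left_quotient :: "'a list \<Rightarrow> 'a list set \<Rightarrow> 'a list set" where
  "left_quotient u A = {v. u @ v \<in> A}"

definition finite_quotients :: "'a list set \<Rightarrow> bool" where
  "finite_quotients A \<longleftrightarrow> finite (range (\<lambda>u. left_quotient u A))"

lemma left_quotient_Nil [simp]: "left_quotient [] A = A"
  by (simp add: left_quotient_def)

lemma left_quotient_append: "left_quotient (u @ v) A = left_quotient v (left_quotient u A)"
  by (simp add: left_quotient_def)

text \<open>Myhill-Nerode: the quotients are the states. \<open>h\<close> codes them by naturals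
  because \<open>regular_lang\<close> asks for a set of natural numbers.\<close>

lemma finite_quotients_imp_regular:
  assumes "A \<subseteq> lists \<Sigma>" "finite_quotients A"
  shows "regular_lang \<Sigma> A"
proof -
  define D where "D = range (\<lambda>u. left_quotient u A)"
  have "finite D" using assms(2) by (simp add: finite_quotients_def D_def)
  then obtain h :: "'a list set \<Rightarrow> nat" where h: "inj_on h D"
    using finite_imp_inj_to_nat_seg by blast
  define \<delta> where "\<delta> q g = h (left_quotient [g] (inv_into D h q))" for q g
  define F where "F = h ` {X \<in> D. [] \<in> X}"
  have D: "left_quotient u A \<in> D" for u by (simp add: D_def)
  have \<delta>: "\<delta> (h (left_quotient u A)) g = h (left_quotient (u @ [g]) A)" for u g
    using h D by (simp add: \<delta>_def left_quotient_append)
  have run: "foldl \<delta> (h A) w = h (left_quotient w A)" for w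
    by (induction w rule: rev_induct) (simp_all add: \<delta>)
  have "left_quotient w A \<in> D" and "h (left_quotient w A) \<in> F \<longleftrightarrow> w \<in> A" for w
    using h D[of w] by (auto simp: F_def inj_on_eq_iff left_quotient_def)
  then have "A = {w \<in> lists \<Sigma>. foldl \<delta> (h A) w \<in> F}" using assms(1) by (auto simp: run)
  moreover have "\<delta> q g \<in> h ` D" if "q \<in> h ` D" for q g
    using that D by (auto simp: D_def \<delta>)
  moreover have "h A \<in> h ` D" using D[of "[]"] by simp
  ultimately show ?thesis
    unfolding regular_lang_def using \<open>finite D\<close>
    by (intro exI[of _ "h ` D"] exI[of _ "h A"] exI[of _ \<delta>] exI[of _ F]) (auto simp: F_def)
qed

lemma finite_quotientsI:
  assumes "finite \<F>" "A \<in> \<F>" "\<And>X g. X \<in> \<F> \<Longrightarrow> left_quotient [g] X \<in> \<F>"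
  shows "finite_quotients A"
proof -
  have "left_quotient u A \<in> \<F>" for u
    using assms(2,3) by (induction u rule: rev_induct) (auto simp: left_quotient_append)
  then show ?thesis
    unfolding finite_quotients_def using assms(1) by (meson finite_subset image_subsetI)
qed

lemma finite_quotients_empty: "finite_quotients {}"
  by (rule finite_quotientsI[of "{{}}"]) (auto simp: left_quotient_def)

lemma finite_quotients_Un:
  assumes "finite_quotients A" "finite_quotients B" shows "finite_quotients (A \<union> B)"
proof -
  have "left_quotient u (A \<union> B) = left_quotient u A \<union> left_quotient u B" for u
    by (auto simp: left_quotient_def)
  then have "range (\<lambda>u. left_quotient u (A \<union> B))
      \<subseteq> (\<lambda>(X, Y). X \<union> Y) ` (range (\<lambda>u. left_quotient u A) \<times> range (\<lambda>u. left_quotient u B))"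
    by auto
  then show ?thesis
    using assms unfolding finite_quotients_def by (meson finite_SigmaI finite_imageI finite_subset)
qed

lemma finite_quotients_UN:
  "finite I \<Longrightarrow> (\<And>i. i \<in> I \<Longrightarrow> finite_quotients (A i)) \<Longrightarrow> finite_quotients (\<Union>i\<in>I. A i)"
  by (induction I rule: finite_induct) (auto intro: finite_quotients_empty finite_quotients_Un)

lemma finite_quotients_prepend:
  assumes "finite_quotients A" shows "finite_quotients ((@) p ` A)"
proof (induction p)
  case Nil
  then show ?case using assms by simp
next
  case (Cons x p)
  let ?M = "(@) p ` A"
  have "left_quotient u ((@) (x # p) ` A) \<in> {(@) (x # p) ` A, {}} \<union> range (\<lambda>u. left_quotient u ?M)" for u
  proof (cases u)
    case Nil
    then show ?thesis by simp
  next
    case (Cons y u')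
    have "left_quotient u ((@) (x # p) ` A) = (if y = x then left_quotient u' ?M else {})"
      by (auto simp: Cons left_quotient_def)
    then show ?thesis by auto
  qed
  then have "range (\<lambda>u. left_quotient u ((@) (x # p) ` A))
      \<subseteq> {(@) (x # p) ` A, {}} \<union> range (\<lambda>u. left_quotient u ?M)"
    by blast
  then show ?case
    using Cons.IH unfolding finite_quotients_def by (meson finite.emptyI finite.insertI finite_UnI finite_subset)
qed

lemma eventually_periodic_finite_shifts:
  assumes "eventually_periodic A" shows "finite (range (\<lambda>k. {n. n + k \<in> A}))"
proof -
  obtain a N where N: "N > 0" and per: "\<And>n. n \<ge> a \<Longrightarrow> n \<in> A \<longleftrightarrow> n + N \<in> A"
    using assms unfolding eventually_periodic_def by blast
  have "{n. n + k \<in> A} \<in> (\<lambda>k. {n. n + k \<in> A}) ` {..<a + N}" for k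
  proof (induction k rule: less_induct)
    case (less k)
    show ?case
    proof (cases "k < a + N")
      case True
      then show ?thesis by auto
    next
      case False
      \<comment> \<open>\<open>k - N \<ge> a\<close> puts the argument into the periodic range
        whatever \<open>n\<close> is.\<close>
      then have "n + k \<in> A \<longleftrightarrow> n + (k - N) \<in> A" for n using per[of "n + (k - N)"] by simp
      then show ?thesis using less[of "k - N"] False N by simp
    qed
  qed
  then have "range (\<lambda>k. {n. n + k \<in> A}) \<subseteq> (\<lambda>k. {n. n + k \<in> A}) ` {..<a + N}" by blast
  then show ?thesis by (rule finite_subset) simp
qed

text \<open>Reading \<open>c\<close> shifts the exponent set, of which there are finitely many
  shifts; reading another letter leaves the block for good. \<open>c \<notin> set q\<close> excludes
  that a \<open>c\<close> read from the block belongs to \<open>q\<close>.\<close>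

lemma finite_quotients_replicate:
  assumes "eventually_periodic A" "c \<notin> set q"
  shows "finite_quotients {replicate n c @ q | n. n \<in> A}"
proof -
  define M where "M N = {replicate n c @ q | n. n \<in> N}" for N
  define Sh where "Sh = range (\<lambda>k. {n. n + k \<in> A})"
  define \<F> where "\<F> = M ` Sh \<union> (\<lambda>j. {drop j q}) ` {..length q} \<union> {{}}"
  have "finite \<F>"
    unfolding \<F>_def Sh_def using eventually_periodic_finite_shifts[OF assms(1)] by auto
  moreover have "M A \<in> \<F>"
    unfolding \<F>_def Sh_def using rangeI[of "\<lambda>k. {n. n + k \<in> A}" 0] by auto
  moreover have "left_quotient [g] X \<in> \<F>" if X: "X \<in> \<F>" for X g
  proof -
    consider (rep) k where "X = M {n. n + k \<in> A}" | (suf) j where "j \<le> length q" "X = {drop j q}" | (emp) "X = {}"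
      using X unfolding \<F>_def Sh_def by blast
    then show ?thesis
    proof cases
      case rep
      show ?thesis
      proof (cases "g = c")
        case True
        have "g # v \<in> X \<longleftrightarrow> v \<in> M {n. n + Suc k \<in> A}" for v
        proof
          assume "g # v \<in> X"
          then obtain n where n: "n + k \<in> A" "g # v = replicate n c @ q" by (auto simp: rep M_def)
          have "n \<noteq> 0"
          proof
            assume "n = 0"
            then have "q = g # v" using n by simp
            then show False using assms(2) True by simp
          qed
          then obtain n' where "n = Suc n'" by (cases n) auto
          then show "v \<in> M {n. n + Suc k \<in> A}" using n by (auto simp: M_def)
        next
          assume "v \<in> M {n. n + Suc k \<in> A}"
          then obtain n where "Suc n + k \<in> A" "v = replicate n c @ q" by (auto simp: M_def)
          then show "g # v \<in> X" unfolding rep M_def using True by (intro CollectI exI[of _ "Suc n"]) auto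
        qed
        then have "left_quotient [g] X = M {n. n + Suc k \<in> A}" by (auto simp: left_quotient_def)
        then show ?thesis unfolding \<F>_def Sh_def by blast
      next
        case False
        have "g # v \<in> X \<longleftrightarrow> k \<in> A \<and> g # v = q" for v
          using False by (auto simp: rep M_def Cons_eq_append_conv Cons_replicate_eq intro: exI[of _ 0])
        then have "left_quotient [g] X = (if k \<in> A \<and> q \<noteq> [] \<and> hd q = g then {drop 1 q} else {})"
          by (cases q) (auto simp: left_quotient_def)
        moreover have "{drop 1 q} \<in> (\<lambda>j. {drop j q}) ` {..length q}" if "q \<noteq> []"
          using that by (intro imageI) (cases q, auto)
        ultimately show ?thesis unfolding \<F>_def by auto
      qed
    next
      case suf
      show ?thesis
      proof (cases "drop j q")
        case Nil
        then show ?thesis by (auto simp: suf left_quotient_def \<F>_def)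
      next
        case (Cons x r)
        then have "r = drop (Suc j) q" "Suc j \<le> length q"
          by (metis drop_Suc list.sel(3) tl_drop, metis Suc_leI drop_all leI list.simps(3))
        moreover have "left_quotient [g] X = (if g = x then {r} else {})"
          using Cons by (auto simp: suf left_quotient_def)
        ultimately show ?thesis by (auto simp: \<F>_def)
      qed
    next
      case emp
      then show ?thesis by (simp add: left_quotient_def \<F>_def)
    qed
  qed
  ultimately have "finite_quotients (M A)" by (rule finite_quotientsI)
  then show ?thesis by (simp add: M_def)
qed

section \<open>The ideal of relations\<close>

lemma wrap_append [simp]: "wrap u r v (u @ y @ v) = r y"
  by (auto simp: wrap_def)

lemma wrap_outside: "(\<And>y. w \<noteq> u @ y @ v) \<Longrightarrow> wrap u r v w = 0"
  by (auto simp: wrap_def)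

lemma wrap_mon: "wrap u (mon z) v = (mon (u @ z @ v) :: 'k::field ncpoly)"
proof
  fix w
  show "wrap u (mon z) v w = (mon (u @ z @ v) w :: 'k)"
  proof (cases "\<exists>y. w = u @ y @ v")
    case True
    then obtain y where y: "w = u @ y @ v" by blast
    show ?thesis unfolding y wrap_append by (simp add: mon_def)
  next
    case False
    then show ?thesis by (subst wrap_outside) (auto simp: mon_def)
  qed
qed

lemma wrap_hom: "module_hom fscale fscale (\<lambda>r. wrap u r v)"
  by (rule fscale_module_homI) (auto simp: wrap_def fun_eq_iff fscale_apply)

lemma rel_ideal_generator:
  assumes "r \<in> relations m L R \<sigma>" "u \<in> lists (gens m)" "v \<in> lists (gens m)"
  shows "wrap u r v \<in> rel_ideal m L R \<sigma>"
  using rel_ideal.gen[OF assms, of 1] by simp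

lemma rel_ideal_subspace: "fv.subspace (rel_ideal m L R \<sigma>)"
  unfolding fv.subspace_def
proof (intro conjI ballI allI)
  show "0 \<in> rel_ideal m L R \<sigma>" using rel_ideal.zero by (simp add: zero_fun_def)
  show "p + q \<in> rel_ideal m L R \<sigma>" if "p \<in> rel_ideal m L R \<sigma>" "q \<in> rel_ideal m L R \<sigma>" for p q
    using rel_ideal.add[OF that] by (simp add: plus_fun_def)
  show "fscale c p \<in> rel_ideal m L R \<sigma>" if "p \<in> rel_ideal m L R \<sigma>" for c p
    using that
  proof induction
    case zero
    then show ?case using rel_ideal.zero by (simp add: fscale_def)
  next
    case (add p q)
    then show ?case using rel_ideal.add[OF add.IH] by (simp add: fscale_def distrib_left)
  next
    case (gen r u v d)
    then show ?case using rel_ideal.gen[OF gen, of "c * d"] by (simp add: fscale_def mult.assoc)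
  qed
qed

section \<open>Linear combinations of words differing in one letter\<close>

text \<open>The element p v q of the free algebra with \<open>v\<close> in degree one. The relations
  from \<open>L\<close> and \<open>R\<close> and the subtracted term of the commutation relation
  have this form, so ideal membership becomes linear algebra in \<open>v\<close>.\<close>

definition word_vec :: "nat \<Rightarrow> gen list \<Rightarrow> (nat \<Rightarrow> 'k::field) \<Rightarrow> gen list \<Rightarrow> 'k ncpoly" where
  "word_vec m p v q = (\<Sum>j\<in>{1..m}. fscale (v j) (mon (p @ [Xg j] @ q)))"

lemma word_vec_hom: "module_hom fscale fscale (\<lambda>v. word_vec m p v q)"
proof (rule fscale_module_homI)
  show "word_vec m p (x + y) q = word_vec m p x q + word_vec m p y q" for x y
    by (simp add: word_vec_def fv.scale_left_distrib sum.distrib)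
  show "word_vec m p (fscale c x) q = fscale c (word_vec m p x q)" for c x
    by (simp add: word_vec_def fv.scale_sum_right fscale_apply)
qed

lemma word_vec_unitv:
  assumes "i \<in> {1..m}" shows "word_vec m p (unitv i) q = mon (p @ [Xg i] @ q)"
proof -
  have "word_vec m p (unitv i) q = (\<Sum>j\<in>{1..m}. if j = i then mon (p @ [Xg j] @ q) else 0)"
    unfolding word_vec_def by (intro sum.cong) (auto simp: unitv_def)
  then show ?thesis using assms by simp
qed

lemma word_vec_eq: "word_vec m p v q = (\<lambda>w. \<Sum>j\<in>{1..m}. v j * mon (p @ [Xg j] @ q) w)"
  by (simp add: word_vec_def fun_eq_iff sum_fun_apply fscale_apply)

lemma word_vec_apply:
  assumes "i \<in> {1..m}" shows "word_vec m p v q (p @ [Xg i] @ q) = v i"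
proof -
  have "word_vec m p v q (p @ [Xg i] @ q) = (\<Sum>j\<in>{1..m}. if j = i then v j else 0)"
    unfolding word_vec_eq by (intro sum.cong) (auto simp: mon_def)
  then show ?thesis using assms by simp
qed

lemma word_vec_support:
  assumes "word_vec m p v q w \<noteq> 0"
  obtains j where "j \<in> {1..m}" "w = p @ [Xg j] @ q" "v j \<noteq> 0"
proof -
  obtain j where "j \<in> {1..m}" "v j * mon (p @ [Xg j] @ q) w \<noteq> 0"
    using assms unfolding word_vec_eq by (meson sum.neutral)
  then show ?thesis using that[of j] by (auto simp: mon_def split: if_splits)
qed

lemma wrap_word_vec: "wrap u (word_vec m p w q) v = word_vec m (u @ p) w (q @ v)"
proof -
  interpret module_hom fscale fscale "\<lambda>r. wrap u r v" by (rule wrap_hom)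
  show ?thesis by (simp add: word_vec_def sum scale wrap_mon)
qed

lemma word_vec_A: "word_vec m [Ag] l [] = (\<lambda>u. \<Sum>j\<in>{1..m}. l j * mon [Ag, Xg j] u)"
  and word_vec_B: "word_vec m [] l [Bg] = (\<lambda>u. \<Sum>j\<in>{1..m}. l j * mon [Xg j, Bg] u)"
  by (simp_all add: word_vec_eq)

lemma relation_XC_eq:
  assumes "i \<in> {1..m}"
  shows "(\<lambda>u. mon [Xg i, Cg] u - (\<Sum>j\<in>{1..m}. \<sigma> (unitv i) j * mon [Cg, Xg j] u))
    = mon [Xg i, Cg] - word_vec m [Cg] (matrix_map m \<sigma> (unitv i)) []"
proof -
  interpret h: module_hom fscale fscale "\<lambda>v. word_vec m [Cg] v []" by (rule word_vec_hom)
  have "word_vec m [Cg] (matrix_map m \<sigma> (unitv i)) [] = (\<Sum>j\<in>{1..m}. fscale (\<sigma> (unitv i) j) (mon [Cg, Xg j]))"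
    unfolding matrix_map_unitv[OF assms] by (simp add: h.sum h.scale word_vec_unitv)
  then show ?thesis by (simp add: fun_eq_iff sum_fun_apply fscale_apply)
qed

lemma relations_cases:
  fixes L :: "(nat \<Rightarrow> 'k::field) set"
  assumes "r \<in> relations m L R \<sigma>"
  obtains (XX) i j where "r = mon [Xg i, Xg j]"
    | (A) y where "r = mon [y, Ag]"
    | (B) y where "r = mon [Bg, y]"
    | (L) l where "l \<in> L" "r = word_vec m [Ag] l []"
    | (R) \<rho> where "\<rho> \<in> R" "r = word_vec m [] \<rho> [Bg]"
    | (XC) i where "i \<in> {1..m}" "r = mon [Xg i, Cg] - word_vec m [Cg] (matrix_map m \<sigma> (unitv i)) []"
proof -
  have "(\<exists>i j. r = mon [Xg i, Xg j]) \<or> (\<exists>y. r = mon [y, Ag]) \<or> (\<exists>y. r = mon [Bg, y])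
      \<or> (\<exists>l\<in>L. r = word_vec m [Ag] l []) \<or> (\<exists>\<rho>\<in>R. r = word_vec m [] \<rho> [Bg])
      \<or> (\<exists>i\<in>{1..m}. r = (\<lambda>u. mon [Xg i, Cg] u - (\<Sum>j\<in>{1..m}. \<sigma> (unitv i) j * mon [Cg, Xg j] u)))"
    using assms unfolding relations_def word_vec_A word_vec_B by blast
  then show ?thesis
  proof (elim disjE exE bexE)
    fix i assume "i \<in> {1..m}"
      "r = (\<lambda>u. mon [Xg i, Cg] u - (\<Sum>j\<in>{1..m}. \<sigma> (unitv i) j * mon [Cg, Xg j] u))"
    then show ?thesis by (intro XC) (simp_all only: relation_XC_eq)
  qed (erule XX A B | erule (1) L R)+
qed

lemma relations_XC:
  assumes "i \<in> {1..m}"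
  shows "mon [Xg i, Cg] - word_vec m [Cg] (matrix_map m \<sigma> (unitv i)) [] \<in> relations m L R \<sigma>"
proof -
  have "(\<lambda>u. mon [Xg i, Cg] u - (\<Sum>j\<in>{1..m}. \<sigma> (unitv i) j * mon [Cg, Xg j] u)) \<in> relations m L R \<sigma>"
    unfolding relations_def using assms by blast
  then show ?thesis by (simp only: relation_XC_eq[OF assms])
qed

lemma rel_ideal_XC:
  assumes "i \<in> {1..m}" "p \<in> lists (gens m)" "q \<in> lists (gens m)"
  shows "mon (p @ [Xg i, Cg] @ q) - word_vec m (p @ [Cg]) (matrix_map m \<sigma> (unitv i)) q \<in> rel_ideal m L R \<sigma>"
proof -
  interpret module_hom fscale fscale "\<lambda>r. wrap p r q" by (rule wrap_hom)
  show ?thesis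
    using rel_ideal_generator[OF relations_XC[OF assms(1)] assms(2,3)]
    by (simp add: diff wrap_mon wrap_word_vec)
qed

text \<open>The relation x c = c \<sigma>(x) is imposed on the letters only; both sides being linear
  in \<open>v\<close>, it passes to all vectors.\<close>

lemma word_vec_move_C:
  assumes v: "v \<in> vecs m" and pq: "p \<in> lists (gens m)" "q \<in> lists (gens m)"
  shows "word_vec m p v (Cg # q) - word_vec m (p @ [Cg]) (matrix_map m \<sigma> v) q \<in> rel_ideal m L R \<sigma>"
proof -
  interpret a: module_hom fscale fscale "\<lambda>v. word_vec m p v (Cg # q)" by (rule word_vec_hom)
  interpret b: module_hom fscale fscale "\<lambda>v. word_vec m (p @ [Cg]) v q" by (rule word_vec_hom)
  have "module_hom fscale fscale (\<lambda>v. word_vec m p v (Cg # q) - word_vec m (p @ [Cg]) (matrix_map m \<sigma> v) q)"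
    by (rule fscale_module_homI)
      (simp_all add: a.add b.add a.scale b.scale matrix_map_add matrix_map_scale fv.scale_right_diff_distrib)
  then interpret module_hom fscale fscale
    "\<lambda>v. word_vec m p v (Cg # q) - word_vec m (p @ [Cg]) (matrix_map m \<sigma> v) q" .
  have "word_vec m p (unitv i) (Cg # q) - word_vec m (p @ [Cg]) (matrix_map m \<sigma> (unitv i)) q \<in> rel_ideal m L R \<sigma>"
    if "i \<in> {1..m}" for i
    using rel_ideal_XC[OF that pq] that by (simp add: word_vec_unitv)
  then show ?thesis
    by (subst (1 2) vecs_expansion[OF v], unfold sum scale)
      (intro fv.subspace_sum[OF rel_ideal_subspace] fv.subspace_scale[OF rel_ideal_subspace])
qed

lemma word_vec_move_C_power:
  assumes "v \<in> vecs m" "p \<in> lists (gens m)" "q \<in> lists (gens m)"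
    and "word_vec m p v (replicate n Cg @ q) \<in> rel_ideal m L R \<sigma>"
  shows "word_vec m (p @ replicate n Cg) ((matrix_map m \<sigma> ^^ n) v) q \<in> rel_ideal m L R \<sigma>"
  using assms
proof (induction n arbitrary: p v)
  case 0
  then show ?case by simp
next
  case (Suc n)
  have "replicate n Cg @ q \<in> lists (gens m)" using Suc.prems(3) by (auto simp: gens_def)
  then have "word_vec m p v (Cg # replicate n Cg @ q)
      - word_vec m (p @ [Cg]) (matrix_map m \<sigma> v) (replicate n Cg @ q) \<in> rel_ideal m L R \<sigma>"
    by (rule word_vec_move_C[OF Suc.prems(1,2)])
  from fv.subspace_diff[OF rel_ideal_subspace Suc.prems(4)[simplified] this]
  have "word_vec m (p @ [Cg]) (matrix_map m \<sigma> v) (replicate n Cg @ q) \<in> rel_ideal m L R \<sigma>" by simp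
  then have "word_vec m ((p @ [Cg]) @ replicate n Cg) ((matrix_map m \<sigma> ^^ n) (matrix_map m \<sigma> v)) q
      \<in> rel_ideal m L R \<sigma>"
    using Suc.prems by (intro Suc.IH matrix_map_in_vecs) (auto simp: gens_def)
  then show ?case by (simp add: funpow_swap1)
qed

text \<open>The degree-one vectors killed when placed between \<open>p c^n\<close> and \<open>s\<close>, where \<open>p\<close> is empty
  or \<open>a\<close>, and \<open>s\<close> is empty or \<open>b\<close>.\<close>

definition killed_vecs :: "nat \<Rightarrow> (nat \<Rightarrow> 'k::field) set \<Rightarrow> (nat \<Rightarrow> 'k) set
    \<Rightarrow> ((nat \<Rightarrow> 'k) \<Rightarrow> nat \<Rightarrow> 'k) \<Rightarrow> gen list \<Rightarrow> gen list \<Rightarrow> nat \<Rightarrow> (nat \<Rightarrow> 'k) set" where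
  "killed_vecs m L R \<sigma> p s n = fv.span
     ((if p = [] then {} else (matrix_map m \<sigma> ^^ n) ` L) \<union> (if s = [] then {} else R))"

text \<open>The vectors with this property form a subspace, so generators suffice. For
  \<open>L\<close>, the relation a l is multiplied by c^n s on the right and the letters c are moved
  to the left; for \<open>R\<close>, the relation \<rho> b is multiplied on the left.\<close>

lemma word_vec_killed:
  assumes p: "p \<in> {[], [Ag]}" and s: "s \<in> {[], [Bg]}" and L: "L \<subseteq> vecs m"
    and y: "y \<in> killed_vecs m L R \<sigma> p s n"
  shows "word_vec m (p @ replicate n Cg) y s \<in> rel_ideal m L R \<sigma>"
proof -
  interpret module_hom fscale fscale "\<lambda>v. word_vec m (p @ replicate n Cg) v s" by (rule word_vec_hom)
  let ?I = "rel_ideal m L R \<sigma>"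
  have lists: "p \<in> lists (gens m)" "p @ replicate n Cg \<in> lists (gens m)" "s \<in> lists (gens m)"
      "replicate n Cg @ s \<in> lists (gens m)"
    using p s by (auto simp: gens_def)
  have "word_vec m (p @ replicate n Cg) ((matrix_map m \<sigma> ^^ n) l) s \<in> ?I" if l: "l \<in> L" "p \<noteq> []" for l
  proof -
    have "word_vec m [Ag] l [] \<in> relations m L R \<sigma>"
      unfolding relations_def word_vec_A using l(1) by blast
    from rel_ideal_generator[OF this, of "[]" "replicate n Cg @ s"] lists
    have "word_vec m p l (replicate n Cg @ s) \<in> ?I" using p l by (simp add: wrap_word_vec)
    then show ?thesis using L l by (intro word_vec_move_C_power lists) auto
  qed
  moreover have "word_vec m (p @ replicate n Cg) \<rho> s \<in> ?I" if \<rho>: "\<rho> \<in> R" "s \<noteq> []" for \<rho>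
  proof -
    have "word_vec m [] \<rho> [Bg] \<in> relations m L R \<sigma>"
      unfolding relations_def word_vec_B using \<rho>(1) by blast
    from rel_ideal_generator[OF this, of "p @ replicate n Cg" "[]"] lists
    show ?thesis using s \<rho> by (simp add: wrap_word_vec)
  qed
  ultimately have "(if p = [] then {} else (matrix_map m \<sigma> ^^ n) ` L) \<union> (if s = [] then {} else R)
      \<subseteq> {y. word_vec m (p @ replicate n Cg) y s \<in> ?I}"
    by auto
  moreover have "fv.subspace {y. word_vec m (p @ replicate n Cg) y s \<in> ?I}"
    using rel_ideal_subspace[of m L R \<sigma>] by (auto simp: fv.subspace_def add scale zero)
  ultimately show ?thesis using y fv.span_minimal unfolding killed_vecs_def by blast
qed

section \<open>Coefficient invariants of the ideal\<close>

text \<open>Moving all letters \<open>c\<close> to the left turns the part of \<open>f\<close> supported on the words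
  \<open>p c^k x_j c^(n-k) s\<close> into \<open>p c^n y s\<close>, where \<open>y\<close> is the following vector.\<close>

definition slice :: "nat \<Rightarrow> ((nat \<Rightarrow> 'k::field) \<Rightarrow> nat \<Rightarrow> 'k) \<Rightarrow> gen list \<Rightarrow> gen list \<Rightarrow> nat
    \<Rightarrow> 'k ncpoly \<Rightarrow> nat \<Rightarrow> 'k" where
  "slice m \<sigma> p s n f = (\<Sum>k\<le>n. \<Sum>j\<in>{1..m}.
     fscale (f ((p @ replicate k Cg) @ [Xg j] @ (replicate (n - k) Cg @ s))) ((matrix_map m \<sigma> ^^ (n - k)) (unitv j)))"

lemma slice_hom: "module_hom fscale fscale (slice m \<sigma> p s n)"
proof (rule fscale_module_homI)
  show "slice m \<sigma> p s n (x + y) = slice m \<sigma> p s n x + slice m \<sigma> p s n y" for x y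
    by (simp add: slice_def fv.scale_left_distrib sum.distrib)
  show "slice m \<sigma> p s n (fscale c x) = fscale c (slice m \<sigma> p s n x)" for c x
    by (simp add: slice_def fv.scale_sum_right fscale_apply)
qed

lemma X_position:
  assumes "u' @ [Xg j'] @ v' = u @ [Xg j] @ v" "\<And>i. Xg i \<notin> set u'" "\<And>i. Xg i \<notin> set v'"
  shows "u = u'" "v = v'" "j = j'"
proof -
  have "Xg j \<in> set (u' @ [Xg j'] @ v')" unfolding assms(1) by simp
  then show j: "j = j'" using assms(2,3) by auto
  have "u' = u \<and> v' = v" using assms j by (simp add: append_Cons_eq_iff)
  then show "u = u'" "v = v'" by auto
qed

lemma slice_mon_no_match:
  fixes \<sigma> :: "(nat \<Rightarrow> 'k::field) \<Rightarrow> nat \<Rightarrow> 'k"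
  assumes "\<And>k j. k \<le> n \<Longrightarrow> w \<noteq> (p @ replicate k Cg) @ [Xg j] @ (replicate (n - k) Cg @ s)"
  shows "slice m \<sigma> p s n (mon w) = 0"
  unfolding slice_def
proof (intro sum.neutral ballI)
  fix k j assume "k \<in> {..n}"
  then have "mon w ((p @ replicate k Cg) @ [Xg j] @ (replicate (n - k) Cg @ s)) = (0 :: 'k)"
    using assms[of k j] unfolding mon_def by auto
  then show "fscale (mon w ((p @ replicate k Cg) @ [Xg j] @ (replicate (n - k) Cg @ s)))
      ((matrix_map m \<sigma> ^^ (n - k)) (unitv j)) = 0"
    by (simp only: fv.scale_zero_left)
qed

lemma slice_mon_match:
  assumes p: "p \<in> {[], [Ag]}" and s: "s \<in> {[], [Bg]}" and "k \<le> n" "j \<in> {1..m}"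
  shows "slice m \<sigma> p s n (mon ((p @ replicate k Cg) @ [Xg j] @ (replicate (n - k) Cg @ s)))
    = (matrix_map m \<sigma> ^^ (n - k)) (unitv j)"
proof -
  let ?w = "\<lambda>k j. (p @ replicate k Cg) @ [Xg j] @ (replicate (n - k) Cg @ s)"
  have eq: "?w k' j' = ?w k j \<longleftrightarrow> k' = k \<and> j' = j" for k' j'
  proof
    assume "?w k' j' = ?w k j"
    from X_position(1,3)[OF this] p s have "p @ replicate k Cg = p @ replicate k' Cg" "j = j'" by auto
    then show "k' = k \<and> j' = j" by simp
  qed simp
  have "slice m \<sigma> p s n (mon (?w k j)) = (\<Sum>k'\<le>n. \<Sum>j'\<in>{1..m}.
      if k' = k \<and> j' = j then (matrix_map m \<sigma> ^^ (n - k')) (unitv j') else 0)"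
    unfolding slice_def mon_def eq by (intro sum.cong refl) simp
  also have "\<dots> = (\<Sum>k'\<le>n. if k' = k then (matrix_map m \<sigma> ^^ (n - k')) (unitv j) else 0)"
    using assms(4) by (intro sum.cong refl) simp
  also have "\<dots> = (matrix_map m \<sigma> ^^ (n - k)) (unitv j)" using assms(3) by simp
  finally show ?thesis .
qed

lemma slice_word_vec_no_match:
  assumes p: "p \<in> {[], [Ag]}" and s: "s \<in> {[], [Bg]}"
    and no: "\<And>k. k \<le> n \<Longrightarrow> u = p @ replicate k Cg \<Longrightarrow> v = replicate (n - k) Cg @ s \<Longrightarrow> False"
  shows "slice m \<sigma> p s n (word_vec m u y v) = 0"
proof -
  interpret module_hom fscale fscale "slice m \<sigma> p s n" by (rule slice_hom)
  have "slice m \<sigma> p s n (mon (u @ [Xg j] @ v)) = 0" for j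
  proof (rule slice_mon_no_match, rule notI)
    fix k j' assume k: "k \<le> n" and eq: "u @ [Xg j] @ v = (p @ replicate k Cg) @ [Xg j'] @ (replicate (n - k) Cg @ s)"
    from X_position(1,2)[OF eq[symmetric]] p s show False using no[OF k] by auto
  qed
  then show ?thesis by (simp add: word_vec_def sum scale)
qed

lemma slice_word_vec_match:
  assumes p: "p \<in> {[], [Ag]}" and s: "s \<in> {[], [Bg]}" and k: "k \<le> n" and y: "y \<in> vecs m"
    and u: "u = p @ replicate k Cg" and v: "v = replicate (n - k) Cg @ s"
  shows "slice m \<sigma> p s n (word_vec m u y v) = (matrix_map m \<sigma> ^^ (n - k)) y"
proof -
  interpret module_hom fscale fscale "slice m \<sigma> p s n" by (rule slice_hom)
  interpret h: module_hom fscale fscale "matrix_map m \<sigma> ^^ (n - k)" by (rule funpow_matrix_map_hom)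
  have "slice m \<sigma> p s n (word_vec m u y v) = (\<Sum>j\<in>{1..m}. fscale (y j) ((matrix_map m \<sigma> ^^ (n - k)) (unitv j)))"
    unfolding word_vec_def u v sum scale by (intro sum.cong refl) (simp only: slice_mon_match[OF p s k])
  also have "\<dots> = (matrix_map m \<sigma> ^^ (n - k)) y"
    by (subst (2) vecs_expansion[OF y]) (simp only: h.sum h.scale)
  finally show ?thesis .
qed

text \<open>In \<open>p @ M @ s\<close> the letter \<open>Ag\<close> occurs only in front and
  \<open>Bg\<close> only at the end.\<close>

lemma no_bad_pair:
  assumes p: "p \<in> {[], [Ag]}" and s: "s \<in> {[], [Bg]}" and M: "Ag \<notin> set M" "Bg \<notin> set M"
  shows "p @ M @ s \<noteq> u @ [y, Ag] @ v" "p @ M @ s \<noteq> u @ [Bg, y] @ v"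
proof -
  have "Ag \<notin> set (tl (p @ M @ s))" using p s M by (cases M) auto
  moreover have "Ag \<in> set (tl (u @ [y, Ag] @ v))" by (cases u) auto
  ultimately show "p @ M @ s \<noteq> u @ [y, Ag] @ v" by metis
  have "Bg \<notin> set (butlast (p @ M @ s))"
    using p s M by (auto simp: butlast_append dest: in_set_butlastD)
  moreover have "Bg \<in> set (butlast (u @ [Bg, y] @ v))" by (simp add: butlast_append)
  ultimately show "p @ M @ s \<noteq> u @ [Bg, y] @ v" by metis
qed

text \<open>The monomial relations involve no word of the slice, and the two terms of a commutation
  relation contribute the same vector and cancel. What remains is \<sigma>^n(l) from a l and \<rho>
  from \<rho> b, the vectors that span \<open>killed_vecs\<close>.\<close>

lemma slice_wrap_relation:
  assumes p: "p \<in> {[], [Ag]}" and s: "s \<in> {[], [Bg]}" and L: "L \<subseteq> vecs m" and R: "R \<subseteq> vecs m"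
    and r: "r \<in> relations m L R \<sigma>"
  shows "slice m \<sigma> p s n (wrap u r v) \<in> killed_vecs m L R \<sigma> p s n"
proof -
  interpret module_hom fscale fscale "slice m \<sigma> p s n" by (rule slice_hom)
  interpret w: module_hom fscale fscale "\<lambda>r. wrap u r v" by (rule wrap_hom)
  let ?T = "matrix_map m \<sigma>"
  have zero: "slice m \<sigma> p s n (wrap u r v) = 0 \<Longrightarrow> ?thesis"
    by (simp add: killed_vecs_def fv.span_zero)
  have M: "Ag \<notin> set (replicate k Cg @ [Xg j] @ replicate l Cg)"
      "Bg \<notin> set (replicate k Cg @ [Xg j] @ replicate l Cg)" for k j l
    by auto
  from r show ?thesis
  proof (cases rule: relations_cases)
    case (XX i j)
    have "slice m \<sigma> p s n (mon (u @ [Xg i] @ (Xg j # v))) = 0"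
    proof (rule slice_mon_no_match, rule notI)
      fix k j' assume "u @ [Xg i] @ (Xg j # v) = (p @ replicate k Cg) @ [Xg j'] @ (replicate (n - k) Cg @ s)"
      from X_position(2)[OF this[symmetric]] p s have "Xg j # v = replicate (n - k) Cg @ s" by auto
      then have "Xg j \<in> set (replicate (n - k) Cg @ s)" by (metis list.set_intros(1))
      then show False using s by auto
    qed
    then show ?thesis by (intro zero) (simp add: XX wrap_mon)
  next
    case (A y)
    have "slice m \<sigma> p s n (mon (u @ [y, Ag] @ v)) = 0"
      using no_bad_pair(1)[OF p s M] by (intro slice_mon_no_match) (metis append_assoc)
    then show ?thesis by (intro zero) (simp add: A wrap_mon)
  next
    case (B y)
    have "slice m \<sigma> p s n (mon (u @ [Bg, y] @ v)) = 0"
      using no_bad_pair(2)[OF p s M] by (intro slice_mon_no_match) (metis append_assoc)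
    then show ?thesis by (intro zero) (simp add: B wrap_mon)
  next
    case (L l)
    show ?thesis
    proof (cases "\<exists>k\<le>n. u @ [Ag] = p @ replicate k Cg \<and> v = replicate (n - k) Cg @ s")
      case True
      then obtain k where k: "k \<le> n" "u @ [Ag] = p @ replicate k Cg" "v = replicate (n - k) Cg @ s" by blast
      \<comment> \<open>The prefix ends in \<open>Ag\<close>, so no \<open>c\<close> lies between
        \<open>a\<close> and the vector.\<close>
      have "k = 0"
      proof (rule ccontr)
        assume "k \<noteq> 0"
        then have "last (p @ replicate k Cg) = Cg" by simp
        then show False using k(2) by (metis gen.distinct last_snoc)
      qed
      then have "p \<noteq> []" using k(2) by auto
      moreover have "slice m \<sigma> p s n (word_vec m (u @ [Ag]) l v) = (?T ^^ n) l"
        using slice_word_vec_match[OF p s k(1) _ k(2,3), where y = l and \<sigma> = \<sigma>] L assms(3) \<open>k = 0\<close> by auto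
      ultimately show ?thesis
        using L by (auto simp: wrap_word_vec killed_vecs_def intro!: fv.span_base)
    next
      case False
      then show ?thesis
        using slice_word_vec_no_match[OF p s, of n "u @ [Ag]" v] by (intro zero) (auto simp: L wrap_word_vec)
    qed
  next
    case (R \<rho>)
    show ?thesis
    proof (cases "\<exists>k\<le>n. u = p @ replicate k Cg \<and> Bg # v = replicate (n - k) Cg @ s")
      case True
      then obtain k where k: "k \<le> n" "u = p @ replicate k Cg" "Bg # v = replicate (n - k) Cg @ s" by blast
      have "n - k = 0"
        using k(3) by (cases "n - k") auto
      then have "s \<noteq> []" using k(3) by auto
      moreover have "slice m \<sigma> p s n (word_vec m u \<rho> (Bg # v)) = \<rho>"
        using slice_word_vec_match[OF p s k(1) _ k(2,3), where y = \<rho> and \<sigma> = \<sigma>] R assms(4) \<open>n - k = 0\<close> by auto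
      ultimately show ?thesis
        using R by (auto simp: wrap_word_vec killed_vecs_def intro!: fv.span_base)
    next
      case False
      then show ?thesis
        using slice_word_vec_no_match[OF p s, of n u "Bg # v"] by (intro zero) (auto simp: R wrap_word_vec)
    qed
  next
    case (XC i)
    have split: "slice m \<sigma> p s n (wrap u r v) = slice m \<sigma> p s n (word_vec m u (unitv i) (Cg # v))
        - slice m \<sigma> p s n (word_vec m (u @ [Cg]) (?T (unitv i)) v)"
      using XC(1) by (simp add: XC(2) w.diff diff wrap_mon wrap_word_vec word_vec_unitv)
    show ?thesis
    proof (cases "\<exists>k\<le>n. u = p @ replicate k Cg \<and> Cg # v = replicate (n - k) Cg @ s")
      case True
      then obtain k where k: "k \<le> n" "u = p @ replicate k Cg" "Cg # v = replicate (n - k) Cg @ s" by blast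
      \<comment> \<open>In the first word one more \<open>c\<close> stands to the right, costing one
        more application of \<open>?T\<close>; in the second word that application is already part
        of the vector.\<close>
      obtain l where l: "n - k = Suc l" using k(3) s by (cases "n - k") auto
      have k': "Suc k \<le> n" "n - Suc k = l" using l by auto
      have "u @ [Cg] = p @ replicate (Suc k) Cg" using k(2) by (simp add: replicate_append_same)
      moreover have "v = replicate (n - Suc k) Cg @ s" using k(3) l k'(2) by simp
      ultimately have "slice m \<sigma> p s n (word_vec m (u @ [Cg]) (?T (unitv i)) v) = (?T ^^ l) (?T (unitv i))"
        using slice_word_vec_match[OF p s k'(1) matrix_map_in_vecs] k'(2) by metis
      moreover have "slice m \<sigma> p s n (word_vec m u (unitv i) (Cg # v)) = (?T ^^ Suc l) (unitv i)"
        using slice_word_vec_match[OF p s k(1) unitv_in_vecs[OF XC(1)] k(2,3)] l by simp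
      ultimately show ?thesis by (intro zero) (simp add: split funpow_swap1)
    next
      case False
      have "slice m \<sigma> p s n (word_vec m u (unitv i) (Cg # v)) = 0"
        using False by (intro slice_word_vec_no_match[OF p s]) auto
      moreover have "slice m \<sigma> p s n (word_vec m (u @ [Cg]) (?T (unitv i)) v) = 0"
      proof (rule slice_word_vec_no_match[OF p s])
        \<comment> \<open>A match of the second word would give one of the first, with the last
          \<open>c\<close> of the prefix moved across the vector.\<close>
        fix k assume k: "k \<le> n" "u @ [Cg] = p @ replicate k Cg" "v = replicate (n - k) Cg @ s"
        obtain k' where k': "k = Suc k'" using k(2) p by (cases k) auto
        then have "u @ [Cg] = (p @ replicate k' Cg) @ [Cg]" using k(2) by (simp add: replicate_append_same)
        then have "u = p @ replicate k' Cg" by simp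
        moreover have "n - k' = Suc (n - k)" using k' k(1) by simp
        then have "Cg # v = replicate (n - k') Cg @ s" using k(3) by simp
        moreover have "k' \<le> n" using k' k(1) by simp
        ultimately show False using False by blast
      qed
      ultimately show ?thesis by (intro zero) (simp add: split)
    qed
  qed
qed

lemma slice_rel_ideal:
  assumes p: "p \<in> {[], [Ag]}" and s: "s \<in> {[], [Bg]}" and L: "L \<subseteq> vecs m" and R: "R \<subseteq> vecs m"
    and f: "f \<in> rel_ideal m L R \<sigma>"
  shows "slice m \<sigma> p s n f \<in> killed_vecs m L R \<sigma> p s n"
proof -
  interpret h: module_hom fscale fscale "slice m \<sigma> p s n" by (rule slice_hom)
  have K: "fv.subspace (killed_vecs m L R \<sigma> p s n)" unfolding killed_vecs_def by (rule fv.subspace_span)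
  from f show ?thesis
  proof induction
    case zero
    show ?case using fv.subspace_0[OF K] by (simp only: zero_fun_def[symmetric] h.zero)
  next
    case (add f g)
    have "slice m \<sigma> p s n (f + g) \<in> killed_vecs m L R \<sigma> p s n"
      using fv.subspace_add[OF K add.IH] by (simp only: h.add)
    then show ?case by (simp only: plus_fun_def)
  next
    case (gen r u v c)
    have "slice m \<sigma> p s n (fscale c (wrap u r v)) \<in> killed_vecs m L R \<sigma> p s n"
      unfolding h.scale by (intro fv.subspace_scale[OF K] slice_wrap_relation[OF p s L R gen(1)])
    then show ?case by (simp only: fscale_def)
  qed
qed

text \<open>Every word in a relation contains some x, or \<open>a\<close> after another letter, or
  \<open>b\<close> before one. So this coefficient vanishes on the whole ideal, and words without x
  of this shape are always normal.\<close>

lemma rel_ideal_X_free: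
  assumes p: "p \<in> {[], [Ag]}" and s: "s \<in> {[], [Bg]}" and f: "f \<in> rel_ideal m L R \<sigma>"
  shows "f (p @ replicate n Cg @ s) = 0"
  using f
proof induction
  case (gen r u v c)
  let ?w = "p @ replicate n Cg @ s"
  have X: "Xg j \<notin> set ?w" for j using p s by auto
  have M: "Ag \<notin> set (replicate n Cg)" "Bg \<notin> set (replicate n Cg)" by auto
  have mon: "mon z ?w = 0" if "?w \<noteq> z" for z using that by (simp add: mon_def)
  have wv: "word_vec m u' y v' ?w = 0" for u' y v'
  proof (rule ccontr)
    assume "word_vec m u' y v' ?w \<noteq> 0"
    then obtain j where "?w = u' @ [Xg j] @ v'" by (rule word_vec_support)
    then have "Xg j \<in> set ?w" by simp
    then show False using X by blast
  qed
  interpret module_hom fscale fscale "\<lambda>r. wrap u r v" by (rule wrap_hom)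
  from gen(1) have "wrap u r v ?w = 0"
  proof (cases rule: relations_cases)
    case (XX i j)
    have "?w \<noteq> u @ [Xg i, Xg j] @ v" using X[of i] by (metis in_set_conv_decomp append_Cons)
    from mon[OF this] show ?thesis by (simp only: XX wrap_mon)
  next
    case (A y)
    from mon[OF no_bad_pair(1)[OF p s M]] show ?thesis unfolding A wrap_mon .
  next
    case (B y)
    from mon[OF no_bad_pair(2)[OF p s M]] show ?thesis unfolding B wrap_mon .
  next
    case (L l)
    then show ?thesis by (simp only: wrap_word_vec wv)
  next
    case (R \<rho>)
    then show ?thesis by (simp only: wrap_word_vec wv)
  next
    case (XC i)
    have "?w \<noteq> u @ [Xg i, Cg] @ v" using X[of i] by (metis in_set_conv_decomp append_Cons)
    then have "mon (u @ [Xg i, Cg] @ v) ?w = 0" by (rule mon)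
    then show ?thesis by (simp add: XC diff wrap_mon wrap_word_vec wv)
  qed
  then show ?case by simp
qed simp_all

section \<open>Normal words\<close>

lemma deglex_less_at:
  assumes "rank m x < rank m y" "length Q = length Q'"
  shows "deglex_less m (P @ x # Q) (P @ y # Q')"
  using assms by (simp add: deglex_less_def lexord_same_pref_iff)

lemma deglex_less_atD:
  assumes "deglex_less m (P @ x # Q) (P @ y # Q')" "length Q = length Q'"
  shows "rank m x \<le> rank m y"
  using assms by (auto simp: deglex_less_def lexord_same_pref_iff)

lemma not_normalI:
  "f \<in> rel_ideal m L R \<sigma> \<Longrightarrow> is_leading_word m f w \<Longrightarrow> w \<notin> normal_words m L R \<sigma>"
  by (auto simp: normal_words_def)

text \<open>The last four cases contain one of the leading words x x, y a, b y, x c. Avoiding these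
  leaves \<open>a\<close> only in front, \<open>b\<close> only at the end, at most one x, and no
  \<open>c\<close> after it.\<close>

lemma word_shape:
  assumes "w \<in> lists (gens m)"
  obtains (X_free) p n s where "p \<in> {[], [Ag]}" "s \<in> {[], [Bg]}" "w = p @ replicate n Cg @ s"
    | (one_X) p n i s where "p \<in> {[], [Ag]}" "s \<in> {[], [Bg]}" "i \<in> {1..m}"
        "w = p @ replicate n Cg @ [Xg i] @ s"
    | (XX) u i j v where "i \<in> {1..m}" "j \<in> {1..m}" "w = u @ [Xg i, Xg j] @ v"
    | (A) u y v where "w = u @ [y, Ag] @ v"
    | (B) u y v where "w = u @ [Bg, y] @ v"
    | (XC) u i v where "i \<in> {1..m}" "w = u @ [Xg i, Cg] @ v"
proof -
  define bad where "bad w \<longleftrightarrow> (\<exists>u i j v. i \<in> {1..m} \<and> j \<in> {1..m} \<and> w = u @ [Xg i, Xg j] @ v)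
    \<or> (\<exists>u y v. w = u @ [y, Ag] @ v) \<or> (\<exists>u y v. w = u @ [Bg, y] @ v)
    \<or> (\<exists>u i v. i \<in> {1..m} \<and> w = u @ [Xg i, Cg] @ v)" for w
  have bad_Cons: "bad (g # w)" if "bad w" for g w
    using that unfolding bad_def by (metis append_Cons)
  define nice where "nice w \<longleftrightarrow> (\<exists>p\<in>{[], [Ag]}. \<exists>s\<in>{[], [Bg]}. \<exists>n.
    w = p @ replicate n Cg @ s \<or> (\<exists>i\<in>{1..m}. w = p @ replicate n Cg @ [Xg i] @ s))" for w
  have "bad w \<or> nice w"
    using assms
  proof (induction w)
    case Nil
    have "nice []" unfolding nice_def by (intro bexI[of _ "[]"] exI[of _ 0]) auto
    then show ?case by simp
  next
    case (Cons g w)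
    show ?case
    proof (cases "bad w")
      case True
      then show ?thesis by (simp add: bad_Cons)
    next
      case False
      then have "nice w" using Cons by auto
      \<comment> \<open>\<open>q\<close> merges the two good shapes: it is empty or a single
        x.\<close>
      then obtain p s n q where ps: "p \<in> {[], [Ag]}" "s \<in> {[], [Bg]}"
        and w: "w = p @ replicate n Cg @ q @ s" and q: "q = [] \<or> (\<exists>i\<in>{1..m}. q = [Xg i])"
        unfolding nice_def by (metis append_Nil)
      have niceI: "nice (p' @ replicate n' Cg @ q' @ s')"
        if "p' \<in> {[], [Ag]}" "s' \<in> {[], [Bg]}" "q' = [] \<or> (\<exists>i\<in>{1..m}. q' = [Xg i])" for p' n' q' s'
        using that unfolding nice_def by (metis append_Nil)
      show ?thesis
      \<comment> \<open>If the word starts with \<open>a\<close>, any letter put in front of it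
        creates a forbidden pair.\<close>
      proof (cases "p = []")
        case False
        then have "g # w = [] @ [g, Ag] @ (replicate n Cg @ q @ s)" using ps w by auto
        then show ?thesis unfolding bad_def by blast
      next
        case True
        then have w: "w = replicate n Cg @ q @ s" using w by simp
        have "g \<in> gens m" using Cons by auto
        then consider (x) i where "i \<in> {1..m}" "g = Xg i" | "g = Ag" | "g = Bg" | "g = Cg"
          unfolding gens_def by auto
        then show ?thesis
        proof cases
          case x
          show ?thesis
          proof (cases n)
            case 0
            show ?thesis
            proof (cases "q = []")
              case True
              then have "g # w = [] @ replicate 0 Cg @ [Xg i] @ s" using w 0 x by simp
              then show ?thesis using niceI[of "[]" s "[Xg i]" 0] ps x by auto
            next
              case False
              then obtain j where "j \<in> {1..m}" "q = [Xg j]" using q by auto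
              then have "g # w = [] @ [Xg i, Xg j] @ s" using w 0 x by simp
              then show ?thesis using x(1) \<open>j \<in> {1..m}\<close> unfolding bad_def by blast
            qed
          next
            case (Suc n')
            then have "g # w = [] @ [Xg i, Cg] @ (replicate n' Cg @ q @ s)" using w x by simp
            then show ?thesis using x(1) unfolding bad_def by blast
          qed
        next
          case 2
          then have "g # w = [Ag] @ replicate n Cg @ q @ s" using w by simp
          then show ?thesis using niceI[of "[Ag]" s q n] ps q by auto
        next
          case 3
          show ?thesis
          proof (cases w)
            case Nil
            then have "g # w = [] @ replicate 0 Cg @ [] @ [Bg]" using 3 by simp
            then show ?thesis using niceI[of "[]" "[Bg]" "[]" 0] by auto
          next
            case (Cons y w')
            then have "g # w = [] @ [Bg, y] @ w'" using 3 by simp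
            then show ?thesis unfolding bad_def by blast
          qed
        next
          case 4
          then have "g # w = [] @ replicate (Suc n) Cg @ q @ s" using w by simp
          then show ?thesis using niceI[of "[]" s q "Suc n"] ps q by auto
        qed
      qed
    qed
  qed
  then show ?thesis
  proof
    assume "bad w"
    then show ?thesis unfolding bad_def using that(3-6) by blast
  next
    assume "nice w"
    then obtain p s n where ps: "p \<in> {[], [Ag]}" "s \<in> {[], [Bg]}"
      and w: "w = p @ replicate n Cg @ s \<or> (\<exists>i\<in>{1..m}. w = p @ replicate n Cg @ [Xg i] @ s)"
      unfolding nice_def by (elim bexE exE) (rule that)
    from w show ?thesis
    proof
      assume "w = p @ replicate n Cg @ s"
      with ps show ?thesis by (rule X_free)
    next
      assume "\<exists>i\<in>{1..m}. w = p @ replicate n Cg @ [Xg i] @ s"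
      then show ?thesis using one_X[OF ps] by blast
    qed
  qed
qed

lemma monomial_relation_not_normal:
  assumes "mon z \<in> (relations m L R \<sigma> :: 'k::field ncpoly set)" "u @ z @ v \<in> lists (gens m)"
  shows "u @ z @ v \<notin> normal_words m L R \<sigma>"
proof (rule not_normalI)
  show "mon (u @ z @ v) \<in> rel_ideal m L R \<sigma>"
    using rel_ideal_generator[OF assms(1), of u v] assms(2) by (simp add: wrap_mon)
  show "is_leading_word m (mon (u @ z @ v) :: 'k ncpoly) (u @ z @ v)"
    by (auto simp: is_leading_word_def mon_def)
qed

text \<open>Every x outranks \<open>c\<close>, so the order makes x c, and not a word beginning with
  c, the leading word of the commutation relation.\<close>

lemma XC_not_normal:
  fixes L :: "(nat \<Rightarrow> 'k::field) set"
  assumes "i \<in> {1..m}" "u @ [Xg i, Cg] @ v \<in> lists (gens m)"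
  shows "u @ [Xg i, Cg] @ v \<notin> normal_words m L R \<sigma>"
proof (rule not_normalI)
  let ?w = "u @ [Xg i, Cg] @ v"
  define y where "y = matrix_map m \<sigma> (unitv i)"
  show "mon ?w - word_vec m (u @ [Cg]) y v \<in> rel_ideal m L R \<sigma>"
    unfolding y_def using assms by (intro rel_ideal_XC) auto
  have less: "deglex_less m x ?w \<and> x \<noteq> ?w" if x: "word_vec m (u @ [Cg]) y v x \<noteq> 0" for x
  proof -
    obtain j where "x = (u @ [Cg]) @ [Xg j] @ v" using x by (rule word_vec_support)
    then show ?thesis by (auto simp: rank_def intro!: deglex_less_at)
  qed
  show "is_leading_word m (mon ?w - word_vec m (u @ [Cg]) y v) ?w"
    unfolding is_leading_word_def
  proof (intro conjI allI impI)
    have "word_vec m (u @ [Cg]) y v ?w = 0" using less by blast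
    then show "(mon ?w - word_vec m (u @ [Cg]) y v) ?w \<noteq> 0" by (simp add: mon_def)
    fix x assume "(mon ?w - word_vec m (u @ [Cg]) y v) x \<noteq> 0"
    then have "mon ?w x \<noteq> (0 :: 'k) \<or> word_vec m (u @ [Cg]) y v x \<noteq> 0" by auto
    then show "x = ?w \<or> deglex_less m x ?w"
    proof
      assume "mon ?w x \<noteq> (0 :: 'k)"
      then show ?thesis by (simp add: mon_def split: if_splits)
    next
      assume "word_vec m (u @ [Cg]) y v x \<noteq> 0"
      then show ?thesis using less by blast
    qed
  qed
qed

text \<open>Amounts to a killed vector with leading letter x_i: the letters smaller than x_i are
  those of larger index.\<close>

definition killed_letter :: "nat \<Rightarrow> (nat \<Rightarrow> 'k::field) set \<Rightarrow> (nat \<Rightarrow> 'k) set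
    \<Rightarrow> ((nat \<Rightarrow> 'k) \<Rightarrow> nat \<Rightarrow> 'k) \<Rightarrow> gen list \<Rightarrow> gen list \<Rightarrow> nat \<Rightarrow> nat \<Rightarrow> bool" where
  "killed_letter m L R \<sigma> p s i n \<longleftrightarrow>
     unitv i \<in> fv.span (killed_vecs m L R \<sigma> p s n \<union> unitv ` {i<..m})"

lemma span_unitv_coordinate:
  assumes "z \<in> fv.span (unitv ` {i<..m})" "k \<le> i" shows "z k = 0"
proof -
  have "fv.subspace {z. z k = 0}" by (auto simp: fv.subspace_def fscale_apply)
  moreover have "unitv ` {i<..m} \<subseteq> {z. z k = 0}" using assms(2) by (auto simp: unitv_def)
  ultimately show ?thesis using fv.span_minimal assms(1) by blast
qed

text \<open>When \<open>unitv i\<close> is split as y + z, the killed vector y has coordinate 1 at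
  \<open>i\<close> and 0 before it, so the element of the ideal that it defines has the required
  leading word.\<close>

lemma killed_letter_not_normal:
  assumes p: "p \<in> {[], [Ag]}" and s: "s \<in> {[], [Bg]}" and L: "L \<subseteq> vecs m"
    and i: "i \<in> {1..m}" and killed: "killed_letter m L R \<sigma> p s i n"
  shows "p @ replicate n Cg @ [Xg i] @ s \<notin> normal_words m L R \<sigma>"
proof -
  let ?P = "p @ replicate n Cg"
  have span: "fv.span (killed_vecs m L R \<sigma> p s n) = killed_vecs m L R \<sigma> p s n"
    unfolding killed_vecs_def by (rule fv.span_span)
  obtain y z where yz: "unitv i = y + z" and y: "y \<in> killed_vecs m L R \<sigma> p s n"
    and z: "z \<in> fv.span (unitv ` {i<..m})"
    using killed unfolding killed_letter_def fv.span_Un span by blast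
  have coord: "y k = unitv i k" if "k \<le> i" for k
    using fun_cong[OF yz, of k] span_unitv_coordinate[OF z that] by simp
  have mem: "word_vec m ?P y s \<in> rel_ideal m L R \<sigma>" by (rule word_vec_killed[OF p s L y])
  have "is_leading_word m (word_vec m ?P y s) (p @ replicate n Cg @ [Xg i] @ s)"
    unfolding is_leading_word_def
  proof (intro conjI allI impI)
    show "word_vec m ?P y s (p @ replicate n Cg @ [Xg i] @ s) \<noteq> 0"
      using word_vec_apply[OF i, of ?P y s] coord[of i] by (simp add: unitv_def)
    fix x assume "word_vec m ?P y s x \<noteq> 0"
    then obtain j where j: "j \<in> {1..m}" "x = ?P @ [Xg j] @ s" "y j \<noteq> 0" by (rule word_vec_support)
    have "j \<ge> i" using coord[of j] j(3) by (cases "j < i") (auto simp: unitv_def)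
    then show "x = p @ replicate n Cg @ [Xg i] @ s \<or> deglex_less m x (p @ replicate n Cg @ [Xg i] @ s)"
      using deglex_less_at[of m "Xg j" "Xg i" s s ?P] j i by (cases "j = i") (auto simp: rank_def)
  qed
  with mem show ?thesis by (rule not_normalI)
qed

text \<open>The converse, through \<open>slice\<close>. Since x > c, a word of the slice with its x
  further left exceeds the leading word, and so does one with a smaller index; both have coefficient
  0. The slice is thus a nonzero multiple of \<open>unitv i\<close> plus later unit vectors, and it
  is a killed vector.\<close>

lemma leading_letter_killed:
  assumes p: "p \<in> {[], [Ag]}" and s: "s \<in> {[], [Bg]}" and L: "L \<subseteq> vecs m" and R: "R \<subseteq> vecs m"
    and i: "i \<in> {1..m}" and f: "f \<in> rel_ideal m L R \<sigma>"
    and lead: "is_leading_word m f (p @ replicate n Cg @ [Xg i] @ s)"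
  shows "killed_letter m L R \<sigma> p s i n"
proof -
  let ?w = "\<lambda>k j. (p @ replicate k Cg) @ [Xg j] @ (replicate (n - k) Cg @ s)"
  let ?S = "fv.span (killed_vecs m L R \<sigma> p s n \<union> unitv ` {i<..m})"
  have lead': "f (?w n i) \<noteq> 0" "\<And>u. f u \<noteq> 0 \<Longrightarrow> u = ?w n i \<or> deglex_less m u (?w n i)"
    using lead unfolding is_leading_word_def by simp_all
  have far: "f (?w k j) = 0" if "k < n" for k j
  proof (rule ccontr)
    assume nz: "f (?w k j) \<noteq> 0"
    obtain l where l: "n = k + Suc l" using \<open>k < n\<close> less_iff_Suc_add by auto
    \<comment> \<open>The two words first differ after p c^k, where x_j meets
      \<open>c\<close>.\<close>
    have w1: "?w k j = (p @ replicate k Cg) @ Xg j # (replicate (Suc l) Cg @ s)" by (simp add: l)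
    have w2: "?w n i = (p @ replicate k Cg) @ Cg # (replicate l Cg @ [Xg i] @ s)"
      by (simp add: l replicate_add replicate_append_same)
    have "deglex_less m (?w k j) (?w n i)" using lead'(2)[OF nz] unfolding w1 w2 by auto
    then have "rank m (Xg j) \<le> rank m Cg" unfolding w1 w2 by (rule deglex_less_atD) simp
    then show False by (simp add: rank_def)
  qed
  have near: "f (?w n j) = 0" if "j < i" for j
  proof (rule ccontr)
    assume nz: "f (?w n j) \<noteq> 0"
    have "deglex_less m ((p @ replicate n Cg) @ Xg j # s) ((p @ replicate n Cg) @ Xg i # s)"
      using lead'(2)[OF nz] that by auto
    then have "rank m (Xg j) \<le> rank m (Xg i)" by (rule deglex_less_atD) simp
    then show False using that i by (simp add: rank_def)
  qed
  have "slice m \<sigma> p s n f = (\<Sum>k\<in>{n}. \<Sum>j\<in>{1..m}. fscale (f (?w k j)) ((matrix_map m \<sigma> ^^ (n - k)) (unitv j)))"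
    unfolding slice_def
  proof (rule sum.mono_neutral_right)
    show "\<forall>k\<in>{..n} - {n}. (\<Sum>j\<in>{1..m}. fscale (f (?w k j)) ((matrix_map m \<sigma> ^^ (n - k)) (unitv j))) = 0"
      using far by (intro ballI sum.neutral) (simp add: fv.scale_zero_left del: append_assoc append.simps)
  qed auto
  also have "\<dots> = (\<Sum>j\<in>{1..m}. fscale (f (?w n j)) (unitv j))" by simp
  also have "\<dots> = fscale (f (?w n i)) (unitv i) + (\<Sum>j\<in>{1..m} - {i}. fscale (f (?w n j)) (unitv j))"
    using i by (intro sum.remove) auto
  finally have "fscale (f (?w n i)) (unitv i)
      = slice m \<sigma> p s n f - (\<Sum>j\<in>{1..m} - {i}. fscale (f (?w n j)) (unitv j))" by simp
  moreover have S1: "slice m \<sigma> p s n f \<in> ?S"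
    using slice_rel_ideal[OF p s L R f] by (intro fv.span_base) auto
  moreover have S2: "(\<Sum>j\<in>{1..m} - {i}. fscale (f (?w n j)) (unitv j)) \<in> ?S"
  proof (rule fv.span_sum)
    fix j assume j: "j \<in> {1..m} - {i}"
    show "fscale (f (?w n j)) (unitv j) \<in> ?S"
    proof (cases "j < i")
      case True
      then show ?thesis unfolding near[OF True] fv.scale_zero_left by (intro fv.span_zero)
    next
      case False
      then show ?thesis using j by (intro fv.span_scale fv.span_base) auto
    qed
  qed
  ultimately have "fscale (f (?w n i)) (unitv i) \<in> ?S" by (simp only: fv.span_diff)
  then have "fscale (inverse (f (?w n i))) (fscale (f (?w n i)) (unitv i)) \<in> ?S" by (rule fv.span_scale)
  then show ?thesis
    unfolding killed_letter_def fv.scale_scale using lead'(1) by simp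
qed

lemma normal_words_eq:
  fixes L :: "(nat \<Rightarrow> 'k::field) set"
  assumes L: "L \<subseteq> vecs m" and R: "R \<subseteq> vecs m"
  shows "normal_words m L R \<sigma> = (\<Union>p\<in>{[], [Ag]}. \<Union>s\<in>{[], [Bg]}.
      (@) p ` ({replicate n Cg @ s | n. n \<in> UNIV}
        \<union> (\<Union>i\<in>{1..m}. {replicate n Cg @ (Xg i # s) | n. n \<in> {n. \<not> killed_letter m L R \<sigma> p s i n}})))"
    (is "_ = (\<Union>p\<in>_. \<Union>s\<in>_. (@) p ` ?M p s)" is "_ = ?N")
proof
  show "normal_words m L R \<sigma> \<subseteq> ?N"
  proof
    fix w assume w: "w \<in> normal_words m L R \<sigma>"
    then have wg: "w \<in> lists (gens m)" by (simp add: normal_words_def)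
    from wg show "w \<in> ?N"
    proof (cases rule: word_shape)
      case (X_free p n s)
      have "replicate n Cg @ s \<in> ?M p s" by (rule UnI1) auto
      then show ?thesis
        unfolding X_free(3) by (intro UN_I[OF X_free(1)] UN_I[OF X_free(2)] imageI)
    next
      case (one_X p n i s)
      then have "\<not> killed_letter m L R \<sigma> p s i n" using killed_letter_not_normal[OF _ _ L] w by blast
      then have "replicate n Cg @ (Xg i # s) \<in> ?M p s"
        by (intro UnI2 UN_I[OF one_X(3)]) auto
      then have "p @ (replicate n Cg @ (Xg i # s)) \<in> ?N"
        by (intro UN_I[OF one_X(1)] UN_I[OF one_X(2)] imageI)
      then show ?thesis using one_X(4) by simp
    next
      case (XX u i j v)
      have "mon [Xg i, Xg j] \<in> relations m L R \<sigma>" unfolding relations_def using XX(1,2) by blast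
      from monomial_relation_not_normal[OF this, of u v] show ?thesis using wg w XX(3) by simp
    next
      case (A u y v)
      then have "y \<in> gens m" using wg by simp
      then have "mon [y, Ag] \<in> relations m L R \<sigma>" unfolding relations_def by blast
      from monomial_relation_not_normal[OF this, of u v] show ?thesis using wg w A by simp
    next
      case (B u y v)
      then have "y \<in> gens m" using wg by simp
      then have "mon [Bg, y] \<in> relations m L R \<sigma>" unfolding relations_def by blast
      from monomial_relation_not_normal[OF this, of u v] show ?thesis using wg w B by simp
    next
      case (XC u i v)
      then show ?thesis using XC_not_normal[of i m u v L R \<sigma>] wg w by simp
    qed
  qed
  show "?N \<subseteq> normal_words m L R \<sigma>"
  proof
    fix w assume "w \<in> ?N"
    then obtain p s x where p: "p \<in> {[], [Ag]}" and s: "s \<in> {[], [Bg]}" and x: "x \<in> ?M p s" "w = p @ x"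
      by (elim UN_E imageE) (rule that)
    from x obtain n where w: "w = p @ replicate n Cg @ s
        \<or> (\<exists>i\<in>{1..m}. w = p @ replicate n Cg @ [Xg i] @ s \<and> \<not> killed_letter m L R \<sigma> p s i n)"
      by auto
    have "w \<in> lists (gens m)" using p s w by (auto simp: gens_def)
    moreover have "\<not> is_leading_word m f w" if f: "f \<in> rel_ideal m L R \<sigma>" for f
      using w
    proof
      assume "w = p @ replicate n Cg @ s"
      then show ?thesis using rel_ideal_X_free[OF p s f, of n] by (simp add: is_leading_word_def)
    next
      assume "\<exists>i\<in>{1..m}. w = p @ replicate n Cg @ [Xg i] @ s \<and> \<not> killed_letter m L R \<sigma> p s i n"
      then show ?thesis using leading_letter_killed[OF p s L R _ f] by blast
    qed
    ultimately show "w \<in> normal_words m L R \<sigma>" by (auto simp: normal_words_def)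
  qed
qed

text \<open>\<open>L\<close> and \<open>R\<close> are replaced by finite spanning lists. Only the
  part from \<open>L\<close> moves with \<open>n\<close>; the letters after x_i join the fixed
  vectors \<open>Xs\<close>.\<close>

lemma killed_letter_eventually_periodic:
  fixes L :: "(nat \<Rightarrow> 'k::field_char_0) set"
  assumes L: "is_subspace m L" and R: "is_subspace m R" and i: "i \<in> {1..m}"
  shows "eventually_periodic {n. killed_letter m L R \<sigma> p s i n}"
proof -
  obtain Ls where Ls: "set Ls \<subseteq> L" "L \<subseteq> fv.span (set Ls)" by (rule subspace_finite_basis[OF L])
  obtain Rs where Rs: "set Rs \<subseteq> R" "R \<subseteq> fv.span (set Rs)" by (rule subspace_finite_basis[OF R])
  define Ls' where "Ls' = (if p = [] then [] else Ls)"
  define Xs where "Xs = (if s = [] then [] else Rs) @ map unitv [Suc i..<Suc m]"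
  have XV: "set (map unitv [Suc i..<Suc m]) = unitv ` {i<..m}" by auto
  have "fv.span (killed_vecs m L R \<sigma> p s n \<union> unitv ` {i<..m})
      = fv.span ((matrix_map m \<sigma> ^^ n) ` set Ls' \<union> set Xs)" (is "fv.span ?X = fv.span ?Y") for n
  proof -
    interpret module_hom fscale fscale "matrix_map m \<sigma> ^^ n" by (rule funpow_matrix_map_hom)
    have "(matrix_map m \<sigma> ^^ n) ` L \<subseteq> fv.span ?Y" if "p \<noteq> []"
    proof -
      have "(matrix_map m \<sigma> ^^ n) ` L \<subseteq> fv.span ((matrix_map m \<sigma> ^^ n) ` set Ls)"
        unfolding span_image using Ls(2) by (rule image_mono)
      also have "\<dots> \<subseteq> fv.span ?Y" using that by (intro fv.span_mono) (auto simp: Ls'_def)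
      finally show ?thesis .
    qed
    moreover have "R \<subseteq> fv.span ?Y" if "s \<noteq> []"
      using Rs(2) fv.span_mono[of "set Rs" ?Y] that by (auto simp: Xs_def)
    ultimately have "killed_vecs m L R \<sigma> p s n \<subseteq> fv.span ?Y"
      unfolding killed_vecs_def by (intro fv.span_minimal fv.subspace_span) auto
    moreover have "unitv ` {i<..m} \<subseteq> ?Y" unfolding Xs_def set_append XV by auto
    then have "unitv ` {i<..m} \<subseteq> fv.span ?Y" using fv.span_superset by blast
    moreover have "?Y \<subseteq> fv.span ?X"
    proof -
      have "(matrix_map m \<sigma> ^^ n) ` set Ls' \<union> set (if s = [] then [] else Rs) \<subseteq> killed_vecs m L R \<sigma> p s n"
        unfolding killed_vecs_def using Ls(1) Rs(1) fv.span_superset by (fastforce simp: Ls'_def)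
      then have "?Y \<subseteq> ?X" unfolding Xs_def set_append XV by auto
      then show ?thesis using fv.span_superset by blast
    qed
    ultimately show ?thesis unfolding fv.span_eq by simp
  qed
  moreover have "eventually_periodic {n. unitv i \<in> fv.span ((matrix_map m \<sigma> ^^ n) ` set Ls' \<union> set Xs)}"
  proof (rule span_orbit_eventually_periodic)
    show "set Ls' \<subseteq> vecs m" using Ls(1) L by (auto simp: Ls'_def is_subspace_def)
    show "set Xs \<subseteq> vecs m"
      using Rs(1) R by (auto simp: Xs_def is_subspace_def intro!: unitv_in_vecs)
    show "unitv i \<in> vecs m" using i by (rule unitv_in_vecs)
  qed
  ultimately show ?thesis by (simp add: killed_letter_def)
qed

theorem theorem4p5:
  fixes m :: nat and L R :: "(nat \<Rightarrow> 'k::field_char_0) set"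
    and \<sigma> :: "(nat \<Rightarrow> 'k) \<Rightarrow> (nat \<Rightarrow> 'k)"
  assumes "m \<ge> 1" and "is_subspace m L" and "is_subspace m R" and "is_lin_endo m \<sigma>"
  shows "regular_lang (gens m) (normal_words m L R \<sigma>)"
proof (rule finite_quotients_imp_regular)
  show "normal_words m L R \<sigma> \<subseteq> lists (gens m)" by (auto simp: normal_words_def)
  have LR: "L \<subseteq> vecs m" "R \<subseteq> vecs m" using assms(2,3) by (auto simp: is_subspace_def)
  \<comment> \<open>For the words without x, whose exponents are unrestricted.\<close>
  have "eventually_periodic UNIV" by (auto simp: eventually_periodic_def)
  then show "finite_quotients (normal_words m L R \<sigma>)"
    unfolding normal_words_eq[OF LR]
    by (intro finite_quotients_UN finite_quotients_prepend finite_quotients_Un finite_quotients_replicate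
        eventually_periodic_Not killed_letter_eventually_periodic assms) auto
qed

end
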